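(* Let $h\colon L^2\to\mathbb{R}^{n+1}$, $n\geq 3$, be a surface with flat normal bundle and let $X,Y\in\mathfrak{X}(L)$ be an orthonormal frame (for the metric induced by $h$) that diagonalizes the second fundamental form of $h$. Assume that the integral curves of $X$ and $Y$ are nowhere geodesics and that the integral curves of $X$ are nowhere asymptotic. Then the map $g\colon L^2\to\mathbb{S}^n\subset\mathbb{R}^{n+1}$ given by $g=h_*X$ defines a surface of type $D$. Conversely, any surface of type $D$ in $\mathbb{S}^n$ can be locally constructed in this way.
   Context: All objects are smooth; surfaces are immersions and $L^2$ is endowed with the induced metric under consideration. For a surface $h$ with second fundamental form $\alpha_h$ and induced Levi-Civita connection $\nabla^h$, the orthonormal frame $X,Y$ diagonalizes $\alpha_h$ if $\alpha_h(X,Y)=0$; the integral curves of $X$ (resp. $Y$) are nowhere geodesics if $\nabla^h_XX\neq0$ (resp. $\nabla^h_YY\neq 0$) at every point; the integral curves of $X$ are nowhere asymptotic if $\alpha_h(X,X)\neq0$ at every point. The vector $h_*X$ is regarded as a point of the unit sphere $\mathbb{S}^n\subset\mathbb{R}^{n+1}$. A surface $g\colon L^2\to\mathbb{S}^n$, $n\geq3$, is of type $D$ if there exist linearly independent vector fields $X_g,Y_g\in\mathfrak{X}(L)$ with $\|Y_g\|=1$ (in the metric induced by $g$) such that everywhere (i) $\langle X_g,Y_g\rangle_g\neq0$, (ii) $\nabla^g_{X_g}Y_g=0$, (iii) $\alpha_g(X_g,Y_g)=0$, where $\nabla^g$ is the Levi-Civita connection of the metric induced by $g$ and $\alpha_g$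 is the second fundamental form of $g$ in $\mathbb{S}^n$. "Locally constructed in this way" means: every point of $L^2$ has a neighborhood $U$ for which there are a surface $h\colon U\to\mathbb{R}^{n+1}$ with flat normal bundle and a frame $X,Y$ satisfying all the assumptions of the direct statement such that $g|_U=h_*X$. *)

theory Defs
  imports "HOL-Analysis.Analysis"
begin

text \<open>The next two notions are only meant for open \<open>S\<close>.\<close>

fun Ck_on :: "nat \<Rightarrow> ('a::real_normed_vector \<Rightarrow> 'b::real_normed_vector) \<Rightarrow> 'a set \<Rightarrow> bool" where
  "Ck_on 0 f S \<longleftrightarrow> continuous_on S f"
| "Ck_on (Suc k) f S \<longleftrightarrow>
     (\<forall>x\<in>S. f differentiable (at x)) \<and>
     (\<forall>v. Ck_on k (\<lambda>x. frechet_derivative f (at x) v) S)"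

definition smooth_on :: "('a::real_normed_vector \<Rightarrow> 'b::real_normed_vector) \<Rightarrow> 'a set \<Rightarrow> bool" where
  "smooth_on f S \<longleftrightarrow> (\<forall>k. Ck_on k f S)"

text \<open>A chart is a pair \<open>(V, \<phi>)\<close> of a coordinate domain and a coordinate map. The manifold
  described by a set of charts is the union of their domains; the Hausdorff and second countability
  axioms are imposed through the type class of the points.\<close>

type_synonym 'p chart = "'p set \<times> ('p \<Rightarrow> real^2)"

abbreviation dom_chart :: "'p chart \<Rightarrow> 'p set" where
  "dom_chart c \<equiv> fst c"

abbreviation coord :: "'p chart \<Rightarrow> 'p \<Rightarrow> real^2" where
  "coord c \<equiv> snd c"

abbreviation cod_chart :: "'p chart \<Rightarrow> (real^2) set" where
  "cod_chart c \<equiv> coord c ` dom_chart c"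

definition inv_chart :: "'p chart \<Rightarrow> real^2 \<Rightarrow> 'p" where
  "inv_chart c = inv_into (dom_chart c) (coord c)"

definition points :: "'p chart set \<Rightarrow> 'p set" where
  "points A = (\<Union>c\<in>A. dom_chart c)"

definition smooth_atlas :: "('p::{t2_space,second_countable_topology}) chart set \<Rightarrow> bool" where
  "smooth_atlas A \<longleftrightarrow>
     (\<forall>c\<in>A. open (dom_chart c) \<and> open (cod_chart c) \<and>
        homeomorphism (dom_chart c) (cod_chart c) (coord c) (inv_chart c)) \<and>
     (\<forall>c\<in>A. \<forall>d\<in>A. smooth_on (coord d \<circ> inv_chart c) (coord c ` (dom_chart c \<inter> dom_chart d)))"

definition restrict_atlas :: "'p chart set \<Rightarrow> 'p set \<Rightarrow> 'p chart set" where
  "restrict_atlas A U = (\<lambda>(V, \<phi>). (V \<inter> U, \<phi>)) ` A"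

definition in_chart :: "'p chart \<Rightarrow> ('p \<Rightarrow> 'b) \<Rightarrow> real^2 \<Rightarrow> 'b" where
  "in_chart c f = f \<circ> inv_chart c"

definition smooth_map :: "'p chart set \<Rightarrow> ('p \<Rightarrow> 'b::real_normed_vector) \<Rightarrow> bool" where
  "smooth_map A f \<longleftrightarrow> (\<forall>c\<in>A. smooth_on (in_chart c f) (cod_chart c))"

text \<open>A vector field is given by its components with respect to every chart; these are smooth and
  transform under a change of coordinates by the Jacobian of the transition map.\<close>

type_synonym 'p vfield = "'p chart \<Rightarrow> 'p \<Rightarrow> real^2"

definition vector_field :: "'p chart set \<Rightarrow> 'p vfield \<Rightarrow> bool" where
  "vector_field A X \<longleftrightarrow>
     (\<forall>c\<in>A. smooth_on (in_chart c (X c)) (cod_chart c)) \<and>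
     (\<forall>c\<in>A. \<forall>d\<in>A. \<forall>p \<in> dom_chart c \<inter> dom_chart d.
        X d p = frechet_derivative (coord d \<circ> inv_chart c) (at (coord c p)) (X c p))"

definition vanishing :: "'p chart set \<Rightarrow> 'p vfield \<Rightarrow> bool" where
  "vanishing A X \<longleftrightarrow> (\<forall>c\<in>A. \<forall>p\<in>dom_chart c. X c p = 0)"

definition nowhere_vanishing :: "'p chart set \<Rightarrow> 'p vfield \<Rightarrow> bool" where
  "nowhere_vanishing A X \<longleftrightarrow> (\<forall>c\<in>A. \<forall>p\<in>dom_chart c. X c p \<noteq> 0)"

definition linearly_independent :: "'p chart set \<Rightarrow> 'p vfield \<Rightarrow> 'p vfield \<Rightarrow> bool" where
  "linearly_independent A X Y \<longleftrightarrow>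
     (\<forall>c\<in>A. \<forall>p\<in>dom_chart c. \<forall>a b. a *\<^sub>R X c p + b *\<^sub>R Y c p = 0 \<longrightarrow> a = 0 \<and> b = 0)"

definition lie_bracket :: "'p vfield \<Rightarrow> 'p vfield \<Rightarrow> 'p vfield" where
  "lie_bracket X Y = (\<lambda>c p.
     frechet_derivative (in_chart c (Y c)) (at (coord c p)) (X c p) -
     frechet_derivative (in_chart c (X c)) (at (coord c p)) (Y c p))"

definition chart_at :: "'p chart set \<Rightarrow> 'p \<Rightarrow> 'p chart" where
  "chart_at A p = (SOME c. c \<in> A \<and> p \<in> dom_chart c)"

text \<open>The differential of \<open>f\<close> along \<open>X\<close>, computed in some chart (for a vector field \<open>X\<close> and a smooth
  map \<open>f\<close> the choice is immaterial). For an immersion \<open>f\<close> into a Euclidean space this is \<open>f\<^sub>*X\<close>; for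
  a map \<open>V\<close> regarded as a field of ambient vectors along the surface, it is also the covariant
  derivative of \<open>V\<close> along \<open>X\<close> with respect to the flat connection of the ambient space.\<close>

definition pushforward ::
  "'p chart set \<Rightarrow> ('p \<Rightarrow> 'b::real_normed_vector) \<Rightarrow> 'p vfield \<Rightarrow> 'p \<Rightarrow> 'b" where
  "pushforward A f X p = (let c = chart_at A p in
     frechet_derivative (in_chart c f) (at (coord c p)) (X c p))"

definition tangent_plane ::
  "'p chart set \<Rightarrow> ('p \<Rightarrow> 'b::real_normed_vector) \<Rightarrow> 'p \<Rightarrow> 'b set" where
  "tangent_plane A f p = (let c = chart_at A p in
     range (frechet_derivative (in_chart c f) (at (coord c p))))"

definition immersion :: "'p chart set \<Rightarrow> ('p \<Rightarrow> 'b::real_normed_vector) \<Rightarrow> bool" where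
  "immersion A f \<longleftrightarrow> smooth_map A f \<and>
     (\<forall>c\<in>A. \<forall>p\<in>dom_chart c. inj (frechet_derivative (in_chart c f) (at (coord c p))))"

definition induced_inner ::
  "'p chart set \<Rightarrow> ('p \<Rightarrow> 'b::euclidean_space) \<Rightarrow> 'p vfield \<Rightarrow> 'p vfield \<Rightarrow> 'p \<Rightarrow> real" where
  "induced_inner A f X Y p = pushforward A f X p \<bullet> pushforward A f Y p"

definition partial :: "2 \<Rightarrow> (real^2 \<Rightarrow> 'b::real_normed_vector) \<Rightarrow> real^2 \<Rightarrow> 'b" where
  "partial i F x = frechet_derivative F (at x) (axis i 1)"

definition metric_coeff :: "'p chart \<Rightarrow> ('p \<Rightarrow> 'b::euclidean_space) \<Rightarrow> real^2 \<Rightarrow> real^2^2" where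
  "metric_coeff c f x = (\<chi> i j. partial i (in_chart c f) x \<bullet> partial j (in_chart c f) x)"

definition christoffel ::
  "'p chart \<Rightarrow> ('p \<Rightarrow> 'b::euclidean_space) \<Rightarrow> 2 \<Rightarrow> 2 \<Rightarrow> 2 \<Rightarrow> real^2 \<Rightarrow> real" where
  "christoffel c f k i j x = (\<Sum>l\<in>UNIV. matrix_inv (metric_coeff c f x) $ k $ l *
     (partial i (\<lambda>y. metric_coeff c f y $ j $ l) x +
      partial j (\<lambda>y. metric_coeff c f y $ i $ l) x -
      partial l (\<lambda>y. metric_coeff c f y $ i $ j) x)) / 2"

text \<open>The covariant derivative \<open>\<nabla>\<^sub>X Y\<close> for the Levi-Civita connection of the metric induced by \<open>f\<close>.\<close>

definition levi_civita ::
  "('p \<Rightarrow> 'b::euclidean_space) \<Rightarrow> 'p vfield \<Rightarrow> 'p vfield \<Rightarrow> 'p vfield" where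
  "levi_civita f X Y = (\<lambda>c p. \<chi> k.
     frechet_derivative (in_chart c (Y c)) (at (coord c p)) (X c p) $ k +
     (\<Sum>i\<in>UNIV. \<Sum>j\<in>UNIV. christoffel c f k i j (coord c p) * X c p $ i * Y c p $ j))"

text \<open>Gauss formula for an immersion into a Euclidean space.\<close>

definition second_ff :: "'p chart set \<Rightarrow> ('p \<Rightarrow> 'b::euclidean_space) \<Rightarrow>
    'p vfield \<Rightarrow> 'p vfield \<Rightarrow> 'p \<Rightarrow> 'b" where
  "second_ff A f X Y p =
     pushforward A (pushforward A f Y) X p - pushforward A f (levi_civita f X Y) p"

text \<open>Gauss formula for an immersion into the unit sphere: the Levi-Civita connection of the sphere
  is the component, orthogonal to the position vector, of the flat connection.\<close>

definition sphere_second_ff :: "'p chart set \<Rightarrow> ('p \<Rightarrow> 'b::euclidean_space) \<Rightarrow>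
    'p vfield \<Rightarrow> 'p vfield \<Rightarrow> 'p \<Rightarrow> 'b" where
  "sphere_second_ff A g X Y p =
     (let w = pushforward A (pushforward A g Y) X p in
      (w - (w \<bullet> g p) *\<^sub>R g p) - pushforward A g (levi_civita g X Y) p)"

definition normal_component :: "'b::euclidean_space set \<Rightarrow> 'b \<Rightarrow> 'b" where
  "normal_component T v = (THE w. w \<in> T\<^sup>\<bottom> \<and> v - w \<in> T)"

definition normal_field :: "'p chart set \<Rightarrow> ('p \<Rightarrow> 'b::euclidean_space) \<Rightarrow> ('p \<Rightarrow> 'b) \<Rightarrow> bool" where
  "normal_field A f \<xi> \<longleftrightarrow> smooth_map A \<xi> \<and> (\<forall>p\<in>points A. \<xi> p \<in> (tangent_plane A f p)\<^sup>\<bottom>)"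

definition normal_connection :: "'p chart set \<Rightarrow> ('p \<Rightarrow> 'b::euclidean_space) \<Rightarrow>
    'p vfield \<Rightarrow> ('p \<Rightarrow> 'b) \<Rightarrow> 'p \<Rightarrow> 'b" where
  "normal_connection A f X \<xi> p = normal_component (tangent_plane A f p) (pushforward A \<xi> X p)"

definition normal_curvature :: "'p chart set \<Rightarrow> ('p \<Rightarrow> 'b::euclidean_space) \<Rightarrow>
    'p vfield \<Rightarrow> 'p vfield \<Rightarrow> ('p \<Rightarrow> 'b) \<Rightarrow> 'p \<Rightarrow> 'b" where
  "normal_curvature A f X Y \<xi> p =
     normal_connection A f X (normal_connection A f Y \<xi>) p -
     normal_connection A f Y (normal_connection A f X \<xi>) p -
     normal_connection A f (lie_bracket X Y) \<xi> p"

definition flat_normal_bundle :: "'p chart set \<Rightarrow> ('p \<Rightarrow> 'b::euclidean_space) \<Rightarrow> bool" where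
  "flat_normal_bundle A f \<longleftrightarrow>
     (\<forall>X Y \<xi>. vector_field A X \<and> vector_field A Y \<and> normal_field A f \<xi> \<longrightarrow>
        (\<forall>p\<in>points A. normal_curvature A f X Y \<xi> p = 0))"

definition type_D :: "'p chart set \<Rightarrow> ('p \<Rightarrow> 'b::euclidean_space) \<Rightarrow> bool" where
  "type_D A g \<longleftrightarrow>
     immersion A g \<and> g ` points A \<subseteq> sphere 0 1 \<and>
     (\<exists>X Y. vector_field A X \<and> vector_field A Y \<and> linearly_independent A X Y \<and>
        (\<forall>p\<in>points A. norm (pushforward A g Y p) = 1) \<and>
        (\<forall>p\<in>points A. induced_inner A g X Y p \<noteq> 0) \<and>
        vanishing A (levi_civita g X Y) \<and>
        (\<forall>p\<in>points A. sphere_second_ff A g X Y p = 0))"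

definition orthonormal_frame ::
  "'p chart set \<Rightarrow> ('p \<Rightarrow> 'b::euclidean_space) \<Rightarrow> 'p vfield \<Rightarrow> 'p vfield \<Rightarrow> bool" where
  "orthonormal_frame A h X Y \<longleftrightarrow> vector_field A X \<and> vector_field A Y \<and>
     (\<forall>p\<in>points A. induced_inner A h X X p = 1 \<and> induced_inner A h Y Y p = 1 \<and>
        induced_inner A h X Y p = 0)"

definition generating_data ::
  "'p chart set \<Rightarrow> ('p \<Rightarrow> 'b::euclidean_space) \<Rightarrow> 'p vfield \<Rightarrow> 'p vfield \<Rightarrow> bool" where
  "generating_data A h X Y \<longleftrightarrow>
     immersion A h \<and> flat_normal_bundle A h \<and> orthonormal_frame A h X Y \<and>
     (\<forall>p\<in>points A. second_ff A h X Y p = 0) \<and>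
     nowhere_vanishing A (levi_civita h X X) \<and> nowhere_vanishing A (levi_civita h Y Y) \<and>
     (\<forall>p\<in>points A. second_ff A h X X p \<noteq> 0)"

end

theory Submission
  imports Defs
begin

text \<open>Put \<open>g = h\<^sub>*X\<close> and \<open>e = h\<^sub>*Y\<close>. Since the frame diagonalizes the second fundamental form, the flat
  derivatives are \<open>D\<^sub>Y g = \<beta> e\<close> and \<open>D\<^sub>X e = - a g\<close>, where \<open>a\<close> and \<open>\<beta>\<close> are, up to sign, the geodesic
  curvatures of the integral curves of \<open>X\<close> and \<open>Y\<close>. So \<open>X\<close> and \<open>Y / \<beta>\<close> exhibit \<open>g\<close> as a surface of type \<open>D\<close>:
  the derivative of \<open>g\<^sub>*(Y / \<beta>) = e\<close> along \<open>X\<close> is radial.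

  Conversely, for \<open>g\<close> of type \<open>D\<close> with fields \<open>X, Y\<close>, put \<open>e = g\<^sub>*Y\<close> and \<open>m = \<langle>X, Y\<rangle>\<close>; then \<open>D\<^sub>X e = - m g\<close>, and
  one looks for \<open>h\<close> with \<open>h\<^sub>*X = p g\<close> and \<open>h\<^sub>*Y = q e\<close>, the orthonormal frame for \<open>h\<close> being \<open>X / p, Y / q\<close>.
  The integrability condition is a linear hyperbolic system for \<open>p, q\<close> whose characteristics are the integral
  curves of \<open>X\<close> and \<open>Y\<close>. The characteristic coordinates, \<open>p\<close>, \<open>q\<close> and \<open>h\<close> are found together as the solution of one
  system of Volterra integral equations, by contraction and a bootstrap of regularity. The normal bundle
  of \<open>h\<close> is flat by the Ricci equation.\<close>

section \<open>Calculus of smooth maps on open sets\<close>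

text \<open>Write \<open>[X, Y] = c1 X + c2 Y\<close>. Equality of the mixed derivatives of
  \<open>h\<close> then reads \<open>X(q) = p + c2 q\<close> and \<open>Y(p) = - m q - c1 p\<close>:
  each unknown is differentiated in one direction only, so the natural data are values on two
  crossing characteristics (a Goursat problem), and integrating from the axes gives Volterra
  equations. As \<open>X\<close> and \<open>Y\<close> need not commute, the coordinates
  \<open>u, v\<close> along them come with unknown speeds; making these speeds unknowns too keeps
  the system autonomous. The main obstacle is regularity: an unknown given as an integral in
  \<open>v\<close> has no visible \<open>u\<close>-derivative, so this derivative is produced as the
  solution of the linearized equation, and smoothness is gained one order at a time. All speeds and
  coefficients start at 1, hence are nonzero near the base point. The three conditions on
  \<open>h\<close> match three facts about \<open>g\<close>: the curves of \<open>X\<close> are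
  nowhere geodesic because \<open>m\<close> is nonzero, those of \<open>Y\<close> because
  \<open>D_Y g\<close> is exactly \<open>e\<close>, and those of \<open>X\<close> are nowhere
  asymptotic because the differential of \<open>g\<close> is injective.\<close>

lemma Ck_on_cong:
  assumes "open S" "\<And>x. x \<in> S \<Longrightarrow> f x = g x"
  shows "Ck_on k f S \<longleftrightarrow> Ck_on k g S"
  using assms(2)
proof (induction k arbitrary: f g)
  case 0
  then show ?case by (simp cong: continuous_on_cong)
next
  case (Suc k)
  have D: "(f has_derivative D) (at x) \<longleftrightarrow> (g has_derivative D) (at x)" if "x \<in> S" for x D
    using has_derivative_transform_within_open[of f D x UNIV S g]
      has_derivative_transform_within_open[of g D x UNIV S f] assms(1) Suc.prems that by auto
  have "frechet_derivative f (at x) = frechet_derivative g (at x)" if "x \<in> S" for x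
    unfolding frechet_derivative_def using D[OF that] by simp
  moreover have "f differentiable (at x) \<longleftrightarrow> g differentiable (at x)" if "x \<in> S" for x
    unfolding differentiable_def using D[OF that] by simp
  moreover have "Ck_on k (\<lambda>x. frechet_derivative f (at x) v) S \<longleftrightarrow> Ck_on k (\<lambda>x. frechet_derivative g (at x) v) S" for v
    by (rule Suc.IH) (simp add: calculation)
  ultimately show ?case by (simp only: Ck_on.simps(2) cong: ball_cong)
qed

text \<open>\<open>frechet_derivative\<close> is a choice operator; uniqueness of the derivative
  lets each induction step below exhibit its own derivative \<open>f'\<close> instead.\<close>

lemma Ck_on_SucI:
  assumes "open S" "\<And>x. x \<in> S \<Longrightarrow> (f has_derivative f' x) (at x)"
    "\<And>v. Ck_on k (\<lambda>x. f' x v) S"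
  shows "Ck_on (Suc k) f S"
proof -
  have "frechet_derivative f (at x) = f' x" if "x \<in> S" for x
    using assms(2)[OF that] frechet_derivative_at by metis
  then have "Ck_on k (\<lambda>x. frechet_derivative f (at x) v) S" for v
    using Ck_on_cong[OF assms(1), of "\<lambda>x. frechet_derivative f (at x) v" "\<lambda>x. f' x v"] assms(3) by simp
  then show ?thesis
    using assms(2) by (auto simp: differentiable_def)
qed

lemma Ck_on_subset: "Ck_on k f S \<Longrightarrow> T \<subseteq> S \<Longrightarrow> Ck_on k f T"
  by (induction k arbitrary: f) (auto intro: continuous_on_subset)

lemma Ck_on_has_derivative:
  "Ck_on (Suc k) f S \<Longrightarrow> x \<in> S \<Longrightarrow> (f has_derivative frechet_derivative f (at x)) (at x)"
  by (simp add: frechet_derivative_works)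

lemma Ck_on_Suc_imp: "Ck_on (Suc k) f S \<Longrightarrow> Ck_on k f S"
proof (induction k arbitrary: f)
  case 0
  then show ?case
    by (auto intro!: continuous_at_imp_continuous_on differentiable_imp_continuous_within)
next
  case (Suc k)
  have "Ck_on k (\<lambda>x. frechet_derivative f (at x) v) S" for v
    using Suc.prems unfolding Ck_on.simps(2)[of "Suc k"] by (intro Suc.IH) blast
  then show ?case using Suc.prems by simp
qed

lemma Ck_on_le: "Ck_on k f S \<Longrightarrow> j \<le> k \<Longrightarrow> Ck_on j f S"
proof (induction k)
  case (Suc k)
  then show ?case by (cases "j = Suc k") (auto dest: Ck_on_Suc_imp simp del: Ck_on.simps)
qed simp

lemma Ck_on_continuous: "Ck_on k f S \<Longrightarrow> continuous_on S f"
  using Ck_on_le[of k f S 0] by simp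

lemma Ck_on_const: "open S \<Longrightarrow> Ck_on k (\<lambda>x. c) S"
proof (induction k arbitrary: c)
  case (Suc k)
  show ?case
    by (rule Ck_on_SucI[where f'="\<lambda>x v. 0"]) (use Suc in \<open>auto intro!: derivative_eq_intros\<close>)
qed simp

lemma Ck_on_bounded_linear:
  assumes "bounded_linear L" "open S" "Ck_on k f S"
  shows "Ck_on k (\<lambda>x. L (f x)) S"
  using assms(3)
proof (induction k arbitrary: f)
  case 0
  then show ?case
    using assms(1) by (auto intro: bounded_linear.continuous_on)
next
  case (Suc k)
  show ?case
  proof (rule Ck_on_SucI[OF assms(2)])
    show "((\<lambda>x. L (f x)) has_derivative (\<lambda>v. L (frechet_derivative f (at x) v))) (at x)"
      if "x \<in> S" for x
      using bounded_linear.has_derivative[OF assms(1) Ck_on_has_derivative[OF Suc.prems that]] .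
    show "Ck_on k (\<lambda>x. L (frechet_derivative f (at x) v)) S" for v
      using Suc by simp
  qed
qed

lemma Ck_on_id: "open S \<Longrightarrow> Ck_on k (\<lambda>x. x) S"
  by (cases k) (auto intro!: Ck_on_SucI[where f'="\<lambda>x v. v"] Ck_on_const)

lemma Ck_on_add:
  assumes "open S" "Ck_on k f S" "Ck_on k g S"
  shows "Ck_on k (\<lambda>x. f x + g x) S"
  using assms(2,3)
proof (induction k arbitrary: f g)
  case (Suc k)
  show ?case
    by (rule Ck_on_SucI[OF assms(1) has_derivative_add[OF Ck_on_has_derivative Ck_on_has_derivative]])
       (use Suc in auto)
qed (auto intro: continuous_intros)

lemma Ck_on_bilinear:
  assumes "bounded_bilinear B" "open S" "Ck_on k f S" "Ck_on k g S"
  shows "Ck_on k (\<lambda>x. B (f x) (g x)) S"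
  using assms(3,4)
proof (induction k arbitrary: f g)
  case 0
  then show ?case using assms(1) by (auto intro: bounded_bilinear.continuous_on)
next
  case (Suc k)
  note low = Suc.prems[THEN Ck_on_Suc_imp]
  show ?case
  proof (rule Ck_on_SucI[OF assms(2) bounded_bilinear.FDERIV[OF assms(1) Ck_on_has_derivative Ck_on_has_derivative]])
    show "Ck_on k (\<lambda>x. B (f x) (frechet_derivative g (at x) v) + B (frechet_derivative f (at x) v) (g x)) S" for v
      by (rule Ck_on_add[OF assms(2) Suc.IH Suc.IH]) (use low Suc.prems in simp_all)
  qed (use Suc.prems in auto)
qed

lemma Ck_on_sum:
  assumes "open S" "\<And>i. i \<in> I \<Longrightarrow> Ck_on k (f i) S"
  shows "Ck_on k (\<lambda>x. \<Sum>i\<in>I. f i x) S"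
  using assms(2)
  by (induction I rule: infinite_finite_induct) (auto intro: Ck_on_const Ck_on_add assms(1))

lemma Ck_on_Pair:
  assumes "open S" "Ck_on k f S" "Ck_on k g S"
  shows "Ck_on k (\<lambda>x. (f x, g x)) S"
proof -
  have "Ck_on k (\<lambda>x. (f x, 0) + (0, g x)) S"
  proof (rule Ck_on_add[OF assms(1)])
    show "Ck_on k (\<lambda>x. (f x, 0)) S"
      by (rule Ck_on_bounded_linear[OF bounded_linear_Pair[OF bounded_linear_ident bounded_linear_zero] assms(1,2)])
    show "Ck_on k (\<lambda>x. (0, g x)) S"
      by (rule Ck_on_bounded_linear[OF bounded_linear_Pair[OF bounded_linear_zero bounded_linear_ident] assms(1,3)])
  qed
  then show ?thesis by simp
qed

lemma linear_euclidean_expand: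
  fixes a :: "'a::euclidean_space"
  assumes "linear L"
  shows "L a = (\<Sum>b\<in>Basis. (a \<bullet> b) *\<^sub>R L b)"
proof -
  have "L (\<Sum>b\<in>Basis. (a \<bullet> b) *\<^sub>R b) = (\<Sum>b\<in>Basis. (a \<bullet> b) *\<^sub>R L b)"
    using assms by (simp add: linear_sum linear_scale)
  then show ?thesis by (simp add: euclidean_representation)
qed

text \<open>Regularity of a field of linear maps is known only vector by vector, as in
  \<open>Ck_on\<close>. Expanding a moving argument in a finite basis turns its image into a finite
  sum of products.\<close>

lemma Ck_on_linear_apply:
  fixes g :: "'a::real_normed_vector \<Rightarrow> 'b::euclidean_space"
  assumes "open S" "\<And>x. x \<in> S \<Longrightarrow> linear (L x)" "\<And>v. Ck_on k (\<lambda>x. L x v) S" "Ck_on k g S"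
  shows "Ck_on k (\<lambda>x. L x (g x)) S"
proof -
  have "Ck_on k (\<lambda>x. \<Sum>b\<in>Basis. (g x \<bullet> b) *\<^sub>R L x b) S"
    by (intro Ck_on_sum assms Ck_on_bilinear[OF bounded_bilinear_scaleR]
        Ck_on_bounded_linear[OF bounded_linear_inner_left])
  then show ?thesis
    using Ck_on_cong[OF assms(1), of "\<lambda>x. L x (g x)" "\<lambda>x. \<Sum>b\<in>Basis. (g x \<bullet> b) *\<^sub>R L x b"]
      linear_euclidean_expand[OF assms(2)] by blast
qed

text \<open>The chain rule feeds a moving vector into the derivative of \<open>g\<close>, so the
  step rests on \<open>Ck_on_linear_apply\<close>. The induction varies \<open>g\<close>, since its
  directional derivatives take its place.\<close>

lemma Ck_on_compose:
  fixes f :: "'a::real_normed_vector \<Rightarrow> 'b::euclidean_space"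
  assumes "open S" "Ck_on k f S" "Ck_on k g T" "f ` S \<subseteq> T"
  shows "Ck_on k (\<lambda>x. g (f x)) S"
  using assms(2,3)
proof (induction k arbitrary: g)
  case 0
  then show ?case
    using assms(4) continuous_on_compose2[of T g S f] by simp
next
  case (Suc k)
  have lin: "linear (frechet_derivative g (at (f x)))" if "x \<in> S" for x
    using Ck_on_has_derivative[OF Suc.prems(2)] that assms(4)
    by (auto dest!: has_derivative_linear)
  show ?case
  proof (rule Ck_on_SucI[OF assms(1)])
    show "((\<lambda>x. g (f x)) has_derivative
        (\<lambda>v. frechet_derivative g (at (f x)) (frechet_derivative f (at x) v))) (at x)" if "x \<in> S" for x
      using has_derivative_compose[OF Ck_on_has_derivative[OF Suc.prems(1) that]
          Ck_on_has_derivative[OF Suc.prems(2)]] that assms(4) by auto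
    show "Ck_on k (\<lambda>x. frechet_derivative g (at (f x)) (frechet_derivative f (at x) v)) S" for v
    proof (rule Ck_on_linear_apply[OF assms(1) lin])
      show "Ck_on k (\<lambda>x. frechet_derivative g (at (f x)) w) S" for w
        using Suc.IH[of "\<lambda>y. frechet_derivative g (at y) w"] Suc.prems Ck_on_Suc_imp[OF Suc.prems(1)] by simp
      show "Ck_on k (\<lambda>x. frechet_derivative f (at x) v) S"
        using Suc.prems by simp
    qed
  qed
qed

text \<open>The derivative of \<open>1/f\<close> contains \<open>1/f\<close> again, but there it is
  needed one order lower, which is the induction hypothesis.\<close>

lemma Ck_on_inverse:
  fixes f :: "'a::real_normed_vector \<Rightarrow> real"
  assumes "open S" "Ck_on k f S" "\<And>x. x \<in> S \<Longrightarrow> f x \<noteq> 0"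
  shows "Ck_on k (\<lambda>x. inverse (f x)) S"
  using assms(2)
proof (induction k)
  case 0
  then show ?case using assms by (auto intro: continuous_intros)
next
  case (Suc k)
  have I: "Ck_on k (\<lambda>x. inverse (f x)) S" using Suc Ck_on_Suc_imp by blast
  show ?case
  proof (rule Ck_on_SucI[OF assms(1)])
    show "((\<lambda>x. inverse (f x)) has_derivative
        (\<lambda>v. - (inverse (f x) * frechet_derivative f (at x) v * inverse (f x)))) (at x)" if "x \<in> S" for x
      using Deriv.has_derivative_inverse[OF assms(3)[OF that] Ck_on_has_derivative[OF Suc.prems that]] .
    show "Ck_on k (\<lambda>x. - (inverse (f x) * frechet_derivative f (at x) v * inverse (f x))) S" for v
      using I Suc.prems
      by (intro Ck_on_bounded_linear[OF bounded_linear_minus[OF bounded_linear_ident]]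
          Ck_on_bilinear[OF bounded_bilinear_mult] assms(1)) auto
  qed
qed

section \<open>Closure properties of smooth maps\<close>

lemma smooth_on_Ck: "smooth_on f S \<Longrightarrow> Ck_on k f S"
  by (simp add: smooth_on_def)

lemma smooth_on_cong:
  "open S \<Longrightarrow> (\<And>x. x \<in> S \<Longrightarrow> f x = g x) \<Longrightarrow> smooth_on f S \<longleftrightarrow> smooth_on g S"
  using Ck_on_cong[of S f g] by (auto simp: smooth_on_def)

lemma smooth_on_subset: "smooth_on f S \<Longrightarrow> T \<subseteq> S \<Longrightarrow> smooth_on f T"
  unfolding smooth_on_def by (blast intro: Ck_on_subset)

lemma smooth_on_continuous: "smooth_on f S \<Longrightarrow> continuous_on S f"
  using Ck_on_continuous by (auto simp: smooth_on_def)

lemma smooth_on_has_derivative: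
  "smooth_on f S \<Longrightarrow> x \<in> S \<Longrightarrow> (f has_derivative frechet_derivative f (at x)) (at x)"
  by (rule Ck_on_has_derivative[of 0]) (simp_all add: smooth_on_def del: Ck_on.simps)

lemma smooth_on_linear_derivative:
  "smooth_on f S \<Longrightarrow> x \<in> S \<Longrightarrow> linear (frechet_derivative f (at x))"
  using smooth_on_has_derivative has_derivative_linear by blast

lemma smooth_on_frechet_const: "smooth_on f S \<Longrightarrow> smooth_on (\<lambda>x. frechet_derivative f (at x) v) S"
  unfolding smooth_on_def by (metis Ck_on.simps(2))

named_theorems smooth_intros

lemma smooth_on_const[smooth_intros]: "open S \<Longrightarrow> smooth_on (\<lambda>x. c) S"
  and smooth_on_id[smooth_intros]: "open S \<Longrightarrow> smooth_on (\<lambda>x. x) S"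
  by (simp_all add: smooth_on_def Ck_on_const Ck_on_id)

lemma smooth_on_bounded_linear:
  "bounded_linear L \<Longrightarrow> open S \<Longrightarrow> smooth_on f S \<Longrightarrow> smooth_on (\<lambda>x. L (f x)) S"
  by (simp add: smooth_on_def Ck_on_bounded_linear)

lemma smooth_on_add[smooth_intros]:
  "open S \<Longrightarrow> smooth_on f S \<Longrightarrow> smooth_on g S \<Longrightarrow> smooth_on (\<lambda>x. f x + g x) S"
  by (simp add: smooth_on_def Ck_on_add)

lemma smooth_on_minus[smooth_intros]:
  "open S \<Longrightarrow> smooth_on f S \<Longrightarrow> smooth_on (\<lambda>x. - f x) S"
  by (rule smooth_on_bounded_linear[OF bounded_linear_minus[OF bounded_linear_ident]])

lemma smooth_on_diff[smooth_intros]: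
  "open S \<Longrightarrow> smooth_on f S \<Longrightarrow> smooth_on g S \<Longrightarrow> smooth_on (\<lambda>x. f x - g x) S"
  using smooth_on_add[OF _ _ smooth_on_minus, of S f g] by simp

lemma smooth_on_scaleR[smooth_intros]:
  "open S \<Longrightarrow> smooth_on f S \<Longrightarrow> smooth_on g S \<Longrightarrow> smooth_on (\<lambda>x. f x *\<^sub>R g x) S"
  by (simp add: smooth_on_def Ck_on_bilinear[OF bounded_bilinear_scaleR])

lemma smooth_on_mult[smooth_intros]:
  fixes f g :: "'a::real_normed_vector \<Rightarrow> real"
  shows "open S \<Longrightarrow> smooth_on f S \<Longrightarrow> smooth_on g S \<Longrightarrow> smooth_on (\<lambda>x. f x * g x) S"
  by (simp add: smooth_on_def Ck_on_bilinear[OF bounded_bilinear_mult])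

lemma smooth_on_inner[smooth_intros]:
  "open S \<Longrightarrow> smooth_on f S \<Longrightarrow> smooth_on g S \<Longrightarrow> smooth_on (\<lambda>x. f x \<bullet> g x) S"
  by (simp add: smooth_on_def Ck_on_bilinear[OF bounded_bilinear_inner])

lemma smooth_on_Pair[smooth_intros]:
  "open S \<Longrightarrow> smooth_on f S \<Longrightarrow> smooth_on g S \<Longrightarrow> smooth_on (\<lambda>x. (f x, g x)) S"
  by (simp add: smooth_on_def Ck_on_Pair)

lemma smooth_on_fst[smooth_intros]:
  "open S \<Longrightarrow> smooth_on f S \<Longrightarrow> smooth_on (\<lambda>x. fst (f x)) S"
  and smooth_on_snd[smooth_intros]:
  "open S \<Longrightarrow> smooth_on f S \<Longrightarrow> smooth_on (\<lambda>x. snd (f x)) S"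
  and smooth_on_vec_nth[smooth_intros]:
  "open S \<Longrightarrow> smooth_on h S \<Longrightarrow> smooth_on (\<lambda>x. (h x :: real^'n) $ i) S"
  by (auto intro: smooth_on_bounded_linear bounded_linear_fst bounded_linear_snd bounded_linear_vec_nth)

lemma smooth_on_divide[smooth_intros]:
  fixes f g :: "'a::real_normed_vector \<Rightarrow> real"
  assumes "open S" "smooth_on f S" "smooth_on g S" "\<And>x. x \<in> S \<Longrightarrow> g x \<noteq> 0"
  shows "smooth_on (\<lambda>x. f x / g x) S"
  unfolding divide_inverse
  by (rule smooth_on_mult) (use assms in \<open>simp_all add: smooth_on_def Ck_on_inverse\<close>)

lemma smooth_on_linear_apply:
  fixes g :: "'a::real_normed_vector \<Rightarrow> 'b::euclidean_space"
  assumes "open S" "\<And>x. x \<in> S \<Longrightarrow> linear (L x)" "\<And>v. smooth_on (\<lambda>x. L x v) S" "smooth_on g S"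
  shows "smooth_on (\<lambda>x. L x (g x)) S"
  using assms Ck_on_linear_apply[OF assms(1), of L] by (simp add: smooth_on_def)

lemma smooth_on_frechet:
  fixes X :: "'a::euclidean_space \<Rightarrow> 'a"
  assumes "open S" "smooth_on f S" "smooth_on X S"
  shows "smooth_on (\<lambda>x. frechet_derivative f (at x) (X x)) S"
  by (rule smooth_on_linear_apply)
    (use assms smooth_on_linear_derivative smooth_on_frechet_const in auto)

lemma smooth_on_compose:
  fixes f :: "'a::real_normed_vector \<Rightarrow> 'b::euclidean_space"
  shows "open S \<Longrightarrow> smooth_on f S \<Longrightarrow> smooth_on g T \<Longrightarrow> f ` S \<subseteq> T \<Longrightarrow> smooth_on (\<lambda>x. g (f x)) S"
  using Ck_on_compose[of S _ f g T] by (simp add: smooth_on_def)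

lemma smooth_on_frechet_chain:
  assumes "smooth_on f S" "smooth_on g T" "x \<in> S" "f x \<in> T"
  shows "frechet_derivative (\<lambda>x. g (f x)) (at x) v
    = frechet_derivative g (at (f x)) (frechet_derivative f (at x) v)"
  using has_derivative_compose[OF smooth_on_has_derivative[OF assms(1,3)]
      smooth_on_has_derivative[OF assms(2,4)]] frechet_derivative_at by metis

lemma frechet_derivative_cong:
  assumes "open S" "x \<in> S" "\<And>y. y \<in> S \<Longrightarrow> f y = g y"
  shows "frechet_derivative f (at x) = frechet_derivative g (at x)"
proof -
  have "(f has_derivative D) (at x) \<longleftrightarrow> (g has_derivative D) (at x)" for D
    using has_derivative_transform_within_open[of f D x UNIV S g]
      has_derivative_transform_within_open[of g D x UNIV S f] assms by auto
  then show ?thesis unfolding frechet_derivative_def by simp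
qed

lemma smooth_on_linear_image:
  fixes L :: "'a::euclidean_space \<Rightarrow> 'b::real_normed_vector"
  shows "linear L \<Longrightarrow> open S \<Longrightarrow> smooth_on L S"
  using smooth_on_bounded_linear[of L S "\<lambda>x. x"] smooth_on_id linear_conv_bounded_linear by blast


section \<open>Symmetry of second derivatives and commutators of directional derivatives\<close>

text \<open>The mixed difference of \<open>f\<close> over a small parallelogram, evaluated twice by the mean value
  theorem with the two directions in either order.\<close>

lemma second_derivative_symmetric_real:
  fixes f :: "'a::euclidean_space \<Rightarrow> real"
  assumes "open S" "smooth_on f S" "x \<in> S"
  shows "frechet_derivative (\<lambda>y. frechet_derivative f (at y) v) (at x) w
       = frechet_derivative (\<lambda>y. frechet_derivative f (at y) w) (at x) v"
proof -
  define D where "D = (\<lambda>a y. frechet_derivative f (at y) a)"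
  define D2 where "D2 = (\<lambda>a b y. frechet_derivative (D a) (at y) b)"
  have smD: "smooth_on (D a) S" for a
    unfolding D_def by (rule smooth_on_frechet_const[OF assms(2)])
  have smD2: "smooth_on (D2 a b) S" for a b
    unfolding D2_def by (rule smooth_on_frechet_const[OF smD])
  obtain r where r: "r > 0" "ball x r \<subseteq> S"
    using assms(1,3) openE by blast
  have mvt: "\<exists>s t. 0 < s \<and> s < d \<and> 0 < t \<and> t < d \<and>
      f (x + d *\<^sub>R a + d *\<^sub>R b) - f (x + d *\<^sub>R a) - f (x + d *\<^sub>R b) + f x
        = d * d * D2 a b (x + s *\<^sub>R a + t *\<^sub>R b)"
    if d: "d > 0" "d * (norm a + norm b) < r" for a b d
  proof -
    have inS: "x + s *\<^sub>R a + t *\<^sub>R b \<in> S" if "0 \<le> s" "s \<le> d" "0 \<le> t" "t \<le> d" for s t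
    proof -
      have "norm (s *\<^sub>R a + t *\<^sub>R b) \<le> s * norm a + t * norm b"
        using that norm_triangle_ineq[of "s *\<^sub>R a" "t *\<^sub>R b"] by simp
      also have "\<dots> \<le> d * norm a + d * norm b"
        using that by (intro add_mono mult_right_mono) auto
      finally have "dist (x + s *\<^sub>R a + t *\<^sub>R b) x < r"
        using d by (simp add: dist_norm distrib_left add.assoc)
      then have "dist x (x + s *\<^sub>R a + t *\<^sub>R b) < r" by (simp add: dist_commute)
      then show ?thesis using r(2) by (auto simp: subset_iff)
    qed
    define \<phi> where "\<phi> = (\<lambda>s. f (x + s *\<^sub>R a + d *\<^sub>R b) - f (x + s *\<^sub>R a))"
    have d\<phi>: "(\<phi> has_real_derivative (D a (x + s *\<^sub>R a + d *\<^sub>R b) - D a (x + s *\<^sub>R a))) (at s)"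
      if "0 \<le> s" "s \<le> d" for s
    proof -
      have *: "((\<lambda>s. f (x + s *\<^sub>R a + t *\<^sub>R b)) has_real_derivative D a (x + s *\<^sub>R a + t *\<^sub>R b)) (at s)"
        if "0 \<le> t" "t \<le> d" for t
      proof -
        have m: "x + s *\<^sub>R a + t *\<^sub>R b \<in> S" using inS that \<open>0 \<le> s\<close> \<open>s \<le> d\<close> by auto
        have "((\<lambda>s. x + s *\<^sub>R a + t *\<^sub>R b) has_derivative (\<lambda>h. h *\<^sub>R a)) (at s)"
          by (auto intro!: derivative_eq_intros)
        from has_derivative_compose[OF this smooth_on_has_derivative[OF assms(2) m]]
        have "((\<lambda>s. f (x + s *\<^sub>R a + t *\<^sub>R b)) has_derivative
            (\<lambda>h. frechet_derivative f (at (x + s *\<^sub>R a + t *\<^sub>R b)) (h *\<^sub>R a))) (at s)" .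
        then show ?thesis
          unfolding has_field_derivative_def D_def
          using linear_scale[OF smooth_on_linear_derivative[OF assms(2) m]]
          by (simp add: mult_commute_abs)
      qed
      show ?thesis
        unfolding \<phi>_def using *[of d] *[of 0] d(1) by (auto intro!: derivative_intros)
    qed
    obtain s where s: "0 < s" "s < d" "\<phi> d - \<phi> 0 = d * (D a (x + s *\<^sub>R a + d *\<^sub>R b) - D a (x + s *\<^sub>R a))"
      using MVT2[of 0 d \<phi>, OF d(1) d\<phi>] by auto
    have "((\<lambda>t. D a (x + s *\<^sub>R a + t *\<^sub>R b)) has_real_derivative D2 a b (x + s *\<^sub>R a + t *\<^sub>R b)) (at t)"
      if "0 \<le> t" "t \<le> d" for t
    proof -
      have m: "x + s *\<^sub>R a + t *\<^sub>R b \<in> S" using inS that s by auto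
      have "((\<lambda>t. x + s *\<^sub>R a + t *\<^sub>R b) has_derivative (\<lambda>h. h *\<^sub>R b)) (at t)"
        by (auto intro!: derivative_eq_intros)
      from has_derivative_compose[OF this smooth_on_has_derivative[OF smD m]]
      show ?thesis
        unfolding has_field_derivative_def D2_def
        using linear_scale[OF smooth_on_linear_derivative[OF smD m]]
        by (simp add: mult_commute_abs)
    qed
    then obtain t where t: "0 < t" "t < d"
      "D a (x + s *\<^sub>R a + d *\<^sub>R b) - D a (x + s *\<^sub>R a + 0 *\<^sub>R b) = d * D2 a b (x + s *\<^sub>R a + t *\<^sub>R b)"
      using MVT2[of 0 d "\<lambda>t. D a (x + s *\<^sub>R a + t *\<^sub>R b)" "\<lambda>t. D2 a b (x + s *\<^sub>R a + t *\<^sub>R b)", OF d(1)] by auto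
    have "\<phi> d - \<phi> 0 = d * d * D2 a b (x + s *\<^sub>R a + t *\<^sub>R b)"
      using s(3) t(3) by simp
    then show ?thesis
      using s t by (intro exI[of _ s] exI[of _ t]) (simp add: \<phi>_def)
  qed
  have lim: "\<exists>\<delta>>0. \<forall>y. dist y x < \<delta> \<longrightarrow> \<bar>D2 a b y - D2 a b x\<bar> < e" if "e > 0" for a b e
  proof -
    have "isCont (D2 a b) x"
      using smooth_on_continuous[OF smD2] assms(1,3) continuous_on_eq_continuous_at by blast
    then show ?thesis
      using that unfolding continuous_at_eps_delta by (auto simp: dist_real_def)
  qed
  have "\<bar>D2 v w x - D2 w v x\<bar> < e" if "e > 0" for e
  proof -
    have e2: "e/2 > 0" using that by simp
    obtain \<delta>1 where \<delta>1: "\<delta>1 > 0" "\<And>y. dist y x < \<delta>1 \<Longrightarrow> \<bar>D2 v w y - D2 v w x\<bar> < e/2"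
      using lim[OF e2, of v w] by blast
    obtain \<delta>2 where \<delta>2: "\<delta>2 > 0" "\<And>y. dist y x < \<delta>2 \<Longrightarrow> \<bar>D2 w v y - D2 w v x\<bar> < e/2"
      using lim[OF e2, of w v] by blast
    \<comment> \<open>The summand 1 keeps \<open>N\<close> positive when both directions vanish; the
      factor 2 in \<open>d\<close> makes the bound on \<open>d * N\<close> strict.\<close>
    define N where "N = norm v + norm w + 1"
    define d where "d = min r (min \<delta>1 \<delta>2) / (2 * N)"
    have N: "N > 0" unfolding N_def by (simp add: add_nonneg_pos)
    have d: "d > 0" using r \<delta>1 \<delta>2 N by (simp add: d_def)
    have dN: "d * N < min r (min \<delta>1 \<delta>2)"
    proof -
      have "d * N = min r (min \<delta>1 \<delta>2) / 2" using N by (simp add: d_def)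
      then show ?thesis using r(1) \<delta>1(1) \<delta>2(1) by linarith
    qed
    have dvw: "d * (norm v + norm w) < min r (min \<delta>1 \<delta>2)"
      using d dN by (simp add: N_def distrib_left)
    have close: "dist (x + s *\<^sub>R a + t *\<^sub>R b) x \<le> d * (norm a + norm b)"
      if "0 < s" "s < d" "0 < t" "t < d" for s t and a b :: 'a
    proof -
      have "norm (s *\<^sub>R a + t *\<^sub>R b) \<le> s * norm a + t * norm b"
        using that norm_triangle_ineq[of "s *\<^sub>R a" "t *\<^sub>R b"] by simp
      also have "\<dots> \<le> d * norm a + d * norm b"
        using that by (intro add_mono mult_right_mono) auto
      finally show ?thesis by (simp add: dist_norm add.assoc distrib_left)
    qed
    obtain s t where 1: "0 < s" "s < d" "0 < t" "t < d"
      "f (x + d *\<^sub>R v + d *\<^sub>R w) - f (x + d *\<^sub>R v) - f (x + d *\<^sub>R w) + f x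
        = d * d * D2 v w (x + s *\<^sub>R v + t *\<^sub>R w)"
      using mvt[OF d, of v w] dvw by auto
    obtain s' t' where 2: "0 < s'" "s' < d" "0 < t'" "t' < d"
      "f (x + d *\<^sub>R w + d *\<^sub>R v) - f (x + d *\<^sub>R w) - f (x + d *\<^sub>R v) + f x
        = d * d * D2 w v (x + s' *\<^sub>R w + t' *\<^sub>R v)"
      using mvt[OF d, of w v] dvw by (auto simp: add.commute)
    have "d * d * D2 v w (x + s *\<^sub>R v + t *\<^sub>R w) = d * d * D2 w v (x + s' *\<^sub>R w + t' *\<^sub>R v)"
      using 1(5) 2(5) by (simp add: add.commute add.left_commute algebra_simps)
    then have eq: "D2 v w (x + s *\<^sub>R v + t *\<^sub>R w) = D2 w v (x + s' *\<^sub>R w + t' *\<^sub>R v)"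
      using d by simp
    have "\<bar>D2 v w (x + s *\<^sub>R v + t *\<^sub>R w) - D2 v w x\<bar> < e/2"
      using close[OF 1(1-4), of v w] dvw by (intro \<delta>1) linarith
    moreover have "\<bar>D2 w v (x + s' *\<^sub>R w + t' *\<^sub>R v) - D2 w v x\<bar> < e/2"
      using close[OF 2(1-4), of w v] dvw by (intro \<delta>2) (simp add: add.commute)
    ultimately show ?thesis using eq by linarith
  qed
  \<comment> \<open>Taken with \<open>e\<close> equal to the difference itself: were that positive,
    it would be smaller than itself.\<close>
  from this[of "\<bar>D2 v w x - D2 w v x\<bar>"] have "D2 v w x = D2 w v x"
    by linarith
  then show ?thesis by (simp add: D2_def D_def)
qed

text \<open>Inner products with a basis vector commute with differentiation, which reduces the claim
  to real-valued components.\<close>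

lemma second_derivative_symmetric:
  fixes f :: "'a::euclidean_space \<Rightarrow> 'b::euclidean_space"
  assumes "open S" "smooth_on f S" "x \<in> S"
  shows "frechet_derivative (\<lambda>y. frechet_derivative f (at y) v) (at x) w
       = frechet_derivative (\<lambda>y. frechet_derivative f (at y) w) (at x) v"
proof (rule euclidean_eqI)
  fix b :: 'b
  have sm: "smooth_on (\<lambda>y. f y \<bullet> b) S"
    by (intro smooth_intros assms)
  have inner: "frechet_derivative (\<lambda>y. g y \<bullet> b) (at y) a = frechet_derivative g (at y) a \<bullet> b"
    if "smooth_on g S" "y \<in> S" for g :: "'a \<Rightarrow> 'b" and y a
    using frechet_derivative_at[OF has_derivative_inner_left[OF smooth_on_has_derivative[OF that]]]
    by metis
  have "frechet_derivative (\<lambda>y. frechet_derivative (\<lambda>y. f y \<bullet> b) (at y) a) (at x) c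
      = frechet_derivative (\<lambda>y. frechet_derivative f (at y) a) (at x) c \<bullet> b" for a c
    using frechet_derivative_cong[OF assms(1,3), of "\<lambda>y. frechet_derivative (\<lambda>y. f y \<bullet> b) (at y) a"
        "\<lambda>y. frechet_derivative f (at y) a \<bullet> b"] inner[OF assms(2)]
      inner[OF smooth_on_frechet_const[OF assms(2)] assms(3)] by simp
  then show "frechet_derivative (\<lambda>y. frechet_derivative f (at y) v) (at x) w \<bullet> b =
        frechet_derivative (\<lambda>y. frechet_derivative f (at y) w) (at x) v \<bullet> b"
    using second_derivative_symmetric_real[OF assms(1) sm assms(3), of v w] by metis
qed

text \<open>Product rule for the moving argument \<open>X y\<close>: the first term freezes the
  vector at \<open>X x\<close>, so that symmetry of second derivatives can be applied to it.\<close>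

lemma frechet_derivative_frechet_field:
  fixes f :: "'a::euclidean_space \<Rightarrow> 'b::euclidean_space"
  assumes "open S" "smooth_on f S" "smooth_on X S" "x \<in> S"
  shows "frechet_derivative (\<lambda>y. frechet_derivative f (at y) (X y)) (at x) w
    = frechet_derivative (\<lambda>y. frechet_derivative f (at y) (X x)) (at x) w
      + frechet_derivative f (at x) (frechet_derivative X (at x) w)"
proof -
  define D where "D = (\<lambda>a y. frechet_derivative f (at y) a)"
  have lin: "linear (\<lambda>a. D a y)" if "y \<in> S" for y
    unfolding D_def using smooth_on_linear_derivative[OF assms(2) that] by simp
  have dD: "(D a has_derivative frechet_derivative (D a) (at x)) (at x)" for a
    using smooth_on_has_derivative[OF smooth_on_frechet_const[OF assms(2)] assms(4)]
    by (simp add: D_def)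
  have dX: "(X has_derivative frechet_derivative X (at x)) (at x)"
    using smooth_on_has_derivative[OF assms(3,4)] .
  have dfield: "((\<lambda>y. \<Sum>b\<in>Basis. (X y \<bullet> b) *\<^sub>R D b y) has_derivative
      (\<lambda>w. \<Sum>b\<in>Basis. (X x \<bullet> b) *\<^sub>R frechet_derivative (D b) (at x) w
         + (frechet_derivative X (at x) w \<bullet> b) *\<^sub>R D b x)) (at x)"
    by (intro has_derivative_sum has_derivative_scaleR has_derivative_inner_left dX dD)
  have "frechet_derivative (\<lambda>y. D (X y) y) (at x)
      = frechet_derivative (\<lambda>y. \<Sum>b\<in>Basis. (X y \<bullet> b) *\<^sub>R D b y) (at x)"
    by (rule frechet_derivative_cong[OF assms(1,4)]) (use linear_euclidean_expand[OF lin] in auto)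
  also have "\<dots> = (\<lambda>w. \<Sum>b\<in>Basis. (X x \<bullet> b) *\<^sub>R frechet_derivative (D b) (at x) w
         + (frechet_derivative X (at x) w \<bullet> b) *\<^sub>R D b x)"
    using frechet_derivative_at[OF dfield] by simp
  finally have 1: "frechet_derivative (\<lambda>y. D (X y) y) (at x) w
      = (\<Sum>b\<in>Basis. (X x \<bullet> b) *\<^sub>R frechet_derivative (D b) (at x) w)
       + (\<Sum>b\<in>Basis. (frechet_derivative X (at x) w \<bullet> b) *\<^sub>R D b x)"
    by (simp add: sum.distrib)
  have dconst: "((\<lambda>y. \<Sum>b\<in>Basis. (X x \<bullet> b) *\<^sub>R D b y) has_derivative
      (\<lambda>w. \<Sum>b\<in>Basis. (X x \<bullet> b) *\<^sub>R frechet_derivative (D b) (at x) w)) (at x)"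
    by (intro has_derivative_sum has_derivative_scaleR_right dD)
  have "frechet_derivative (D (X x)) (at x)
      = frechet_derivative (\<lambda>y. \<Sum>b\<in>Basis. (X x \<bullet> b) *\<^sub>R D b y) (at x)"
    by (rule frechet_derivative_cong[OF assms(1,4)]) (use linear_euclidean_expand[OF lin] in auto)
  also have "\<dots> = (\<lambda>w. \<Sum>b\<in>Basis. (X x \<bullet> b) *\<^sub>R frechet_derivative (D b) (at x) w)"
    using frechet_derivative_at[OF dconst] by simp
  finally show ?thesis
    using 1 linear_euclidean_expand[OF lin[OF assms(4)], of "frechet_derivative X (at x) w"]
    by (simp add: D_def)
qed

text \<open>The two frozen second-derivative terms cancel by symmetry, leaving the first-order term
  given by the bracket.\<close>

lemma frechet_derivative_bracket:
  fixes f :: "'a::euclidean_space \<Rightarrow> 'b::euclidean_space"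
  assumes "open S" "smooth_on f S" "smooth_on X S" "smooth_on Y S" "x \<in> S"
  shows "frechet_derivative (\<lambda>y. frechet_derivative f (at y) (Y y)) (at x) (X x)
       - frechet_derivative (\<lambda>y. frechet_derivative f (at y) (X y)) (at x) (Y x)
     = frechet_derivative f (at x) (frechet_derivative Y (at x) (X x) - frechet_derivative X (at x) (Y x))"
  using frechet_derivative_frechet_field[OF assms(1,2,4,5), of "X x"]
    frechet_derivative_frechet_field[OF assms(1,2,3,5), of "Y x"]
    second_derivative_symmetric[OF assms(1,2,5), of "Y x" "X x"]
    linear_diff[OF smooth_on_linear_derivative[OF assms(2,5)]]
  by simp

section \<open>Volterra equations in two variables\<close>

text \<open>The integral of \<open>f\<close> over the segment from the axis, with \<open>s\<close>
  running from 0 to \<open>fst z\<close>, after the substitution \<open>s = t * fst z\<close>. The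
  fixed interval treats both signs of the endpoint alike and makes continuity in \<open>z\<close> a
  matter of a parametric integral.\<close>

definition vint1 :: "(real \<times> real \<Rightarrow> 'a::banach) \<Rightarrow> real \<times> real \<Rightarrow> 'a" where
  "vint1 f z = fst z *\<^sub>R integral {0..1} (\<lambda>t. f (t * fst z, snd z))"

definition vint2 :: "(real \<times> real \<Rightarrow> 'a::banach) \<Rightarrow> real \<times> real \<Rightarrow> 'a" where
  "vint2 f z = snd z *\<^sub>R integral {0..1} (\<lambda>t. f (fst z, t * snd z))"

definition square :: "real \<Rightarrow> (real \<times> real) set" where
  "square r = {-r<..<r} \<times> {-r<..<r}"

definition closed_square :: "real \<Rightarrow> (real \<times> real) set" where
  "closed_square r = {-r..r} \<times> {-r..r}"

text \<open>At a point of such a set both integral operators use values inside the set only.\<close>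

definition shrinkable :: "(real \<times> real) set \<Rightarrow> bool" where
  "shrinkable S \<longleftrightarrow> (\<forall>z\<in>S. \<forall>t\<in>{0..1}. (t * fst z, snd z) \<in> S \<and> (fst z, t * snd z) \<in> S)"

lemma mem_square: "(u, v) \<in> square r \<longleftrightarrow> \<bar>u\<bar> < r \<and> \<bar>v\<bar> < r"
  and mem_closed_square: "(u, v) \<in> closed_square r \<longleftrightarrow> \<bar>u\<bar> \<le> r \<and> \<bar>v\<bar> \<le> r"
  by (auto simp: square_def closed_square_def)

lemma open_square: "open (square r)"
  unfolding square_def by (intro open_Times open_greaterThanLessThan)

lemma closed_square_cbox: "closed_square r = cbox (-r, -r) (r, r)"
  by (simp add: closed_square_def cbox_Pair_eq)

lemma closed_square_subset: "s < r \<Longrightarrow> closed_square s \<subseteq> square r"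
  and square_subset_closed: "square r \<subseteq> closed_square r"
  by (auto simp: square_def closed_square_def)

lemma abs_mult_unit_le: "t \<in> {0..1} \<Longrightarrow> \<bar>t * x\<bar> \<le> \<bar>x\<bar>" for x t :: real
  by (auto simp: abs_mult intro: mult_left_le_one_le)

lemma shrinkable_square: "shrinkable (square r)"
  by (auto simp: shrinkable_def mem_square intro: le_less_trans[OF abs_mult_unit_le])

lemma shrinkable_closed_square: "shrinkable (closed_square r)"
  by (auto simp: shrinkable_def mem_closed_square intro: order_trans[OF abs_mult_unit_le])

lemma shrinkable1: "shrinkable S \<Longrightarrow> (u, v) \<in> S \<Longrightarrow> t \<in> {0..1} \<Longrightarrow> (t * u, v) \<in> S"
  and shrinkable2: "shrinkable S \<Longrightarrow> (u, v) \<in> S \<Longrightarrow> t \<in> {0..1} \<Longrightarrow> (u, t * v) \<in> S"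
  by (force simp: shrinkable_def)+

lemma vint1_swap: "vint1 f z = vint2 (f \<circ> prod.swap) (prod.swap z)"
  by (cases z) (simp add: vint1_def vint2_def)

lemma vint2_swap: "vint2 f z = vint1 (f \<circ> prod.swap) (prod.swap z)"
  by (cases z) (simp add: vint1_def vint2_def)

lemma continuous_on_slice2:
  assumes "shrinkable S" "continuous_on S f" "(u, v) \<in> S"
  shows "continuous_on {0..1} (\<lambda>t. f (u, t * v))"
  by (rule continuous_on_compose2[OF assms(2)])
    (use shrinkable2[OF assms(1,3)] in \<open>auto intro!: continuous_intros\<close>)

lemma continuous_on_slice1:
  assumes "shrinkable S" "continuous_on S f" "(u, v) \<in> S"
  shows "continuous_on {0..1} (\<lambda>t. f (t * u, v))"
  by (rule continuous_on_compose2[OF assms(2)])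
    (use shrinkable1[OF assms(1,3)] in \<open>auto intro!: continuous_intros\<close>)

lemma continuous_on_vint2:
  assumes "shrinkable S" "continuous_on S f"
  shows "continuous_on S (vint2 f)"
proof -
  have "continuous_on (S \<times> cbox 0 1) (\<lambda>(z, t). f (fst z, t * snd z))"
    unfolding split_beta
    by (rule continuous_on_compose2[OF assms(2)])
      (use assms(1) in \<open>auto simp: shrinkable_def intro!: continuous_intros\<close>)
  from integral_continuous_on_param[OF this]
  have "continuous_on S (\<lambda>z. snd z *\<^sub>R integral {0..1} (\<lambda>t. f (fst z, t * snd z)))"
    by (auto intro!: continuous_intros)
  then show ?thesis
    by (simp add: vint2_def[abs_def])
qed

lemma continuous_on_vint1:
  assumes "shrinkable S" "continuous_on S f"
  shows "continuous_on S (vint1 f)"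
proof -
  have "continuous_on (S \<times> cbox 0 1) (\<lambda>(z, t). f (t * fst z, snd z))"
    unfolding split_beta
    by (rule continuous_on_compose2[OF assms(2)])
      (use assms(1) in \<open>auto simp: shrinkable_def intro!: continuous_intros\<close>)
  from integral_continuous_on_param[OF this]
  have "continuous_on S (\<lambda>z. fst z *\<^sub>R integral {0..1} (\<lambda>t. f (t * fst z, snd z)))"
    by (auto intro!: continuous_intros)
  then show ?thesis
    by (simp add: vint1_def[abs_def])
qed

lemma norm_vint2_le:
  assumes "shrinkable S" "continuous_on S f" "(u, v) \<in> S"
    "\<And>t. t \<in> {0..1} \<Longrightarrow> norm (f (u, t * v)) \<le> B"
  shows "norm (vint2 f (u, v)) \<le> \<bar>v\<bar> * B"
  using integral_bound[OF _ continuous_on_slice2[OF assms(1-3)], of B] assms(4)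
  by (simp add: vint2_def mult_left_mono)

lemma norm_vint1_le:
  assumes "shrinkable S" "continuous_on S f" "(u, v) \<in> S"
    "\<And>t. t \<in> {0..1} \<Longrightarrow> norm (f (t * u, v)) \<le> B"
  shows "norm (vint1 f (u, v)) \<le> \<bar>u\<bar> * B"
  using integral_bound[OF _ continuous_on_slice1[OF assms(1-3)], of B] assms(4)
  by (simp add: vint1_def mult_left_mono)

lemma vint2_diff:
  assumes "shrinkable S" "continuous_on S f" "continuous_on S g" "z \<in> S"
  shows "vint2 (\<lambda>z. f z - g z) z = vint2 f z - vint2 g z"
proof (cases z)
  case (Pair u v)
  have "(\<lambda>t. f (u, t * v)) integrable_on {0..1}" "(\<lambda>t. g (u, t * v)) integrable_on {0..1}"
    using integrable_continuous_real continuous_on_slice2[OF assms(1)] assms Pair by blast+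
  then show ?thesis
    using Pair by (simp add: vint2_def integral_diff scaleR_diff_right)
qed

lemma vint1_diff:
  assumes "shrinkable S" "continuous_on S f" "continuous_on S g" "z \<in> S"
  shows "vint1 (\<lambda>z. f z - g z) z = vint1 f z - vint1 g z"
proof (cases z)
  case (Pair u v)
  have "(\<lambda>t. f (t * u, v)) integrable_on {0..1}" "(\<lambda>t. g (t * u, v)) integrable_on {0..1}"
    using integrable_continuous_real continuous_on_slice1[OF assms(1)] assms Pair by blast+
  then show ?thesis
    using Pair by (simp add: vint1_def integral_diff scaleR_diff_right)
qed

lemma vint2_cong:
  assumes "shrinkable S" "\<And>z. z \<in> S \<Longrightarrow> f z = g z" "z \<in> S"
  shows "vint2 f z = vint2 g z"
proof (cases z)
  case (Pair u v)
  then have "integral {0..1} (\<lambda>t. f (u, t * v)) = integral {0..1} (\<lambda>t. g (u, t * v))"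
    using shrinkable2[OF assms(1)] assms by (intro integral_cong) auto
  then show ?thesis using Pair by (simp add: vint2_def)
qed

lemma vint2_linear:
  assumes "bounded_linear L" "shrinkable S" "continuous_on S f" "z \<in> S"
  shows "L (vint2 f z) = vint2 (\<lambda>z. L (f z)) z"
proof (cases z)
  case (Pair u v)
  have i: "(\<lambda>t. f (u, t * v)) integrable_on {0..1}"
    using integrable_continuous_real continuous_on_slice2[OF assms(2,3)] assms(4) Pair by blast
  show ?thesis
    using Pair integral_linear[OF i assms(1)] linear_scale[OF bounded_linear.linear[OF assms(1)]]
    by (simp add: vint2_def o_def)
qed

lemma vint1_linear:
  assumes "bounded_linear L" "shrinkable S" "continuous_on S f" "z \<in> S"
  shows "L (vint1 f z) = vint1 (\<lambda>z. L (f z)) z"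
proof (cases z)
  case (Pair u v)
  have i: "(\<lambda>t. f (t * u, v)) integrable_on {0..1}"
    using integrable_continuous_real continuous_on_slice1[OF assms(2,3)] assms(4) Pair by blast
  show ?thesis
    using Pair integral_linear[OF i assms(1)] linear_scale[OF bounded_linear.linear[OF assms(1)]]
    by (simp add: vint1_def o_def)
qed

lemma vint2_has_vector_derivative:
  assumes "continuous_on (square r) f" "(u, v) \<in> square r"
  shows "((\<lambda>v. vint2 f (u, v)) has_vector_derivative f (u, v)) (at v)"
proof -
  \<comment> \<open>Chosen strictly between, so that the antiderivative lives on a compact interval
    in which \<open>v\<close> is interior.\<close>
  obtain a where a: "\<bar>v\<bar> < a" "a < r"
    using assms(2) dense by (auto simp: mem_square)
  define \<Phi> where "\<Phi> = (\<lambda>s. integral {-a..s} (\<lambda>s. f (u, s)))"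
  have "continuous_on {-a..a} (\<lambda>s. f (u, s))"
    by (rule continuous_on_compose2[OF assms(1)])
      (use a assms(2) in \<open>auto simp: mem_square intro!: continuous_intros\<close>)
  then have d: "(\<Phi> has_vector_derivative f (u, s)) (at s within {-a..a})" if "s \<in> {-a..a}" for s
    unfolding \<Phi>_def using that by (rule integral_has_vector_derivative)
  \<comment> \<open>Undoing the substitution: the integrand is the \<open>t\<close>-derivative of
    \<open>\<Phi> (t * s)\<close>, whatever the sign of \<open>s\<close>.\<close>
  have eq: "vint2 f (u, s) = \<Phi> s - \<Phi> 0" if s: "\<bar>s\<bar> < a" for s
  proof -
    have "((\<lambda>t. \<Phi> (t * s)) has_vector_derivative s *\<^sub>R f (u, t * s)) (at t within {0..1})"
      if t: "t \<in> {0..1}" for t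
    proof -
      have ts: "t * s \<in> {-a..a}" if "t \<in> {0..1}" for t using abs_mult_unit_le[OF that, of s] s by auto
      have "((\<lambda>t. t * s) has_derivative (\<lambda>h. h * s)) (at t within {0..1})"
        by (auto intro!: derivative_eq_intros)
      moreover have "(\<Phi> has_derivative (\<lambda>h. h *\<^sub>R f (u, t * s))) (at (t * s) within (\<lambda>t. t * s) ` {0..1})"
        by (rule has_derivative_subset[where s="{-a..a}"])
          (use d[OF ts[OF t]] ts in \<open>auto simp: has_vector_derivative_def\<close>)
      ultimately show ?thesis
        using has_derivative_in_compose[of "\<lambda>t. t * s" _ t "{0..1}" \<Phi>]
        by (fastforce simp: has_vector_derivative_def)
    qed
    from fundamental_theorem_of_calculus[OF _ this]
    have "((\<lambda>t. s *\<^sub>R f (u, t * s)) has_integral (\<Phi> s - \<Phi> 0)) {0..1}"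
      by simp
    from integral_unique[OF this] show ?thesis by (simp add: vint2_def)
  qed
  have "at v within {-a..a} = at v"
    using a by (intro at_within_interior) auto
  then have "(\<Phi> has_vector_derivative f (u, v)) (at v)"
    using d[of v] a(1) by (simp add: abs_less_iff)
  then have "((\<lambda>s. \<Phi> s - \<Phi> 0) has_vector_derivative f (u, v)) (at v)"
    by (auto intro!: derivative_eq_intros)
  then show ?thesis
    by (rule has_vector_derivative_transform_within_open[where S="{-a<..<a}"])
      (use a eq in auto)
qed

lemma continuous_on_swap: "continuous_on (square r) f \<Longrightarrow> continuous_on (square r) (f \<circ> prod.swap)"
  by (rule continuous_on_compose2[of "square r"])
    (auto simp: mem_square o_def intro!: continuous_on_compose2[of "square r" f] continuous_on_swap)

lemma vint1_has_vector_derivative: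
  assumes "continuous_on (square r) f" "(u, v) \<in> square r"
  shows "((\<lambda>u. vint1 f (u, v)) has_vector_derivative f (u, v)) (at u)"
  using vint2_has_vector_derivative[OF continuous_on_swap[OF assms(1)], of v u] assms(2)
  by (simp add: vint1_swap mem_square)

lemma vint1_0 [simp]: "vint1 f (0, v) = 0" and vint2_0 [simp]: "vint2 f (u, 0) = 0"
  by (simp_all add: vint1_def vint2_def)

section \<open>Continuous solutions by contraction\<close>

text \<open>In the supremum norm each of the two integrals is Lipschitz with constant
  \<open>r * L\<close>, at most 1/4, so together they contract by 1/2. The set \<open>K\<close>
  serves two uses: a closed ball for the nonlinear system, and the whole space for linearized
  equations.\<close>

lemma volterra_exists:
  fixes f :: "real \<times> real \<Rightarrow> 'a::euclidean_space"
  assumes "r \<ge> 0" and Q: "Q = closed_square r" and K: "closed K" "K \<noteq> {}"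
    and f: "continuous_on Q f"
    and F: "continuous_on (Q \<times> K) (\<lambda>p. F (fst p) (snd p))"
    and G: "continuous_on (Q \<times> K) (\<lambda>p. G (fst p) (snd p))"
    and LF: "\<And>z w w'. z \<in> Q \<Longrightarrow> w \<in> K \<Longrightarrow> w' \<in> K \<Longrightarrow> norm (F z w - F z w') \<le> L * norm (w - w')"
    and LG: "\<And>z w w'. z \<in> Q \<Longrightarrow> w \<in> K \<Longrightarrow> w' \<in> K \<Longrightarrow> norm (G z w - G z w') \<le> L * norm (w - w')"
    and L: "L \<ge> 0" "r * L \<le> 1/4"
    and self: "\<And>W z. continuous_on Q W \<Longrightarrow> W ` Q \<subseteq> K \<Longrightarrow> z \<in> Q \<Longrightarrow>
        f z + vint1 (\<lambda>z. F z (W z)) z + vint2 (\<lambda>z. G z (W z)) z \<in> K"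
  shows "\<exists>W. continuous_on Q W \<and> W ` Q \<subseteq> K \<and>
    (\<forall>z\<in>Q. W z = f z + vint1 (\<lambda>z. F z (W z)) z + vint2 (\<lambda>z. G z (W z)) z)"
proof -
  define \<Psi> where "\<Psi> = (\<lambda>W z. f z + vint1 (\<lambda>z. F z (W z)) z + vint2 (\<lambda>z. G z (W z)) z)"
  have shr: "shrinkable Q" by (simp add: Q shrinkable_closed_square)
  have contF: "continuous_on Q (\<lambda>z. F z (W z))" and contG: "continuous_on Q (\<lambda>z. G z (W z))"
    if "continuous_on Q W" "W ` Q \<subseteq> K" for W
  proof -
    have "continuous_on Q (\<lambda>z. (z, W z))" "(\<lambda>z. (z, W z)) ` Q \<subseteq> Q \<times> K"
      using that by (auto intro!: continuous_intros)
    from continuous_on_compose2[OF F this] continuous_on_compose2[OF G this]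
    show "continuous_on Q (\<lambda>z. F z (W z))" "continuous_on Q (\<lambda>z. G z (W z))" by simp_all
  qed
  have cont: "continuous_on Q (\<Psi> W)" if "continuous_on Q W" "W ` Q \<subseteq> K" for W
    unfolding \<Psi>_def
    by (intro continuous_intros f continuous_on_vint1[OF shr] continuous_on_vint2[OF shr] contF contG that)
  define S :: "((real \<times> real) \<Rightarrow>\<^sub>C 'a) set" where "S = PiC Q (\<lambda>_. K)"
  have S: "W \<in> S \<longleftrightarrow> W ` Q \<subseteq> K" for W
    by (auto simp: S_def mem_PiC_iff)
  have cl: "complete S"
    unfolding S_def using K by (simp add: closed_PiC complete_eq_closed)
  \<comment> \<open>Points of the function space are bounded continuous functions on the whole
    plane. The image is extended off \<open>Q\<close> by clamping, so that the distance of two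
    images is governed by their values on \<open>Q\<close>.\<close>
  have "\<exists>V. (\<forall>z\<in>Q. apply_bcontfun V z = \<Psi> W z) \<and> (\<forall>z. apply_bcontfun V z = \<Psi> W (clamp (-r, -r) (r, r) z))"
    if "W \<in> S" for W :: "(real \<times> real) \<Rightarrow>\<^sub>C 'a"
    using continuous_on_cbox_bcontfunE[of "(-r, -r)" "(r, r)" "\<Psi> W"] cont[of W] that S
    by (metis Q closed_square_cbox continuous_on_apply_bcontfun)
  then obtain T where T: "\<And>W z. W \<in> S \<Longrightarrow> z \<in> Q \<Longrightarrow> apply_bcontfun (T W) z = \<Psi> W z"
    "\<And>W z. W \<in> S \<Longrightarrow> apply_bcontfun (T W) z = \<Psi> W (clamp (-r, -r) (r, r) z)"
    by metis
  have clampQ: "clamp (-r, -r) (r, r) z \<in> Q" for z :: "real \<times> real"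
    unfolding Q closed_square_cbox using assms(1) by (intro clamp_in_interval) (auto simp: Basis_prod_def)
  obtain k where k: "k \<in> K" using K by auto
  have "S \<noteq> {}"
    using S[of "const_bcontfun k"] k by auto
  moreover have "T ` S \<subseteq> S"
    using T(1) self S unfolding \<Psi>_def by (auto simp: image_subset_iff)
  moreover have "dist (T V) (T W) \<le> 1/2 * dist V W" if VW: "V \<in> S" "W \<in> S" for V W
  proof (rule dist_bound)
    fix z :: "real \<times> real"
    obtain u v where uv: "clamp (-r, -r) (r, r) z = (u, v)" by (cases "clamp (-r, -r) (r, r) z")
    have mem: "(u, v) \<in> Q" using clampQ[of z] uv by simp
    have uvr: "\<bar>u\<bar> \<le> r" "\<bar>v\<bar> \<le> r" using mem by (auto simp: Q mem_closed_square)
    have V: "continuous_on Q V" "V ` Q \<subseteq> K" and W: "continuous_on Q W" "W ` Q \<subseteq> K"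
      using VW S by auto
    have d: "norm (V p - W p) \<le> dist V W" for p
      using dist_bounded[of V p W] by (simp add: dist_norm)
    have bF: "norm (F p (V p) - F p (W p)) \<le> L * dist V W" and bG: "norm (G p (V p) - G p (W p)) \<le> L * dist V W"
      if "p \<in> Q" for p
      using LF[OF that, of "V p" "W p"] LG[OF that, of "V p" "W p"] that V W
        mult_left_mono[OF d L(1), of p] by (force simp: image_subset_iff)+
    have "\<Psi> V (u, v) - \<Psi> W (u, v) = vint1 (\<lambda>z. F z (V z) - F z (W z)) (u, v)
        + vint2 (\<lambda>z. G z (V z) - G z (W z)) (u, v)"
      unfolding \<Psi>_def vint1_diff[OF shr contF[OF V] contF[OF W] mem] vint2_diff[OF shr contG[OF V] contG[OF W] mem]
      by simp
    also have "norm \<dots> \<le> \<bar>u\<bar> * (L * dist V W) + \<bar>v\<bar> * (L * dist V W)"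
    proof (rule norm_triangle_mono)
      show "norm (vint1 (\<lambda>z. F z (V z) - F z (W z)) (u, v)) \<le> \<bar>u\<bar> * (L * dist V W)"
        by (rule norm_vint1_le[OF shr _ mem])
          (use bF shrinkable1[OF shr mem] contF[OF V] contF[OF W] in \<open>auto intro!: continuous_intros\<close>)
      show "norm (vint2 (\<lambda>z. G z (V z) - G z (W z)) (u, v)) \<le> \<bar>v\<bar> * (L * dist V W)"
        by (rule norm_vint2_le[OF shr _ mem])
          (use bG shrinkable2[OF shr mem] contG[OF V] contG[OF W] in \<open>auto intro!: continuous_intros\<close>)
    qed
    also have "\<dots> \<le> r * (L * dist V W) + r * (L * dist V W)"
      using uvr L(1) by (intro add_mono mult_right_mono) auto
    also have "\<dots> = 2 * (r * L) * dist V W" by simp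
    also have "\<dots> \<le> 1/2 * dist V W"
      using L(2) by (intro mult_right_mono) auto
    finally show "dist (apply_bcontfun (T V) z) (apply_bcontfun (T W) z) \<le> 1/2 * dist V W"
      unfolding T(2)[OF VW(1)] T(2)[OF VW(2)] uv by (simp add: dist_norm)
  qed
  ultimately obtain W where "W \<in> S" "T W = W"
    using Banach_fix[OF cl, of "1/2" T] by auto
  then have "apply_bcontfun W z = \<Psi> W z" if "z \<in> Q" for z
    using T(1)[of W z] that by simp
  moreover have "apply_bcontfun W ` Q \<subseteq> K"
    using \<open>W \<in> S\<close> S by simp
  ultimately show ?thesis
    unfolding \<Psi>_def
    by (intro exI[of _ "apply_bcontfun W"] conjI ballI continuous_on_apply_bcontfun) blast+
qed

section \<open>Differentiation transverse to the direction of integration\<close>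

lemma continuous_on_linear_apply:
  fixes g :: "'a::topological_space \<Rightarrow> 'b::euclidean_space"
  assumes "\<And>x. x \<in> S \<Longrightarrow> linear (L x)" "\<And>v. continuous_on S (\<lambda>x. L x v :: 'c::real_normed_vector)"
    "continuous_on S g"
  shows "continuous_on S (\<lambda>x. L x (g x))"
proof -
  have "continuous_on S (\<lambda>x. \<Sum>b\<in>Basis. (g x \<bullet> b) *\<^sub>R L x b)"
    by (intro continuous_intros assms)
  then show ?thesis
    using linear_euclidean_expand[OF assms(1)] by (auto cong: continuous_on_cong)
qed

text \<open>The sum over the basis bounds the operator norm and is visibly continuous in a parameter
  as soon as each \<open>L b\<close> is, which is all the continuity that \<open>Ck_on\<close>
  provides.\<close>

lemma norm_linear_le_basis:
  fixes a :: "'a::euclidean_space"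
  assumes "linear L"
  shows "norm (L a) \<le> (\<Sum>b\<in>Basis. norm (L b)) * norm a"
proof -
  have "norm (L a) \<le> (\<Sum>b\<in>Basis. norm ((a \<bullet> b) *\<^sub>R L b))"
    unfolding linear_euclidean_expand[OF assms, of a] by (rule norm_sum)
  also have "\<dots> \<le> (\<Sum>b\<in>Basis. norm (L b) * norm a)"
    by (intro sum_mono) (simp add: mult.commute[of "norm (L _)"] mult_right_mono Basis_le_norm)
  finally show ?thesis by (simp add: sum_distrib_right)
qed

text \<open>The mean value inequality bounds the remainder by the oscillation of the derivative, and
  that oscillation is uniformly small on a compact neighbourhood of \<open>K\<close>.\<close>

lemma uniformly_differentiable_on_compact:
  fixes G :: "'a::euclidean_space \<Rightarrow> 'b::real_normed_vector"
  assumes "open \<Omega>" "Ck_on (Suc 0) G \<Omega>" "compact K" "K \<subseteq> \<Omega>" "\<epsilon> > 0"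
  obtains d where "d > 0" "\<And>x y. x \<in> K \<Longrightarrow> norm (y - x) < d \<Longrightarrow>
    norm (G y - G x - frechet_derivative G (at x) (y - x)) \<le> \<epsilon> * norm (y - x)"
proof -
  define D where "D = (\<lambda>x. frechet_derivative G (at x))"
  have dG: "(G has_derivative D x) (at x)" if "x \<in> \<Omega>" for x
    unfolding D_def using Ck_on_has_derivative[OF assms(2) that] .
  have lin: "linear (D x)" if "x \<in> \<Omega>" for x
    using dG[OF that] has_derivative_linear by blast
  have contD: "continuous_on \<Omega> (\<lambda>x. D x v)" for v
    unfolding D_def using assms(2) by simp
  obtain e where e: "e > 0" "{x + y |x y. x \<in> K \<and> y \<in> cball 0 e} \<subseteq> \<Omega>"
  proof -
    obtain e where e: "e > 0" "(\<Union>x\<in>K. ball x e) \<subseteq> \<Omega>"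
      using compact_subset_open_imp_ball_epsilon_subset[OF assms(3,1,4)] by blast
    have "{x + y |x y. x \<in> K \<and> y \<in> cball 0 (e/2)} \<subseteq> (\<Union>x\<in>K. ball x e)"
      using e(1) by (force simp: dist_norm)
    then show ?thesis using e by (intro that[of "e/2"]) auto
  qed
  define K' where "K' = {x + y |x y. x \<in> K \<and> y \<in> cball 0 e}"
  have K': "compact K'" "K' \<subseteq> \<Omega>"
    unfolding K'_def using e compact_sums[OF assms(3) compact_cball[of 0 e]] by auto
  have inK': "y \<in> K'" if "x \<in> K" "norm (y - x) \<le> e" for x y
    unfolding K'_def by (rule CollectI, rule exI[of _ x], rule exI[of _ "y - x"]) (use that in \<open>auto simp: norm_minus_commute\<close>)
  \<comment> \<open>Dominates the operator norm of the difference of two derivatives and vanishes on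
    the diagonal, so uniform continuity makes it small nearby.\<close>
  define N where "N = (\<lambda>p. \<Sum>b\<in>Basis. norm (D (snd p) b - D (fst p) b))"
  have "continuous_on (K' \<times> K') N"
    unfolding N_def using K'(2)
    by (intro continuous_intros continuous_on_compose2[OF contD]) auto
  then have "uniformly_continuous_on (K' \<times> K') N"
    by (intro compact_uniformly_continuous compact_Times K')
  then obtain d where d: "d > 0"
    "\<And>p q. p \<in> K' \<times> K' \<Longrightarrow> q \<in> K' \<times> K' \<Longrightarrow> dist q p < d \<Longrightarrow> dist (N q) (N p) < \<epsilon>"
    using assms(5) unfolding uniformly_continuous_on_def by metis
  show ?thesis
  proof (rule that[of "min d e"])
    show "min d e > 0" using d e by simp
    fix x y assume x: "x \<in> K" and y: "norm (y - x) < min d e"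
    have near: "z \<in> \<Omega> \<and> N (x, z) < \<epsilon>" if "z \<in> ball x (min d e)" for z
    proof -
      have z: "z \<in> K'" "x \<in> K'" using inK'[OF x] that e(1) by (auto simp: dist_norm norm_minus_commute)
      have "dist (N (x, z)) (N (x, x)) < \<epsilon>"
        using z that by (intro d) (auto simp: dist_commute dist_Pair_Pair)
      then show ?thesis using z K'(2) by (auto simp: N_def dist_real_def)
    qed
    have "norm (G y - G x - D x (y - x)) \<le> norm (y - x) * \<epsilon>"
    proof (rule differentiable_bound_linearization[where S="ball x (min d e)"])
      show "x + t *\<^sub>R (y - x) \<in> ball x (min d e)" if "t \<in> {0..1}" for t
        using y that by (auto simp: dist_norm intro: le_less_trans[OF mult_left_le_one_le])
      show "(G has_derivative D z) (at z within ball x (min d e))" if "z \<in> ball x (min d e)" for z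
        using dG near[OF that] has_derivative_at_withinI by blast
      show "onorm (D z - D x) \<le> \<epsilon>" if "z \<in> ball x (min d e)" for z
      proof (rule onorm_le)
        fix v
        have "linear (\<lambda>v. D z v - D x v)"
          using lin near[OF that] x assms(4) by (intro linear_compose_sub) auto
        from norm_linear_le_basis[OF this, of v]
        have "norm ((D z - D x) v) \<le> N (x, z) * norm v" by (simp add: N_def)
        also have "\<dots> \<le> \<epsilon> * norm v" using near[OF that] by (intro mult_right_mono) auto
        finally show "norm ((D z - D x) v) \<le> \<epsilon> * norm v" .
      qed
      show "x \<in> ball x (min d e)" using d e by simp
    qed
    then show "norm (G y - G x - frechet_derivative G (at x) (y - x)) \<le> \<epsilon> * norm (y - x)"
      by (simp add: D_def mult.commute)
  qed
qed

lemma square_subset_mono: "r \<le> s \<Longrightarrow> square r \<subseteq> square s"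
  by (auto simp: square_def)

lemma continuous_on_subsquares:
  assumes "\<And>\<rho>. 0 < \<rho> \<Longrightarrow> \<rho> < r \<Longrightarrow> continuous_on (square \<rho>) f"
  shows "continuous_on (square r) f"
proof (rule continuous_at_imp_continuous_on, rule ballI)
  fix z assume "z \<in> square r"
  then obtain u v where z: "z = (u, v)" "\<bar>u\<bar> < r" "\<bar>v\<bar> < r" by (cases z) (auto simp: mem_square)
  obtain \<rho> where "max \<bar>u\<bar> \<bar>v\<bar> < \<rho>" "\<rho> < r" using dense[of "max \<bar>u\<bar> \<bar>v\<bar>" r] z by auto
  then have "z \<in> square \<rho>" "continuous_on (square \<rho>) f"
    using assms[of \<rho>] by (auto simp: z mem_square)
  then show "isCont f z"
    using open_square continuous_on_eq_continuous_at by blast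
qed

text \<open>The hypothesis \<open>r * L \<le> 1/4\<close> replaces Gronwall's inequality: the error of the difference quotient
  along a \<open>v\<close>-segment is absorbed into half of its own maximum.\<close>

lemma volterra2_param_derivative_aux:
  fixes W S f f1 :: "real \<times> real \<Rightarrow> 'a::euclidean_space" and G :: "(real \<times> real) \<times> 'a \<Rightarrow> 'a"
  defines "A \<equiv> \<lambda>z. frechet_derivative G (at (z, W z))"
  assumes "open \<Omega>" "Ck_on (Suc 0) G \<Omega>" "continuous_on (square r) W"
    and mem: "\<And>z. z \<in> square r \<Longrightarrow> (z, W z) \<in> \<Omega>"
    and bound: "\<And>z s. z \<in> square r \<Longrightarrow> norm (A z (0, s)) \<le> L * norm s"
    and "L \<ge> 0" "r * L \<le> 1/4"
    and eq: "\<And>z. z \<in> square r \<Longrightarrow> W z = f z + vint2 (\<lambda>z. G (z, W z)) z"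
    and "continuous_on (square r) f1"
    and df: "\<And>u v. (u, v) \<in> square r \<Longrightarrow> ((\<lambda>u. f (u, v)) has_vector_derivative f1 (u, v)) (at u)"
    and "\<rho> < r" "continuous_on (square \<rho>) S"
    and S: "\<And>z. z \<in> square \<rho> \<Longrightarrow> S z = f1 z + vint2 (\<lambda>z. A z ((1, 0), S z)) z"
    and uv: "(u, v) \<in> square \<rho>"
  shows "((\<lambda>u. W (u, v)) has_vector_derivative S (u, v)) (at u)"
proof -
  have r: "r > 0" using uv \<open>\<rho> < r\<close> by (auto simp: mem_square)
  have sub: "square \<rho> \<subseteq> square r" using \<open>\<rho> < r\<close> by (simp add: square_subset_mono)
  have linA: "linear (A z)" if "z \<in> square r" for z
    unfolding A_def using Ck_on_has_derivative[OF assms(3) mem[OF that]] has_derivative_linear by blast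
  have contA: "continuous_on (square r) (\<lambda>z. A z s)" for s
  proof -
    have "continuous_on \<Omega> (\<lambda>y. frechet_derivative G (at y) s)"
      using assms(3) unfolding Ck_on.simps by blast
    moreover have "continuous_on (square r) (\<lambda>z. (z, W z))"
      using assms(4) by (intro continuous_intros)
    ultimately show ?thesis
      unfolding A_def by (rule continuous_on_compose2) (use mem in blast)
  qed
  have contG: "continuous_on (square r) (\<lambda>z. G (z, W z))"
    by (rule continuous_on_compose2[OF Ck_on_continuous[OF assms(3)]])
      (use assms(4) mem in \<open>auto intro!: continuous_intros\<close>)
  have contAS: "continuous_on (square \<rho>) (\<lambda>z. A z ((1, 0), S z))"
  proof (rule continuous_on_linear_apply[where L=A])
    show "linear (A z)" if "z \<in> square \<rho>" for z using linA that sub by blast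
    show "continuous_on (square \<rho>) (\<lambda>z. A z s)" for s using contA sub continuous_on_subset by blast
    show "continuous_on (square \<rho>) (\<lambda>z. ((1::real, 0::real), S z))" using assms(13) by (intro continuous_intros)
  qed
  \<comment> \<open>The vertical segment from the axis to \<open>(u, v)\<close>, over which the
    integral runs. \<open>R\<close> below is a compact rectangle that also contains its shifts by
    small \<open>h\<close>.\<close>
  define P where "P = (\<lambda>t. (u, t * v)) ` {0..1}"
  have Psub: "P \<subseteq> square \<rho>"
    unfolding P_def using shrinkable2[OF shrinkable_square uv] by auto
  have cP: "compact P"
    unfolding P_def by (intro compact_continuous_image continuous_intros) auto
  obtain a where a: "a > 0" "\<bar>u\<bar> + a < \<rho>"
    using uv by (auto simp: mem_square intro!: that[of "(\<rho> - \<bar>u\<bar>) / 2"] simp: field_simps)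
  define R where "R = {u-a..u+a} \<times> {-\<bar>v\<bar>..\<bar>v\<bar>}"
  have R: "compact R" "R \<subseteq> square \<rho>"
    unfolding R_def using a uv by (auto intro!: compact_Times simp: mem_square)
  have inR: "(u + h, t * v) \<in> R" if "\<bar>h\<bar> \<le> a" "t \<in> {0..1}" for h t
    using abs_mult_unit_le[OF that(2), of v] that(1) by (auto simp: R_def)
  obtain M where M: "M \<ge> 0" "\<And>t. t \<in> {0..1} \<Longrightarrow> norm (S (u, t * v)) \<le> M"
  proof -
    have "bounded (S ` P)"
      using cP assms(13) Psub continuous_on_subset by (intro compact_imp_bounded compact_continuous_image) blast+
    then obtain M where "\<And>z. z \<in> P \<Longrightarrow> norm (S z) \<le> M" unfolding bounded_iff by auto
    then have "norm (S (u, t * v)) \<le> M" if "t \<in> {0..1}" for t using that unfolding P_def by blast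
    then show ?thesis by (intro that[of "max M 0"]) (auto simp: le_max_iff_disj)
  qed
  have est: "\<exists>d>0. \<forall>h. \<bar>h\<bar> < d \<longrightarrow> norm (W (u + h, v) - W (u, v) - h *\<^sub>R S (u, v)) \<le> e * \<bar>h\<bar>"
    if "e > 0" for e
  proof -
    \<comment> \<open>\<open>C\<close> is what the final estimate leaves once half of the maximal
      error is absorbed, hence the factor 2. The bound \<open>1 / (4 * r)\<close> on
      \<open>\<epsilon>\<close> complements \<open>r * L \<le> 1/4\<close> to make that
      half.\<close>
    define C where "C = 2 * (1 + r * (1 + M))"
    have C: "C > 0" unfolding C_def using r M by (simp add: add_pos_nonneg)
    define \<epsilon> where "\<epsilon> = min (1 / (4 * r)) (e / C)"
    have \<epsilon>: "\<epsilon> > 0" "r * \<epsilon> \<le> 1/4" "\<epsilon> * C \<le> e"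
    proof -
      show "\<epsilon> > 0" unfolding \<epsilon>_def using r C that by simp
      have "\<epsilon> \<le> 1 / (4 * r)" "\<epsilon> \<le> e / C" by (simp_all add: \<epsilon>_def)
      then show "r * \<epsilon> \<le> 1/4" "\<epsilon> * C \<le> e" using r C by (simp_all add: field_simps)
    qed
    obtain d1 where d1: "d1 > 0" "\<And>z y. z \<in> (\<lambda>z. (z, W z)) ` P \<Longrightarrow> norm (y - z) < d1 \<Longrightarrow>
        norm (G y - G z - frechet_derivative G (at z) (y - z)) \<le> \<epsilon> * norm (y - z)"
    proof (rule uniformly_differentiable_on_compact[OF assms(2,3) _ _ \<epsilon>(1)])
      show "compact ((\<lambda>z. (z, W z)) ` P)"
        using cP assms(4) Psub sub continuous_on_subset
        by (intro compact_continuous_image continuous_intros) blast+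
      show "(\<lambda>z. (z, W z)) ` P \<subseteq> \<Omega>" using mem Psub sub by blast
    qed blast
    have "uniformly_continuous_on R W" "uniformly_continuous_on R f1"
      using R assms(4,10) sub continuous_on_subset by (blast intro: compact_uniformly_continuous)+
    then obtain d2 d3 where d2: "d2 > 0" "\<And>p q. p \<in> R \<Longrightarrow> q \<in> R \<Longrightarrow> dist q p < d2 \<Longrightarrow> dist (W q) (W p) < d1 / 2"
      and d3: "d3 > 0" "\<And>p q. p \<in> R \<Longrightarrow> q \<in> R \<Longrightarrow> dist q p < d3 \<Longrightarrow> dist (f1 q) (f1 p) < \<epsilon>"
      using \<epsilon>(1) d1(1) unfolding uniformly_continuous_on_def by (metis half_gt_zero)
    define d where "d = min (min a (d1/2)) (min d2 d3)"
    have d: "d > 0" using a(1) d1(1) d2(1) d3(1) by (simp add: d_def)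
    have "norm (W (u + h, v) - W (u, v) - h *\<^sub>R S (u, v)) \<le> e * \<bar>h\<bar>" if h: "\<bar>h\<bar> < d" for h
    proof -
      \<comment> \<open>Error of the linear approximation with slope \<open>S\<close> at height
        \<open>t * v\<close>. It is estimated on the whole segment at once, because the equation for
        the error integrates over it.\<close>
      define \<Delta> where "\<Delta> = (\<lambda>t. W (u + h, t * v) - W (u, t * v) - h *\<^sub>R S (u, t * v))"
      have m0: "(u, t * v) \<in> square \<rho>" "(u, t * v) \<in> R" "(u + h, t * v) \<in> R" "(u + h, t * v) \<in> square \<rho>"
        if "t \<in> {0..1}" for t
        using inR[OF _ that, of 0] inR[OF _ that, of h] a(1) h R(2) by (auto simp: d_def)
      have mh: "(u + h, v) \<in> square r" and mu: "(u, v) \<in> square r"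
        using m0[of 1] sub by auto
      have "continuous_on {0..1} \<Delta>"
        unfolding \<Delta>_def
        using continuous_on_slice2[OF shrinkable_square assms(4) mh]
          continuous_on_slice2[OF shrinkable_square assms(4) mu]
          continuous_on_slice2[OF shrinkable_square assms(13) uv]
        by (intro continuous_intros) auto
      then have "continuous_on {0..1} (\<lambda>t. norm (\<Delta> t))" by (rule continuous_on_norm)
      moreover have "{0..1::real} \<noteq> {}" by simp
      ultimately obtain t0 where t0: "t0 \<in> {0..1}" "\<And>t. t \<in> {0..1} \<Longrightarrow> norm (\<Delta> t) \<le> norm (\<Delta> t0)"
        using continuous_attains_sup[OF compact_Icc] by blast
      define m where "m = norm (\<Delta> t0)"
      have fpart: "norm (f (u + h, t * v) - f (u, t * v) - h *\<^sub>R f1 (u, t * v)) \<le> \<epsilon> * \<bar>h\<bar>"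
        if t: "t \<in> {0..1}" for t
      proof -
        have seg: "(x, t * v) \<in> R \<and> \<bar>x - u\<bar> \<le> \<bar>h\<bar>" if "x \<in> closed_segment u (u + h)" for x
        proof -
          have "\<bar>x - u\<bar> \<le> \<bar>h\<bar>" using that by (auto simp: closed_segment_eq_real_ivl split: if_splits)
          then show ?thesis using inR[OF _ t, of "x - u"] h by (auto simp: d_def)
        qed
        have "norm (f (u + h, t * v) - f (u, t * v) - ((u + h) - u) *\<^sub>R f1 (u, t * v)) \<le> norm ((u + h) - u) * \<epsilon>"
        proof (rule vector_differentiable_bound_linearization[where S="closed_segment u (u + h)" and f="\<lambda>x. f (x, t * v)" and f'="\<lambda>x. f1 (x, t * v)"])
          show "((\<lambda>x. f (x, t * v)) has_vector_derivative f1 (x, t * v)) (at x within closed_segment u (u + h))"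
            if "x \<in> closed_segment u (u + h)" for x
            using df[of x "t * v"] seg[OF that] R(2) sub by (blast intro: has_vector_derivative_at_within)
          show "norm (f1 (x, t * v) - f1 (u, t * v)) \<le> \<epsilon>" if "x \<in> closed_segment u (u + h)" for x
            using d3(2)[OF m0(2)[OF t], of "(x, t * v)"] seg[OF that] h
            by (auto simp: dist_norm norm_Pair d_def intro: less_imp_le)
        qed auto
        then show ?thesis by (simp add: mult.commute)
      qed
      \<comment> \<open>Integrand in the equation for the error: the increment of \<open>G\<close>
        minus its linearization along the candidate slope.\<close>
      define E where "E = (\<lambda>p. G ((fst p + h, snd p), W (fst p + h, snd p)) - G (p, W p) - h *\<^sub>R A p ((1, 0), S p))"
      have Ebound: "norm (E (u, t * v)) \<le> \<epsilon> * (1 + M) * \<bar>h\<bar> + (\<epsilon> + L) * m" if t: "t \<in> {0..1}" for t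
      proof -
        define z where "z = (u, t * v)"
        define y where "y = ((u + h, t * v), W (u + h, t * v))"
        have zr: "z \<in> square r" using m0[OF t] sub by (auto simp: z_def)
        have diff: "y - (z, W z) = ((h, 0), \<Delta> t + h *\<^sub>R S z)"
          by (simp add: y_def z_def \<Delta>_def)
        have "norm (W (u + h, t * v) - W z) < d1 / 2"
          using d2(2)[OF m0(2)[OF t] m0(3)[OF t]] h by (simp add: dist_norm norm_Pair d_def z_def)
        moreover have "norm (y - (z, W z)) \<le> norm (h, 0::real) + norm (W (u + h, t * v) - W z)"
          unfolding diff using norm_Pair_le[of "(h, 0::real)" "\<Delta> t + h *\<^sub>R S z"] by (simp add: \<Delta>_def z_def)
        ultimately have "norm (y - (z, W z)) < d1"
          using h by (simp add: norm_Pair d_def)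
        then have rem: "norm (G y - G (z, W z) - A z (y - (z, W z))) \<le> \<epsilon> * norm (y - (z, W z))"
        proof -
          have "(z, W z) \<in> (\<lambda>z. (z, W z)) ` P" using t unfolding z_def P_def by blast
          then show "norm (G y - G (z, W z) - A z (y - (z, W z))) \<le> \<epsilon> * norm (y - (z, W z))"
            unfolding A_def using \<open>norm (y - (z, W z)) < d1\<close> by (rule d1(2))
        qed
        have "norm (y - (z, W z)) \<le> norm (h, 0::real) + norm (\<Delta> t + h *\<^sub>R S z)"
          unfolding diff by (rule norm_Pair_le)
        also have "\<dots> \<le> \<bar>h\<bar> + (m + \<bar>h\<bar> * M)"
          using norm_triangle_ineq[of "\<Delta> t" "h *\<^sub>R S z"] t0(2)[OF t] mult_left_mono[OF M(2)[OF t], of "\<bar>h\<bar>"]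
          by (simp add: norm_Pair m_def z_def)
        finally have ny: "norm (y - (z, W z)) \<le> (1 + M) * \<bar>h\<bar> + m"
          by (simp add: algebra_simps)
        have "A z (y - (z, W z)) = h *\<^sub>R A z ((1, 0), S z) + A z (0, \<Delta> t)"
        proof -
          have "y - (z, W z) = h *\<^sub>R ((1, 0), S z) + (0, \<Delta> t)"
            unfolding diff by (simp add: zero_prod_def)
          then have "A z (y - (z, W z)) = A z (h *\<^sub>R ((1, 0), S z)) + A z (0, \<Delta> t)"
            by (simp only: linear_add[OF linA[OF zr]])
          then show ?thesis by (simp only: linear_scale[OF linA[OF zr]])
        qed
        then have "E z = (G y - G (z, W z) - A z (y - (z, W z))) + A z (0, \<Delta> t)"
          by (simp add: E_def y_def z_def)
        then have "norm (E z) \<le> norm (G y - G (z, W z) - A z (y - (z, W z))) + norm (A z (0, \<Delta> t))"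
          using norm_triangle_ineq by simp
        also have "\<dots> \<le> \<epsilon> * ((1 + M) * \<bar>h\<bar> + m) + L * m"
        proof (rule add_mono)
          show "norm (G y - G (z, W z) - A z (y - (z, W z))) \<le> \<epsilon> * ((1 + M) * \<bar>h\<bar> + m)"
            using rem mult_left_mono[OF ny, of \<epsilon>] \<epsilon>(1) by linarith
          show "norm (A z (0, \<Delta> t)) \<le> L * m"
            using bound[OF zr, of "\<Delta> t"] mult_left_mono[OF t0(2)[OF t] \<open>L \<ge> 0\<close>] unfolding m_def by linarith
        qed
        finally show ?thesis by (simp add: z_def algebra_simps)
      qed
      \<comment> \<open>The equations for \<open>W\<close> and \<open>S\<close> are evaluated at the
        height where the error is largest, so that \<open>m\<close> stands on both sides of the
        estimate.\<close>
      define c where "c = t0 * v"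
      have c: "\<bar>c\<bar> < r" "(u, c) \<in> square \<rho>" "(u + h, c) \<in> square r"
        using m0[OF t0(1)] sub \<open>\<rho> < r\<close> by (auto simp: c_def mem_square)
      have cu: "(u, c) \<in> square r" using c sub by auto
      have i1: "(\<lambda>t. G ((u + h, t * c), W (u + h, t * c))) integrable_on {0..1}"
        using continuous_on_slice2[OF shrinkable_square contG c(3)] by (rule integrable_continuous_real)
      have i2: "(\<lambda>t. G ((u, t * c), W (u, t * c))) integrable_on {0..1}"
        using continuous_on_slice2[OF shrinkable_square contG cu] by (rule integrable_continuous_real)
      have i3: "(\<lambda>t. A (u, t * c) ((1, 0), S (u, t * c))) integrable_on {0..1}"
        using continuous_on_slice2[OF shrinkable_square contAS c(2)] by (rule integrable_continuous_real)
      have contE: "continuous_on {0..1} (\<lambda>t. E (u, t * c))"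
        unfolding E_def using continuous_on_slice2[OF shrinkable_square contG c(3)]
          continuous_on_slice2[OF shrinkable_square contG cu] continuous_on_slice2[OF shrinkable_square contAS c(2)]
        by (auto intro!: continuous_intros)
      have "integral {0..1} (\<lambda>t. E (u, t * c)) = integral {0..1} (\<lambda>t. G ((u + h, t * c), W (u + h, t * c)))
          - integral {0..1} (\<lambda>t. G ((u, t * c), W (u, t * c)))
          - h *\<^sub>R integral {0..1} (\<lambda>t. A (u, t * c) ((1, 0), S (u, t * c)))"
        unfolding E_def using i1 i2 i3 by (simp add: integral_diff integrable_diff integrable_cmul)
      then have intE: "c *\<^sub>R integral {0..1} (\<lambda>t. E (u, t * c)) = vint2 (\<lambda>z. G (z, W z)) (u + h, c)
          - vint2 (\<lambda>z. G (z, W z)) (u, c) - h *\<^sub>R vint2 (\<lambda>z. A z ((1, 0), S z)) (u, c)"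
        by (simp add: vint2_def scaleR_diff_right)
      have "\<Delta> t0 = (f (u + h, c) - f (u, c) - h *\<^sub>R f1 (u, c)) + c *\<^sub>R integral {0..1} (\<lambda>t. E (u, t * c))"
        unfolding intE \<Delta>_def c_def[symmetric] eq[OF c(3)] eq[OF cu] S[OF c(2)]
        by (simp add: algebra_simps)
      then have "m \<le> norm (f (u + h, c) - f (u, c) - h *\<^sub>R f1 (u, c)) + norm (c *\<^sub>R integral {0..1} (\<lambda>t. E (u, t * c)))"
        unfolding m_def using norm_triangle_ineq by metis
      also have "\<dots> \<le> \<epsilon> * \<bar>h\<bar> + r * (\<epsilon> * (1 + M) * \<bar>h\<bar> + (\<epsilon> + L) * m)"
      proof (rule add_mono)
        show "norm (f (u + h, c) - f (u, c) - h *\<^sub>R f1 (u, c)) \<le> \<epsilon> * \<bar>h\<bar>"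
          using fpart[OF t0(1)] by (simp add: c_def)
        have "norm (integral {0..1} (\<lambda>t. E (u, t * c))) \<le> (\<epsilon> * (1 + M) * \<bar>h\<bar> + (\<epsilon> + L) * m) * (1 - 0)"
        proof (rule integral_bound[OF _ contE])
          show "norm (E (u, t * c)) \<le> \<epsilon> * (1 + M) * \<bar>h\<bar> + (\<epsilon> + L) * m" if "t \<in> {0..1}" for t
            using Ebound[of "t * t0"] that t0(1) by (auto simp: c_def mult.assoc intro: mult_le_one)
        qed auto
        then show "norm (c *\<^sub>R integral {0..1} (\<lambda>t. E (u, t * c))) \<le> r * (\<epsilon> * (1 + M) * \<bar>h\<bar> + (\<epsilon> + L) * m)"
          using c(1) by (simp only: norm_scaleR) (intro mult_mono, auto)
      qed
      finally have "m \<le> \<epsilon> * \<bar>h\<bar> * (1 + r * (1 + M)) + (r * \<epsilon> + r * L) * m"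
        by (simp add: algebra_simps)
      moreover have "(r * \<epsilon> + r * L) * m \<le> 1/2 * m"
        using \<epsilon>(2) \<open>r * L \<le> 1/4\<close> by (intro mult_right_mono) (auto simp: m_def)
      ultimately have "m \<le> \<epsilon> * C * \<bar>h\<bar>"
        by (simp add: C_def algebra_simps)
      also have "\<dots> \<le> e * \<bar>h\<bar>"
        using \<epsilon>(3) by (intro mult_right_mono) auto
      finally have "m \<le> e * \<bar>h\<bar>" .
      moreover have "norm (\<Delta> 1) \<le> m" using t0(2)[of 1] by (simp add: m_def)
      ultimately show ?thesis by (simp add: \<Delta>_def)
    qed
    then show ?thesis using d by blast
  qed
  show ?thesis
    unfolding has_vector_derivative_def has_derivative_at_alt
  proof (intro conjI allI impI)
    show "bounded_linear (\<lambda>x. x *\<^sub>R S (u, v))" by (rule bounded_linear_scaleR_left)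
    fix e :: real assume "e > 0"
    then obtain d where "d > 0" "\<And>h. \<bar>h\<bar> < d \<Longrightarrow> norm (W (u + h, v) - W (u, v) - h *\<^sub>R S (u, v)) \<le> e * \<bar>h\<bar>"
      using est by blast
    then show "\<exists>d>0. \<forall>y. norm (y - u) < d \<longrightarrow> norm (W (y, v) - W (u, v) - (y - u) *\<^sub>R S (u, v)) \<le> e * norm (y - u)"
      by (intro exI[of _ d]) (metis add.commute diff_add_cancel real_norm_def)
  qed
qed

text \<open>The candidate \<open>S\<close> solves the equation differentiated formally in
  \<open>u\<close>, which is affine in \<open>S\<close>; the auxiliary lemma confirms that it is the
  derivative. Since continuity is known on the open square only, the contraction argument runs on
  each smaller closed square.\<close>

lemma volterra2_param_derivative:
  fixes W f f1 :: "real \<times> real \<Rightarrow> 'a::euclidean_space" and G :: "(real \<times> real) \<times> 'a \<Rightarrow> 'a"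
  defines "A \<equiv> \<lambda>z. frechet_derivative G (at (z, W z))"
  assumes "open \<Omega>" "Ck_on (Suc 0) G \<Omega>" "continuous_on (square r) W"
    and mem: "\<And>z. z \<in> square r \<Longrightarrow> (z, W z) \<in> \<Omega>"
    and bound: "\<And>z s. z \<in> square r \<Longrightarrow> norm (A z (0, s)) \<le> L * norm s"
    and L: "L \<ge> 0" "r * L \<le> 1/4"
    and eq: "\<And>z. z \<in> square r \<Longrightarrow> W z = f z + vint2 (\<lambda>z. G (z, W z)) z"
    and f1: "continuous_on (square r) f1"
    and df: "\<And>u v. (u, v) \<in> square r \<Longrightarrow> ((\<lambda>u. f (u, v)) has_vector_derivative f1 (u, v)) (at u)"
  obtains S where "continuous_on (square r) S"
    "\<And>u v. (u, v) \<in> square r \<Longrightarrow> ((\<lambda>u. W (u, v)) has_vector_derivative S (u, v)) (at u)"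
    "\<And>z. z \<in> square r \<Longrightarrow> S z = f1 z + vint2 (\<lambda>z. A z ((1, 0), S z)) z"
proof -
  have linA: "linear (A z)" if "z \<in> square r" for z
    unfolding A_def using Ck_on_has_derivative[OF assms(3) mem[OF that]] has_derivative_linear by blast
  have contA: "continuous_on (square r) (\<lambda>z. A z s)" for s
  proof -
    have "continuous_on \<Omega> (\<lambda>y. frechet_derivative G (at y) s)"
      using assms(3) unfolding Ck_on.simps by blast
    moreover have "continuous_on (square r) (\<lambda>z. (z, W z))"
      using assms(4) by (intro continuous_intros)
    ultimately show ?thesis
      unfolding A_def by (rule continuous_on_compose2) (use mem in blast)
  qed
  have ex: "\<exists>S. continuous_on (closed_square \<rho>) S \<and>
      (\<forall>z\<in>closed_square \<rho>. S z = f1 z + vint2 (\<lambda>z. A z ((1, 0), S z)) z)"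
    if \<rho>: "0 < \<rho>" "\<rho> < r" for \<rho>
  proof -
    have sub: "closed_square \<rho> \<subseteq> square r" using \<rho> by (rule_tac closed_square_subset)
    have lip: "norm (A z ((1, 0), w) - A z ((1, 0), w')) \<le> L * norm (w - w')"
      if "z \<in> closed_square \<rho>" for z w w'
    proof -
      have "A z ((1, 0), w) - A z ((1, 0), w') = A z (0, w - w')"
        using linear_diff[OF linA, of z "((1, 0), w)" "((1, 0), w')"] that sub by (auto simp: zero_prod_def)
      then show ?thesis using bound[of z "w - w'"] that sub by auto
    qed
    have contAp: "continuous_on (closed_square \<rho> \<times> UNIV) (\<lambda>p. A (fst p) ((1, 0), snd p))"
    proof (rule continuous_on_linear_apply[where L="\<lambda>p. A (fst p)"])
      show "linear (A (fst p))" if "p \<in> closed_square \<rho> \<times> UNIV" for p :: "(real \<times> real) \<times> 'a"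
        using linA that sub by auto
      show "continuous_on (closed_square \<rho> \<times> UNIV) (\<lambda>p. A (fst p) s)" for s
        by (rule continuous_on_compose2[OF contA]) (use sub in \<open>auto intro!: continuous_intros\<close>)
    qed (intro continuous_intros)
    have "\<rho> * L \<le> 1/4" using L \<rho> mult_right_mono[of \<rho> r L] by linarith
    then have "\<exists>S. continuous_on (closed_square \<rho>) S \<and> S ` closed_square \<rho> \<subseteq> UNIV \<and>
      (\<forall>z\<in>closed_square \<rho>. S z = f1 z + vint1 (\<lambda>z. 0) z + vint2 (\<lambda>z. A z ((1, 0), S z)) z)"
      using \<rho>(1) L(1) continuous_on_subset[OF f1 sub] contAp lip
      by (intro volterra_exists[where L=L and F="\<lambda>_ _. 0" and G="\<lambda>z s. A z ((1, 0), s)", OF _ refl])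
        simp_all
    moreover have "vint1 (\<lambda>z. 0 :: 'a) = (\<lambda>z. 0)" by (rule ext) (simp add: vint1_def)
    ultimately show ?thesis by simp
  qed
  \<comment> \<open>Defining \<open>S\<close> as the derivative itself makes the solutions on
    different subsquares agree.\<close>
  define S where "S = (\<lambda>z. vector_derivative (\<lambda>u. W (u, snd z)) (at (fst z)))"
  have main: "continuous_on (square \<rho>) S \<and>
      (\<forall>(u, v)\<in>square \<rho>. ((\<lambda>u. W (u, v)) has_vector_derivative S (u, v)) (at u)) \<and>
      (\<forall>z\<in>square \<rho>. S z = f1 z + vint2 (\<lambda>z. A z ((1, 0), S z)) z)"
    if \<rho>: "0 < \<rho>" "\<rho> < r" for \<rho>
  proof -
    obtain T where T: "continuous_on (square \<rho>) T"
      "\<And>z. z \<in> square \<rho> \<Longrightarrow> T z = f1 z + vint2 (\<lambda>z. A z ((1, 0), T z)) z"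
    proof -
      obtain T where T: "continuous_on (closed_square \<rho>) T"
        "\<And>z. z \<in> closed_square \<rho> \<Longrightarrow> T z = f1 z + vint2 (\<lambda>z. A z ((1, 0), T z)) z"
        using ex[OF \<rho>] by blast
      show ?thesis
        by (rule that[OF continuous_on_subset[OF T(1) square_subset_closed] T(2)])
          (use square_subset_closed in blast)
    qed
    have d: "((\<lambda>u. W (u, v)) has_vector_derivative T (u, v)) (at u)" if "(u, v) \<in> square \<rho>" for u v
      by (rule volterra2_param_derivative_aux[OF assms(2-5) _ L eq f1 df \<rho>(2) T(1) _ that])
        (use bound T(2) in \<open>auto simp: A_def\<close>)
    then have ST: "S z = T z" if "z \<in> square \<rho>" for z
      using that by (cases z) (auto simp: S_def vector_derivative_at)
    have "vint2 (\<lambda>z. A z ((1, 0), S z)) z = vint2 (\<lambda>z. A z ((1, 0), T z)) z" if "z \<in> square \<rho>" for z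
      by (rule vint2_cong[OF shrinkable_square _ that]) (simp add: ST)
    moreover have "continuous_on (square \<rho>) S"
      using T(1) ST by (simp cong: continuous_on_cong)
    ultimately show ?thesis
      using d T(2)[symmetric] ST by (intro conjI ballI) (auto simp del: split_paired_All)
  qed
  have loc: "\<exists>\<rho>. 0 < \<rho> \<and> \<rho> < r \<and> z \<in> square \<rho>" if "z \<in> square r" for z
  proof -
    obtain u v where z: "z = (u, v)" "\<bar>u\<bar> < r" "\<bar>v\<bar> < r" using \<open>z \<in> square r\<close> by (cases z) (auto simp: mem_square)
    obtain \<rho> where "max \<bar>u\<bar> \<bar>v\<bar> < \<rho>" "\<rho> < r" using dense[of "max \<bar>u\<bar> \<bar>v\<bar>" r] z by auto
    then show ?thesis by (intro exI[of _ \<rho>]) (auto simp: z mem_square)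
  qed
  show ?thesis
  proof (rule that)
    show "continuous_on (square r) S"
      by (rule continuous_on_subsquares) (rule main[THEN conjunct1])
    show "((\<lambda>u. W (u, v)) has_vector_derivative S (u, v)) (at u)" if uv: "(u, v) \<in> square r" for u v
    proof -
      obtain \<rho> where "0 < \<rho>" "\<rho> < r" "(u, v) \<in> square \<rho>" using loc[OF uv] by blast
      then show ?thesis using main[THEN conjunct2, THEN conjunct1] by fastforce
    qed
    show "S z = f1 z + vint2 (\<lambda>z. A z ((1, 0), S z)) z" if z: "z \<in> square r" for z
    proof -
      obtain \<rho> where "0 < \<rho>" "\<rho> < r" "z \<in> square \<rho>" using loc[OF z] by blast
      then show ?thesis using main[THEN conjunct2, THEN conjunct2] by blast
    qed
  qed
qed

section \<open>Higher regularity of Volterra solutions\<close>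

lemma has_vector_derivative_partials:
  fixes f :: "real \<times> real \<Rightarrow> 'a::real_normed_vector"
  assumes "(f has_derivative D) (at (u, v))"
  shows "((\<lambda>u. f (u, v)) has_vector_derivative D (1, 0)) (at u)"
    and "((\<lambda>v. f (u, v)) has_vector_derivative D (0, 1)) (at v)"
proof -
  note lin = has_derivative_linear[OF assms]
  have 1: "((\<lambda>u. (u, v)) has_derivative (\<lambda>h. (h, 0))) (at u)"
    and 2: "((\<lambda>v. (u, v)) has_derivative (\<lambda>h. (0, h))) (at v)"
    by (auto intro!: derivative_eq_intros)
  have D: "(\<lambda>h. D (h, 0)) = (\<lambda>h. h *\<^sub>R D (1, 0))" "(\<lambda>h. D (0, h)) = (\<lambda>h. h *\<^sub>R D (0, 1))"
  proof -
    have "D (h, 0) = h *\<^sub>R D (1, 0)" "D (0, h) = h *\<^sub>R D (0, 1)" for h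
      using linear_scale[OF lin, of h "(1, 0)"] linear_scale[OF lin, of h "(0, 1)"] by simp_all
    then show "(\<lambda>h. D (h, 0)) = (\<lambda>h. h *\<^sub>R D (1, 0))" "(\<lambda>h. D (0, h)) = (\<lambda>h. h *\<^sub>R D (0, 1))"
      by blast+
  qed
  show "((\<lambda>u. f (u, v)) has_vector_derivative D (1, 0)) (at u)"
    using has_derivative_compose[OF 1 assms] unfolding has_vector_derivative_def D .
  show "((\<lambda>v. f (u, v)) has_vector_derivative D (0, 1)) (at v)"
    using has_derivative_compose[OF 2 assms] unfolding has_vector_derivative_def D .
qed

lemma has_derivative_of_partials:
  fixes W S V :: "real \<times> real \<Rightarrow> 'a::euclidean_space"
  assumes "continuous_on (square r) S" "continuous_on (square r) V"
    and dS: "\<And>u v. (u, v) \<in> square r \<Longrightarrow> ((\<lambda>u. W (u, v)) has_vector_derivative S (u, v)) (at u)"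
    and dV: "\<And>u v. (u, v) \<in> square r \<Longrightarrow> ((\<lambda>v. W (u, v)) has_vector_derivative V (u, v)) (at v)"
    and z: "z \<in> square r"
  shows "(W has_derivative (\<lambda>h. fst h *\<^sub>R S z + snd h *\<^sub>R V z)) (at z)"
proof -
  obtain u v where uv: "z = (u, v)" by (cases z)
  define I where "I = {-r<..<r}"
  have sq: "square r = I \<times> I" by (simp add: square_def I_def)
  have at: "at (u, v) within I \<times> I = at (u, v)"
    unfolding sq[symmetric] by (rule at_within_open[OF _ open_square]) (use z uv in simp)
  have "((\<lambda>(x, y). W (x, y)) has_derivative (\<lambda>(tx, ty). tx *\<^sub>R S (u, v) + blinfun_scaleR_left (V (u, v)) ty))
      (at (u, v) within I \<times> I)"
  proof (rule has_derivative_partialsI[where fy="\<lambda>x y. blinfun_scaleR_left (V (x, y))"])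
    show "((\<lambda>x. W (x, v)) has_derivative (\<lambda>tx. tx *\<^sub>R S (u, v))) (at u within I)"
      by (rule has_derivative_at_withinI) (use dS[of u v] z uv in \<open>simp add: has_vector_derivative_def\<close>)
    show "((\<lambda>y. W (x, y)) has_derivative blinfun_apply (blinfun_scaleR_left (V (x, y)))) (at y within I)"
      if "x \<in> I" "y \<in> I" for x y
      by (rule has_derivative_at_withinI)
        (use dV[of x y] that in \<open>simp add: sq has_vector_derivative_def\<close>)
    have "continuous (at (u, v)) (\<lambda>z. blinfun_scaleR_left (V z))"
      by (rule bounded_linear.continuous[OF bounded_linear_blinfun_scaleR_left])
        (use assms(2) z uv continuous_on_eq_continuous_at[OF open_square] in blast)
    then show "continuous (at (u, v) within I \<times> I) (\<lambda>(x, y). blinfun_scaleR_left (V (x, y)))"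
      unfolding at by (simp add: case_prod_unfold)
    show "v \<in> I" using z by (simp add: uv sq)
    show "convex I" by (simp add: I_def)
  qed
  then show ?thesis unfolding at uv by (simp add: case_prod_unfold)
qed

lemma Ck_on_Suc_of_partials:
  fixes W S V :: "real \<times> real \<Rightarrow> 'a::euclidean_space"
  assumes "Ck_on k S (square r)" "Ck_on k V (square r)"
    and "\<And>u v. (u, v) \<in> square r \<Longrightarrow> ((\<lambda>u. W (u, v)) has_vector_derivative S (u, v)) (at u)"
    and "\<And>u v. (u, v) \<in> square r \<Longrightarrow> ((\<lambda>v. W (u, v)) has_vector_derivative V (u, v)) (at v)"
  shows "Ck_on (Suc k) W (square r)"
proof (rule Ck_on_SucI[OF open_square])
  show "(W has_derivative (\<lambda>h. fst h *\<^sub>R S z + snd h *\<^sub>R V z)) (at z)" if "z \<in> square r" for z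
    using has_derivative_of_partials[OF Ck_on_continuous[OF assms(1)] Ck_on_continuous[OF assms(2)]
        assms(3,4) that] .
  show "Ck_on k (\<lambda>z. fst h *\<^sub>R S z + snd h *\<^sub>R V z) (square r)" for h
    by (intro Ck_on_add Ck_on_bounded_linear[OF bounded_linear_scaleR_right] open_square assms(1,2))
qed

text \<open>Serves to carry the bound \<open>L\<close> from an equation to its linearization, whose
  right-hand side is affine in the new unknown.\<close>

lemma frechet_derivative_snd_direction:
  fixes H :: "'a::real_normed_vector \<times> 'b::real_normed_vector \<Rightarrow> 'c::real_normed_vector"
  assumes "H differentiable (at (z, w))" "\<And>t. H (z, w + t *\<^sub>R s) = c + t *\<^sub>R d"
  shows "frechet_derivative H (at (z, w)) (0, s) = d"
proof -
  have dH: "(H has_derivative frechet_derivative H (at (z, w))) (at (z, w + 0 *\<^sub>R s))"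
    using assms(1) by (simp add: frechet_derivative_works)
  have "((\<lambda>t. (z, w + t *\<^sub>R s)) has_derivative (\<lambda>h. (0, h *\<^sub>R s))) (at 0)"
    by (auto intro!: derivative_eq_intros)
  from has_derivative_compose[OF this dH]
  have "((\<lambda>t. c + t *\<^sub>R d) has_derivative (\<lambda>h. frechet_derivative H (at (z, w)) (0, h *\<^sub>R s))) (at 0)"
    unfolding assms(2) .
  moreover have "((\<lambda>t. c + t *\<^sub>R d) has_derivative (\<lambda>h. h *\<^sub>R d)) (at 0)"
    by (auto intro!: derivative_eq_intros)
  ultimately have "(\<lambda>h. frechet_derivative H (at (z, w)) (0, h *\<^sub>R s)) = (\<lambda>h. h *\<^sub>R d)"
    by (rule has_derivative_unique)
  from fun_cong[OF this, of 1] show ?thesis by simp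
qed

text \<open>The \<open>u\<close>-derivative solves an equation of the same form, linear in the new unknown and with the same
  bound \<open>L\<close>, so the square does not shrink with the order of differentiation.\<close>

lemma volterra2_regular:
  fixes W f :: "real \<times> real \<Rightarrow> 'a::euclidean_space" and G :: "(real \<times> real) \<times> 'a \<Rightarrow> 'a"
  assumes "open \<Omega>" "Ck_on k G \<Omega>" "continuous_on (square r) W"
    "\<And>z. z \<in> square r \<Longrightarrow> (z, W z) \<in> \<Omega>"
    "\<And>z s. k > 0 \<Longrightarrow> z \<in> square r \<Longrightarrow> norm (frechet_derivative G (at (z, W z)) (0, s)) \<le> L * norm s"
    "L \<ge> 0" "r * L \<le> 1/4" "Ck_on k f (square r)"
    "\<And>z. z \<in> square r \<Longrightarrow> W z = f z + vint2 (\<lambda>z. G (z, W z)) z"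
  shows "Ck_on k W (square r)"
  using assms
proof (induction k arbitrary: \<Omega> G W f)
  case 0
  then show ?case by simp
next
  case (Suc k)
  note opn = open_square[of r]
  \<comment> \<open>Regularity of order \<open>k\<close> comes first, because the coefficients of
    the equation for the \<open>u\<close>-derivative contain \<open>W\<close>.\<close>
  have W: "Ck_on k W (square r)"
    by (rule Suc.IH[OF Suc.prems(1) _ Suc.prems(3,4) _ Suc.prems(6,7) _ Suc.prems(9)])
      (use Suc.prems in \<open>blast intro: Ck_on_Suc_imp\<close>)+
  define f1 where "f1 = (\<lambda>z. frechet_derivative f (at z) (1, 0))"
  define f2 where "f2 = (\<lambda>z. frechet_derivative f (at z) (0, 1))"
  have f1: "Ck_on k f1 (square r)" and f2: "Ck_on k f2 (square r)"
    using Suc.prems(8) unfolding f1_def f2_def Ck_on.simps by blast+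
  define A where "A = (\<lambda>z. frechet_derivative G (at (z, W z)))"
  have G1: "Ck_on (Suc 0) G \<Omega>" using Suc.prems(2) by (rule Ck_on_le) simp
  have dG: "(G has_derivative A z) (at (z, W z))" if "z \<in> square r" for z
    unfolding A_def by (rule Ck_on_has_derivative[OF G1 Suc.prems(4)[OF that]])
  have df: "((\<lambda>u. f (u, v)) has_vector_derivative f1 (u, v)) (at u)"
    "((\<lambda>v. f (u, v)) has_vector_derivative f2 (u, v)) (at v)" if "(u, v) \<in> square r" for u v
    unfolding f1_def f2_def
    using has_vector_derivative_partials[OF Ck_on_has_derivative[OF Suc.prems(8) that]] by blast+
  obtain S where S: "continuous_on (square r) S"
    "\<And>u v. (u, v) \<in> square r \<Longrightarrow> ((\<lambda>u. W (u, v)) has_vector_derivative S (u, v)) (at u)"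
    "\<And>z. z \<in> square r \<Longrightarrow> S z = f1 z + vint2 (\<lambda>z. A z ((1, 0), S z)) z"
  proof (rule volterra2_param_derivative[OF Suc.prems(1) G1 Suc.prems(3,4) _ Suc.prems(6,7) Suc.prems(9)
        Ck_on_continuous[OF f1] df(1)])
    show "norm (frechet_derivative G (at (z, W z)) (0, s)) \<le> L * norm s" if "z \<in> square r" for z s
      using Suc.prems(5)[OF _ that] by simp
  qed (auto simp: A_def)
  \<comment> \<open>Right-hand side of the linearized equation, affine in its last argument and of
    class \<open>k\<close> only: one order of \<open>G\<close> is spent.\<close>
  define G2 where "G2 = (\<lambda>p. A (fst p) ((1, 0), snd p))"
  have opn2: "open (square r \<times> (UNIV :: 'a set))" by (intro open_Times opn open_UNIV)
  have WW: "Ck_on k (\<lambda>p. (fst p, W (fst p))) (square r \<times> (UNIV :: 'a set))"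
    by (intro Ck_on_Pair opn2 Ck_on_bounded_linear[OF bounded_linear_fst] Ck_on_id Ck_on_compose[OF _ _ W]) auto
  have A: "Ck_on k (\<lambda>p. A (fst p) v) (square r \<times> (UNIV :: 'a set))" for v
  proof -
    have "Ck_on k (\<lambda>y. frechet_derivative G (at y) v) \<Omega>"
      using Suc.prems(2) unfolding Ck_on.simps by blast
    moreover have "(\<lambda>p. (fst p, W (fst p))) ` (square r \<times> (UNIV :: 'a set)) \<subseteq> \<Omega>"
      using Suc.prems(4) by force
    ultimately show ?thesis
      unfolding A_def by (rule Ck_on_compose[OF opn2 WW])
  qed
  have G2: "Ck_on k G2 (square r \<times> UNIV)"
    unfolding G2_def
  proof (rule Ck_on_linear_apply[OF opn2, where L="\<lambda>p. A (fst p)"])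
    show "linear (A (fst p))" if "p \<in> square r \<times> UNIV" for p :: "(real \<times> real) \<times> 'a"
      using dG[of "fst p"] that has_derivative_linear by auto
    show "Ck_on k (\<lambda>p. ((1::real, 0::real), snd p)) (square r \<times> (UNIV :: 'a set))"
      by (intro Ck_on_Pair opn2 Ck_on_const Ck_on_bounded_linear[OF bounded_linear_snd] Ck_on_id)
  qed (rule A)
  have "Ck_on k S (square r)"
  proof (rule Suc.IH[OF opn2 G2 S(1) _ _ Suc.prems(6,7) f1])
    show "norm (frechet_derivative G2 (at (z, S z)) (0, s)) \<le> L * norm s" if "k > 0" and z: "z \<in> square r" for z s
    proof -
      obtain j where "k = Suc j" using \<open>k > 0\<close> by (cases k) auto
      then have "G2 differentiable (at (z, S z))"
        using Ck_on_has_derivative[of j G2 "square r \<times> UNIV" "(z, S z)"] G2 z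
        unfolding differentiable_def by blast
      moreover have lin: "linear (A z)" using dG[OF z] has_derivative_linear by blast
      have "G2 (z, S z + t *\<^sub>R s) = A z ((1, 0), S z) + t *\<^sub>R A z (0, s)" for t
        using linear_add[OF lin, of "((1, 0), S z)" "t *\<^sub>R (0, s)"] linear_scale[OF lin, of t "(0, s)"]
        by (simp add: G2_def)
      ultimately have "frechet_derivative G2 (at (z, S z)) (0, s) = A z (0, s)"
        by (rule frechet_derivative_snd_direction)
      then show ?thesis using Suc.prems(5)[OF _ z, of s] by (simp add: A_def)
    qed
  qed (use S(3) in \<open>auto simp: G2_def\<close>)
  moreover have GW: "Ck_on k (\<lambda>z. G (z, W z)) (square r)"
    by (rule Ck_on_compose[OF opn _ Ck_on_Suc_imp[OF Suc.prems(2)]])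
      (use Suc.prems(4) in \<open>auto intro!: Ck_on_Pair opn Ck_on_id W\<close>)
  moreover have "((\<lambda>v. W (u, v)) has_vector_derivative f2 (u, v) + G ((u, v), W (u, v))) (at v)"
    if "(u, v) \<in> square r" for u v
  proof (rule has_vector_derivative_transform_within_open[where S="{-r<..<r}"])
    show "((\<lambda>v. f (u, v) + vint2 (\<lambda>z. G (z, W z)) (u, v)) has_vector_derivative f2 (u, v) + G ((u, v), W (u, v))) (at v)"
      using vint2_has_vector_derivative[OF Ck_on_continuous[OF GW] that]
      by (intro has_vector_derivative_add df(2)[OF that]) simp
    show "f (u, y) + vint2 (\<lambda>z. G (z, W z)) (u, y) = W (u, y)" if "y \<in> {-r<..<r}" for y
      by (rule Suc.prems(9)[symmetric]) (use that \<open>(u, v) \<in> square r\<close> in \<open>auto simp: mem_square\<close>)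
  qed (use that in \<open>auto simp: mem_square\<close>)
  ultimately show ?case
    by (intro Ck_on_Suc_of_partials[where V="\<lambda>z. f2 z + G (z, W z)", OF _ _ S(2)] Ck_on_add opn f2)
qed

text \<open>The \<open>vint1\<close> term is treated as given data: its \<open>u\<close>-derivative
  \<open>F (W z)\<close> is known and as regular as \<open>W\<close>. What remains is an equation in
  the \<open>v\<close>-direction alone, so regularity \<open>k\<close> of \<open>W\<close> passes to
  its \<open>u\<close>-derivative.\<close>

lemma volterra_derivative_regular:
  fixes W :: "real \<times> real \<Rightarrow> 'a::euclidean_space"
  assumes "open \<Omega>" "smooth_on F \<Omega>" "smooth_on G \<Omega>" "Ck_on k W (square r)" "W ` square r \<subseteq> \<Omega>"
    and bound: "\<And>z s. z \<in> square r \<Longrightarrow> norm (frechet_derivative G (at (W z)) s) \<le> L * norm s"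
    and L: "L \<ge> 0" "r * L \<le> 1/4"
    and eq: "\<And>z. z \<in> square r \<Longrightarrow> W z = w0 + vint1 (\<lambda>z. F (W z)) z + vint2 (\<lambda>z. G (W z)) z"
  obtains S where "Ck_on k S (square r)"
    "\<And>u v. (u, v) \<in> square r \<Longrightarrow> ((\<lambda>u. W (u, v)) has_vector_derivative S (u, v)) (at u)"
proof -
  note opn = open_square[of r]
  have FW: "Ck_on k (\<lambda>z. F (W z)) (square r)"
    by (rule Ck_on_compose[OF opn assms(4) smooth_on_Ck[OF assms(2)] assms(5)])
  define G1 :: "(real \<times> real) \<times> 'a \<Rightarrow> 'a" where "G1 = (\<lambda>p. G (snd p))"
  have opn1: "open ((UNIV :: (real \<times> real) set) \<times> \<Omega>)" by (intro open_Times assms(1) open_UNIV)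
  have G1: "smooth_on G1 (UNIV \<times> \<Omega>)"
    unfolding G1_def
    by (rule smooth_on_compose[OF opn1 smooth_on_snd[OF opn1 smooth_on_id[OF opn1]] assms(3)]) auto
  have dG: "(G has_derivative frechet_derivative G (at (W z))) (at (W z))" if "z \<in> square r" for z
    using smooth_on_has_derivative[OF assms(3)] that assms(5) by blast
  have dG1: "frechet_derivative G1 (at (z, W z)) = (\<lambda>a. frechet_derivative G (at (W z)) (snd a))"
    if "z \<in> square r" for z
  proof -
    have "(snd has_derivative snd) (at (z, W z))"
      by (rule bounded_linear_imp_has_derivative[OF bounded_linear_snd])
    from has_derivative_compose[OF this, of G] show ?thesis
      using dG[OF that] frechet_derivative_at unfolding G1_def by fastforce
  qed
  obtain S where S: "continuous_on (square r) S"
    "\<And>u v. (u, v) \<in> square r \<Longrightarrow> ((\<lambda>u. W (u, v)) has_vector_derivative S (u, v)) (at u)"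
    "\<And>z. z \<in> square r \<Longrightarrow> S z = F (W z) + vint2 (\<lambda>z. frechet_derivative G1 (at (z, W z)) ((1, 0), S z)) z"
  proof (rule volterra2_param_derivative[OF opn1 smooth_on_Ck[OF G1] Ck_on_continuous[OF assms(4)] _ _ L _
        Ck_on_continuous[OF FW]])
    show "(z, W z) \<in> UNIV \<times> \<Omega>" if "z \<in> square r" for z using that assms(5) by auto
    show "norm (frechet_derivative G1 (at (z, W z)) (0, s)) \<le> L * norm s" if "z \<in> square r" for z s
      using bound[OF that, of s] dG1[OF that] by simp
    show "W z = (w0 + vint1 (\<lambda>z. F (W z)) z) + vint2 (\<lambda>z. G1 (z, W z)) z" if "z \<in> square r" for z
      using eq[OF that] by (simp add: G1_def)
    show "((\<lambda>u. w0 + vint1 (\<lambda>z. F (W z)) (u, v)) has_vector_derivative F (W (u, v))) (at u)"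
      if "(u, v) \<in> square r" for u v
      using has_vector_derivative_add[OF has_vector_derivative_const vint1_has_vector_derivative[OF Ck_on_continuous[OF FW] that], of w0]
      by simp
  qed blast
  define G2 where "G2 = (\<lambda>p. frechet_derivative G (at (W (fst p))) (snd p))"
  have opn2: "open (square r \<times> (UNIV :: 'a set))" by (intro open_Times opn open_UNIV)
  have Wfst: "Ck_on k (\<lambda>p. W (fst p)) (square r \<times> (UNIV :: 'a set))"
    by (rule Ck_on_compose[OF opn2 Ck_on_bounded_linear[OF bounded_linear_fst opn2 Ck_on_id[OF opn2]] assms(4)]) auto
  have G2: "Ck_on k G2 (square r \<times> UNIV)"
    unfolding G2_def
  proof (rule Ck_on_linear_apply[OF opn2, where L="\<lambda>p. frechet_derivative G (at (W (fst p)))"])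
    show "linear (frechet_derivative G (at (W (fst p))))" if "p \<in> square r \<times> UNIV" for p :: "(real \<times> real) \<times> 'a"
      using dG[of "fst p"] that has_derivative_linear by auto
    show "Ck_on k (\<lambda>p. frechet_derivative G (at (W (fst p))) v) (square r \<times> (UNIV :: 'a set))" for v
      by (rule Ck_on_compose[OF opn2 Wfst smooth_on_Ck[OF smooth_on_frechet_const[OF assms(3)]]])
        (use assms(5) in force)
    show "Ck_on k snd (square r \<times> (UNIV :: 'a set))"
      by (rule Ck_on_bounded_linear[OF bounded_linear_snd opn2 Ck_on_id[OF opn2]])
  qed
  have "Ck_on k S (square r)"
  proof (rule volterra2_regular[OF opn2 G2 S(1) _ _ L FW])
    show "(z, S z) \<in> square r \<times> UNIV" if "z \<in> square r" for z using that by simp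
    show "norm (frechet_derivative G2 (at (z, S z)) (0, s)) \<le> L * norm s" if "k > 0" and z: "z \<in> square r" for z s
    proof -
      obtain j where j: "k = Suc j" using \<open>k > 0\<close> by (cases k) auto
      have "G2 differentiable (at (z, S z))"
        using Ck_on_has_derivative[of j G2 "square r \<times> UNIV" "(z, S z)"] G2 z
        unfolding j differentiable_def by blast
      moreover have "G2 (z, S z + t *\<^sub>R s) = G2 (z, S z) + t *\<^sub>R frechet_derivative G (at (W z)) s" for t
        using linear_add[OF has_derivative_linear[OF dG[OF z]], of "S z" "t *\<^sub>R s"]
          linear_scale[OF has_derivative_linear[OF dG[OF z]], of t s] by (simp add: G2_def)
      ultimately have "frechet_derivative G2 (at (z, S z)) (0, s) = frechet_derivative G (at (W z)) s"
        by (rule frechet_derivative_snd_direction)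
      then show ?thesis using bound[OF z] by simp
    qed
    show "S z = F (W z) + vint2 (\<lambda>z. G2 (z, S z)) z" if z: "z \<in> square r" for z
    proof -
      have "vint2 (\<lambda>z. frechet_derivative G1 (at (z, W z)) ((1, 0), S z)) z = vint2 (\<lambda>z. G2 (z, S z)) z"
        by (rule vint2_cong[OF shrinkable_square _ z]) (simp add: dG1 G2_def)
      then show ?thesis using S(3)[OF z] by simp
    qed
  qed
  then show ?thesis using that S(2) by blast
qed

section \<open>Smooth solutions of the system in both directions\<close>

lemma prod_swap_square: "prod.swap ` square r = square r" "z \<in> square r \<Longrightarrow> prod.swap z \<in> square r"
  by (auto simp: square_def)

lemma smooth_on_swap: "smooth_on prod.swap (square r)"
proof -
  have "smooth_on (\<lambda>z. (snd z, fst z)) (square r)"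
    by (intro smooth_on_Pair smooth_on_fst smooth_on_snd smooth_on_id open_square)
  then show ?thesis by (simp add: prod.swap_def[abs_def])
qed

text \<open>Regularity climbs one order at a time on a fixed square: if \<open>W\<close> is of class
  \<open>k\<close>, so are both partial derivatives, the second one by exchanging the
  variables.\<close>

theorem volterra_smooth_solution:
  fixes F G :: "'a::euclidean_space \<Rightarrow> 'a"
  assumes "open \<Omega>" "w0 \<in> \<Omega>" "smooth_on F \<Omega>" "smooth_on G \<Omega>"
  obtains r W where "r > 0" "smooth_on W (square r)" "W ` square r \<subseteq> \<Omega>"
    "\<And>z. z \<in> square r \<Longrightarrow> W z = w0 + vint1 (\<lambda>z. F (W z)) z + vint2 (\<lambda>z. G (W z)) z"
proof -
  obtain \<rho> where \<rho>: "\<rho> > 0" "cball w0 \<rho> \<subseteq> \<Omega>"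
    using assms(1,2) open_contains_cball by blast
  \<comment> \<open>Controls the derivative and the value of a map at once; compactness of the ball
    makes it bounded.\<close>
  define N :: "('a \<Rightarrow> 'a) \<Rightarrow> 'a \<Rightarrow> real" where "N = (\<lambda>H w. (\<Sum>b\<in>Basis. norm (frechet_derivative H (at w) b)) + norm (H w))"
  have N: "\<exists>C\<ge>0. \<forall>w\<in>cball w0 \<rho>. N H w \<le> C" if H: "smooth_on H \<Omega>" for H :: "'a \<Rightarrow> 'a"
  proof -
    have "continuous_on \<Omega> (N H)"
      unfolding N_def
      by (intro continuous_intros smooth_on_continuous[OF H] smooth_on_continuous[OF smooth_on_frechet_const[OF H]])
    then have "compact (N H ` cball w0 \<rho>)"
      using compact_continuous_image[OF continuous_on_subset[OF _ \<rho>(2)] compact_cball] by blast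
    from compact_imp_bounded[OF this] obtain C where C: "\<forall>x \<in> N H ` cball w0 \<rho>. norm x \<le> C"
      unfolding bounded_iff by (rule exE)
    have "N H w \<le> max C 0" if "w \<in> cball w0 \<rho>" for w
      using bspec[OF C imageI[OF that]] by (simp add: le_max_iff_disj abs_le_iff)
    then show ?thesis by (intro exI[of _ "max C 0"]) simp
  qed
  obtain C where C: "C \<ge> 0" "\<And>w. w \<in> cball w0 \<rho> \<Longrightarrow> N F w \<le> C" "\<And>w. w \<in> cball w0 \<rho> \<Longrightarrow> N G w \<le> C"
  proof -
    obtain C1 C2 where "C1 \<ge> 0" "\<forall>w\<in>cball w0 \<rho>. N F w \<le> C1" "\<forall>w\<in>cball w0 \<rho>. N G w \<le> C2"
      using N[OF assms(3)] N[OF assms(4)] by blast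
    then show ?thesis by (intro that[of "max C1 C2"]) (auto simp: le_max_iff_disj)
  qed
  have props: "norm (H w) \<le> C \<and> norm (frechet_derivative H (at w) s) \<le> C * norm s"
    if H: "smooth_on H \<Omega>" and NC: "\<And>w. w \<in> cball w0 \<rho> \<Longrightarrow> N H w \<le> C" and w: "w \<in> cball w0 \<rho>" for H w s
  proof
    have "0 \<le> (\<Sum>b\<in>Basis. norm (frechet_derivative H (at w) b))" by (intro sum_nonneg) simp
    then show "norm (H w) \<le> C" using NC[OF w] by (simp add: N_def)
    have "norm (frechet_derivative H (at w) s) \<le> (\<Sum>b\<in>Basis. norm (frechet_derivative H (at w) b)) * norm s"
      by (rule norm_linear_le_basis[OF smooth_on_linear_derivative[OF H]]) (use w \<rho> in auto)
    also have "\<dots> \<le> C * norm s"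
    proof (rule mult_right_mono)
      show "(\<Sum>b\<in>Basis. norm (frechet_derivative H (at w) b)) \<le> C"
        using NC[OF w] norm_ge_zero[of "H w"] unfolding N_def by linarith
    qed simp
    finally show "norm (frechet_derivative H (at w) s) \<le> C * norm s" .
  qed
  have lip: "norm (H w - H w') \<le> C * norm (w - w')"
    if H: "smooth_on H \<Omega>" and NC: "\<And>w. w \<in> cball w0 \<rho> \<Longrightarrow> N H w \<le> C"
      and w: "w \<in> cball w0 \<rho>" "w' \<in> cball w0 \<rho>" for H w w'
  proof (rule differentiable_bound[OF convex_cball _ _ w])
    show "(H has_derivative frechet_derivative H (at x)) (at x within cball w0 \<rho>)" if "x \<in> cball w0 \<rho>" for x
      using smooth_on_has_derivative[OF H, of x] that \<rho> by (blast intro: has_derivative_at_withinI)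
    show "onorm (frechet_derivative H (at x)) \<le> C" if "x \<in> cball w0 \<rho>" for x
      by (rule onorm_le) (use props[OF H NC that] in blast)
  qed
  \<comment> \<open>The first bound keeps the iterates in the ball, as the two integrals contribute
    at most \<open>r * C\<close> each; the second gives the contraction. The summand 1 covers
    \<open>C = 0\<close>.\<close>
  define r where "r = min (\<rho> / (2 * (C + 1))) (1 / (4 * (C + 1)))"
  have r: "r > 0" "r * C \<le> 1/4" "2 * (r * C) \<le> \<rho>"
  proof -
    show r0: "r > 0" unfolding r_def using \<rho> C(1) by simp
    have "r \<le> \<rho> / (2 * (C + 1))" "r \<le> 1 / (4 * (C + 1))" by (simp_all add: r_def)
    then have "r * (2 * (C + 1)) \<le> \<rho>" "r * (4 * (C + 1)) \<le> 1"
      using C(1) by (simp_all add: pos_le_divide_eq)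
    then show "r * C \<le> 1/4" "2 * (r * C) \<le> \<rho>"
      using r0 by (simp_all add: algebra_simps)
  qed
  have cont: "continuous_on (closed_square r \<times> cball w0 \<rho>) (\<lambda>p. H (snd p))" if H: "smooth_on H \<Omega>" for H :: "'a \<Rightarrow> 'a"
    by (rule continuous_on_compose2[OF smooth_on_continuous[OF H]]) (use \<rho> in \<open>auto intro!: continuous_intros\<close>)
  have "\<exists>W. continuous_on (closed_square r) W \<and> W ` closed_square r \<subseteq> cball w0 \<rho> \<and>
    (\<forall>z\<in>closed_square r. W z = w0 + vint1 (\<lambda>z. F (W z)) z + vint2 (\<lambda>z. G (W z)) z)"
  proof (rule volterra_exists[where L=C and F="\<lambda>_. F" and G="\<lambda>_. G" and f="\<lambda>_. w0", OF _ refl])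
    show "w0 + vint1 (\<lambda>z. F (W z)) z + vint2 (\<lambda>z. G (W z)) z \<in> cball w0 \<rho>"
      if W: "continuous_on (closed_square r) W" "W ` closed_square r \<subseteq> cball w0 \<rho>" and z: "z \<in> closed_square r" for W z
    proof -
      obtain u v where uv: "z = (u, v)" by (cases z)
      have m: "(u, v) \<in> closed_square r" using z uv by simp
      have HW: "continuous_on (closed_square r) (\<lambda>z. H (W z))" if "smooth_on H \<Omega>" for H :: "'a \<Rightarrow> 'a"
        by (rule continuous_on_compose2[OF smooth_on_continuous[OF that] W(1)]) (use W(2) \<rho>(2) in blast)
      have "norm (vint1 (\<lambda>z. F (W z)) (u, v)) \<le> \<bar>u\<bar> * C"
        using W(2) shrinkable1[OF shrinkable_closed_square m] props[OF assms(3) C(2)]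
        by (intro norm_vint1_le[OF shrinkable_closed_square HW[OF assms(3)] m]) blast
      moreover have "norm (vint2 (\<lambda>z. G (W z)) (u, v)) \<le> \<bar>v\<bar> * C"
        using W(2) shrinkable2[OF shrinkable_closed_square m] props[OF assms(4) C(3)]
        by (intro norm_vint2_le[OF shrinkable_closed_square HW[OF assms(4)] m]) blast
      moreover have "\<bar>u\<bar> * C \<le> r * C" "\<bar>v\<bar> * C \<le> r * C"
        using m C(1) by (auto simp: mem_closed_square intro: mult_right_mono)
      ultimately have "norm (vint1 (\<lambda>z. F (W z)) (u, v) + vint2 (\<lambda>z. G (W z)) (u, v)) \<le> \<rho>"
        using r(3) norm_triangle_ineq[of "vint1 (\<lambda>z. F (W z)) (u, v)" "vint2 (\<lambda>z. G (W z)) (u, v)"] by linarith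
      then have "dist (w0 + vint1 (\<lambda>z. F (W z)) z + vint2 (\<lambda>z. G (W z)) z) w0 \<le> \<rho>"
        by (simp add: uv dist_norm add.assoc)
      then show ?thesis by (simp add: dist_commute)
    qed
    show "cball w0 \<rho> \<noteq> {}" using \<rho>(1) by simp
    show "norm (F w - F w') \<le> C * norm (w - w')" if "w \<in> cball w0 \<rho>" "w' \<in> cball w0 \<rho>" for w w'
      using lip[OF assms(3) C(2) that] by simp
    show "norm (G w - G w') \<le> C * norm (w - w')" if "w \<in> cball w0 \<rho>" "w' \<in> cball w0 \<rho>" for w w'
      using lip[OF assms(4) C(3) that] by simp
    show "r * C \<le> 1/4" by (rule r(2))
  qed (use r(1) in \<open>simp_all add: cont assms(3,4) C(1)\<close>)
  then obtain W where W: "continuous_on (closed_square r) W" "W ` closed_square r \<subseteq> cball w0 \<rho>"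
    "\<And>z. z \<in> closed_square r \<Longrightarrow> W z = w0 + vint1 (\<lambda>z. F (W z)) z + vint2 (\<lambda>z. G (W z)) z"
    by blast
  have W\<Omega>: "W ` square r \<subseteq> cball w0 \<rho>" "W ` square r \<subseteq> \<Omega>"
    using W(2) \<rho>(2) square_subset_closed by blast+
  have eq: "W z = w0 + vint1 (\<lambda>z. F (W z)) z + vint2 (\<lambda>z. G (W z)) z" if "z \<in> square r" for z
    using W(3) that square_subset_closed by blast
  \<comment> \<open>The swap exchanges \<open>vint1\<close> with \<open>vint2\<close> and
    \<open>F\<close> with \<open>G\<close>, so that the \<open>u\<close>-derivative of
    \<open>V\<close> is the \<open>v\<close>-derivative of \<open>W\<close>.\<close>
  define V where "V = W \<circ> prod.swap"
  have V\<Omega>: "V ` square r \<subseteq> \<Omega>" using W\<Omega>(2) prod_swap_square(2) by (auto simp: V_def)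
  have eqV: "V z = w0 + vint1 (\<lambda>z. G (V z)) z + vint2 (\<lambda>z. F (V z)) z" if "z \<in> square r" for z
    using eq[OF prod_swap_square(2)[OF that]]
    by (simp add: V_def vint1_swap[of "\<lambda>z. F (W z)"] vint2_swap[of "\<lambda>z. G (W z)"] o_def)
  have "Ck_on k W (square r)" for k
  proof (induction k)
    case 0
    show ?case using continuous_on_subset[OF W(1) square_subset_closed] by simp
  next
    case (Suc k)
    have Vk: "Ck_on k V (square r)"
      unfolding V_def o_def
      by (rule Ck_on_compose[OF open_square smooth_on_Ck[OF smooth_on_swap] Suc.IH]) (simp add: prod_swap_square)
    obtain S where S: "Ck_on k S (square r)"
      "\<And>u v. (u, v) \<in> square r \<Longrightarrow> ((\<lambda>u. W (u, v)) has_vector_derivative S (u, v)) (at u)"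
      using volterra_derivative_regular[OF assms(1,3,4) Suc.IH W\<Omega>(2) _ C(1) r(2) eq]
        props[OF assms(4) C(3)] W\<Omega>(1) by blast
    have bV: "norm (frechet_derivative F (at (V z)) s) \<le> C * norm s" if "z \<in> square r" for z s
      using props[OF assms(3) C(2)] W\<Omega>(1) prod_swap_square(2)[OF that] by (auto simp: V_def)
    obtain T where T: "Ck_on k T (square r)"
      "\<And>u v. (u, v) \<in> square r \<Longrightarrow> ((\<lambda>u. V (u, v)) has_vector_derivative T (u, v)) (at u)"
      using volterra_derivative_regular[OF assms(1,4,3) Vk V\<Omega> bV C(1) r(2) eqV] by metis
    show ?case
    proof (rule Ck_on_Suc_of_partials[OF S(1) _ S(2)])
      show "Ck_on k (\<lambda>z. T (prod.swap z)) (square r)"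
        by (rule Ck_on_compose[OF open_square smooth_on_Ck[OF smooth_on_swap] T(1)]) (simp add: prod_swap_square)
      show "((\<lambda>v. W (u, v)) has_vector_derivative T (prod.swap (u, v))) (at v)" if "(u, v) \<in> square r" for u v
        using T(2)[of v u] that by (simp add: V_def mem_square)
    qed
  qed
  then show ?thesis
    using that[OF r(1) _ W\<Omega>(2) eq] by (simp add: smooth_on_def)
qed

section \<open>Characteristic coordinates\<close>

text \<open>With \<open>C\<close> a bound for \<open>A\<close> on the compact interval, the squared
  norm of \<open>\<phi>\<close> times \<open>exp (- 2 C t)\<close> cannot increase, and it starts at
  0.\<close>

lemma linear_ode_zero_right:
  fixes \<phi> :: "real \<Rightarrow> 'a::euclidean_space"
  assumes "0 \<le> s" "s < r"
    and d: "\<And>t. 0 \<le> t \<Longrightarrow> t < r \<Longrightarrow> (\<phi> has_vector_derivative A t (\<phi> t)) (at t)"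
    and lin: "\<And>t. 0 \<le> t \<Longrightarrow> t < r \<Longrightarrow> linear (A t)"
    and cont: "\<And>v. continuous_on {0..<r} (\<lambda>t. A t v)"
    and "\<phi> 0 = 0"
  shows "\<phi> s = 0"
proof -
  define N where "N = (\<lambda>t. \<Sum>b\<in>Basis. norm (A t b))"
  have "continuous_on {0..s} N"
    unfolding N_def using assms(2)
    by (intro continuous_intros continuous_on_subset[OF cont]) auto
  from compact_imp_bounded[OF compact_continuous_image[OF this compact_Icc]]
  obtain C where "\<forall>x \<in> N ` {0..s}. norm x \<le> C" unfolding bounded_iff by (rule exE)
  then have C: "N t \<le> C" if "t \<in> {0..s}" for t
    using that by force
  have A: "\<phi> t \<bullet> A t (\<phi> t) \<le> C * (\<phi> t \<bullet> \<phi> t)" if t: "0 \<le> t" "t \<le> s" for t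
  proof -
    have "\<phi> t \<bullet> A t (\<phi> t) \<le> norm (\<phi> t) * norm (A t (\<phi> t))" by (rule norm_cauchy_schwarz)
    also have "\<dots> \<le> norm (\<phi> t) * (C * norm (\<phi> t))"
    proof (rule mult_left_mono)
      have "norm (A t (\<phi> t)) \<le> N t * norm (\<phi> t)"
        unfolding N_def using norm_linear_le_basis[OF lin[of t]] t assms(2) by simp
      also have "\<dots> \<le> C * norm (\<phi> t)" using C[of t] t by (intro mult_right_mono) auto
      finally show "norm (A t (\<phi> t)) \<le> C * norm (\<phi> t)" .
    qed simp
    also have "\<dots> = C * (\<phi> t \<bullet> \<phi> t)" by (simp add: power2_norm_eq_inner[symmetric] power2_eq_square)
    finally show ?thesis .
  qed
  define \<psi> where "\<psi> = (\<lambda>t. (\<phi> t \<bullet> \<phi> t) * exp (- (2 * C * t)))"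
  have "\<psi> s \<le> \<psi> 0"
  proof (rule DERIV_nonpos_imp_nonincreasing[OF assms(1)])
    fix t assume t: "0 \<le> t" "t \<le> s"
    have d\<phi>: "(\<phi> has_derivative (\<lambda>h. h *\<^sub>R A t (\<phi> t))) (at t)"
      using d[of t] t assms(2) by (simp add: has_vector_derivative_def)
    have "((\<lambda>t. \<phi> t \<bullet> \<phi> t) has_real_derivative 2 * (\<phi> t \<bullet> A t (\<phi> t))) (at t)"
      unfolding has_field_derivative_def
      by (rule has_derivative_eq_rhs[OF has_derivative_inner[OF d\<phi> d\<phi>]])
        (auto simp: fun_eq_iff inner_commute)
    then have "(\<psi> has_real_derivative (2 * (\<phi> t \<bullet> A t (\<phi> t)) - 2 * C * (\<phi> t \<bullet> \<phi> t)) * exp (- (2 * C * t))) (at t)"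
      unfolding \<psi>_def by (auto intro!: derivative_eq_intros simp: algebra_simps)
    moreover have "(2 * (\<phi> t \<bullet> A t (\<phi> t)) - 2 * C * (\<phi> t \<bullet> \<phi> t)) * exp (- (2 * C * t)) \<le> 0"
      using A[OF t] by (intro mult_nonpos_nonneg) auto
    ultimately show "\<exists>y. (\<psi> has_real_derivative y) (at t) \<and> y \<le> 0" by blast
  qed
  then have "\<phi> s \<bullet> \<phi> s \<le> 0"
    using assms(6) by (simp add: \<psi>_def mult_le_0_iff)
  then have "\<phi> s \<bullet> \<phi> s = 0"
    using inner_ge_zero[of "\<phi> s"] by linarith
  then show ?thesis by simp
qed

lemma linear_ode_zero:
  fixes \<phi> :: "real \<Rightarrow> 'a::euclidean_space"
  assumes s: "\<bar>s\<bar> < r"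
    and d: "\<And>t. \<bar>t\<bar> < r \<Longrightarrow> (\<phi> has_vector_derivative A t (\<phi> t)) (at t)"
    and lin: "\<And>t. \<bar>t\<bar> < r \<Longrightarrow> linear (A t)"
    and cont: "\<And>v. continuous_on {-r<..<r} (\<lambda>t. A t v)"
    and "\<phi> 0 = 0"
  shows "\<phi> s = 0"
proof (cases "s \<ge> 0")
  case True
  show ?thesis
    by (rule linear_ode_zero_right[of s r \<phi> A])
      (use True s d lin assms(5) in \<open>auto intro!: continuous_on_subset[OF cont]\<close>)
next
  case False
  have "(\<lambda>t. \<phi> (- t)) (- s) = 0"
  proof (rule linear_ode_zero_right[of "- s" r "\<lambda>t. \<phi> (- t)" "\<lambda>t v. - A (- t) v"])
    show "((\<lambda>t. \<phi> (- t)) has_vector_derivative - A (- t) (\<phi> (- t))) (at t)" if "0 \<le> t" "t < r" for t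
    proof -
      have "((\<lambda>t. - t) has_vector_derivative - 1) (at t)"
        by (auto intro!: derivative_eq_intros)
      from vector_diff_chain_at[OF this, of \<phi> "A (- t) (\<phi> (- t))"] show ?thesis
        using d[of "- t"] that by (simp add: o_def)
    qed
    show "linear (\<lambda>v. - A (- t) v)" if "0 \<le> t" "t < r" for t
      using lin[of "- t"] that by (intro linear_compose_neg) auto
    show "continuous_on {0..<r} (\<lambda>t. - A (- t) v)" for v
      by (intro continuous_on_minus continuous_on_compose2[OF cont]) (auto intro!: continuous_intros)
  qed (use False s assms(5) in auto)
  then show ?thesis by simp
qed

section \<open>Frames of the plane and calculus on the square\<close>

definition det2 :: "real^2 \<Rightarrow> real^2 \<Rightarrow> real" where
  "det2 a b = a $ 1 * b $ 2 - a $ 2 * b $ 1"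

text \<open>Cramer's rule. The coefficients are explicit quotients, so their smoothness is
  immediate.\<close>

lemma det2_expand:
  assumes "det2 a b \<noteq> 0"
  shows "w = (det2 w b / det2 a b) *\<^sub>R a + (det2 a w / det2 a b) *\<^sub>R b"
proof -
  have "det2 a b *\<^sub>R w = det2 w b *\<^sub>R a + det2 a w *\<^sub>R b"
    by (simp add: vec_eq_iff forall_2 det2_def algebra_simps)
  then have "w = inverse (det2 a b) *\<^sub>R (det2 w b *\<^sub>R a + det2 a w *\<^sub>R b)"
    using assms by (metis scaleR_scaleR left_inverse scaleR_one)
  then show ?thesis by (simp add: scaleR_add_right divide_inverse_commute)
qed

lemma det2_linear: "det2 (a + a') b = det2 a b + det2 a' b" "det2 a (b + b') = det2 a b + det2 a b'"
  "det2 (c *\<^sub>R a) b = c * det2 a b" "det2 a (c *\<^sub>R b) = c * det2 a b" "det2 a a = 0"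
  by (simp_all add: det2_def algebra_simps)

lemma smooth_on_det2[smooth_intros]:
  "open S \<Longrightarrow> smooth_on f S \<Longrightarrow> smooth_on g S \<Longrightarrow> smooth_on (\<lambda>x. det2 (f x) (g x)) S"
  unfolding det2_def by (intro smooth_intros)

lemma has_vector_derivative_0_const_square:
  fixes f :: "real \<Rightarrow> 'a::real_normed_vector"
  assumes "\<And>t. \<bar>t\<bar> < r \<Longrightarrow> (f has_vector_derivative 0) (at t)" "\<bar>s\<bar> < r"
  shows "f s = f 0"
proof -
  have "(f has_derivative (\<lambda>h. 0)) (at t within {-r<..<r})" if "t \<in> {-r<..<r}" for t
    by (rule has_derivative_at_withinI)
      (use assms(1)[of t] that in \<open>simp add: has_vector_derivative_def abs_less_iff\<close>)
  from has_derivative_zero_constant[OF convex_real_interval(8) this]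
  obtain c where "\<forall>t\<in>{-r<..<r}. f t = c" by (rule exE) blast
  then show ?thesis using assms(2) by (simp add: abs_less_iff)
qed

abbreviation du :: "(real \<times> real \<Rightarrow> 'a::real_normed_vector) \<Rightarrow> real \<times> real \<Rightarrow> 'a" where
  "du f z \<equiv> frechet_derivative f (at z) (1, 0)"

abbreviation dv :: "(real \<times> real \<Rightarrow> 'a::real_normed_vector) \<Rightarrow> real \<times> real \<Rightarrow> 'a" where
  "dv f z \<equiv> frechet_derivative f (at z) (0, 1)"

lemma du_eqI:
  assumes "smooth_on f (square r)" "(u, v) \<in> square r" "((\<lambda>u. f (u, v)) has_vector_derivative d) (at u)"
  shows "du f (u, v) = d"
  using has_vector_derivative_partials(1)[OF smooth_on_has_derivative[OF assms(1,2)]] assms(3)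
    vector_derivative_unique_at by blast

lemma dv_eqI:
  assumes "smooth_on f (square r)" "(u, v) \<in> square r" "((\<lambda>v. f (u, v)) has_vector_derivative d) (at v)"
  shows "dv f (u, v) = d"
  using has_vector_derivative_partials(2)[OF smooth_on_has_derivative[OF assms(1,2)]] assms(3)
    vector_derivative_unique_at by blast

lemma frechet_scaleR_compose:
  fixes \<Psi> :: "real \<times> real \<Rightarrow> 'b::euclidean_space"
  assumes "smooth_on a (square r)" "smooth_on \<Psi> (square r)" "smooth_on X V" "\<Psi> ` square r \<subseteq> V" "z \<in> square r"
  shows "frechet_derivative (\<lambda>z. a z *\<^sub>R X (\<Psi> z)) (at z) h
    = frechet_derivative a (at z) h *\<^sub>R X (\<Psi> z)
      + a z *\<^sub>R frechet_derivative X (at (\<Psi> z)) (frechet_derivative \<Psi> (at z) h)"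
proof -
  have "\<Psi> z \<in> V" using assms(4,5) by blast
  from has_derivative_scaleR[OF smooth_on_has_derivative[OF assms(1,5)]
      has_derivative_compose[OF smooth_on_has_derivative[OF assms(2,5)] smooth_on_has_derivative[OF assms(3) this]]]
  have "frechet_derivative (\<lambda>z. a z *\<^sub>R X (\<Psi> z)) (at z) = (\<lambda>h. a z *\<^sub>R frechet_derivative X (at (\<Psi> z)) (frechet_derivative \<Psi> (at z) h)
      + frechet_derivative a (at z) h *\<^sub>R X (\<Psi> z))"
    by (rule frechet_derivative_at[symmetric])
  then show ?thesis by (simp add: add.commute)
qed

lemma smooth_on_scaleR_compose:
  fixes \<Psi> :: "real \<times> real \<Rightarrow> 'b::euclidean_space"
  assumes "smooth_on a (square r)" "smooth_on \<Psi> (square r)" "smooth_on X V" "\<Psi> ` square r \<subseteq> V"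
  shows "smooth_on (\<lambda>z. a z *\<^sub>R X (\<Psi> z)) (square r)"
  by (intro smooth_on_scaleR open_square assms(1) smooth_on_compose[OF open_square assms(2,3,4)])

lemma volterra_component:
  fixes W :: "real \<times> real \<Rightarrow> 'a::euclidean_space" and L :: "'a \<Rightarrow> 'b::euclidean_space"
  assumes W: "smooth_on W (square r)" "W ` square r \<subseteq> \<Omega>" "smooth_on F \<Omega>" "smooth_on G \<Omega>"
    and eq: "\<forall>z\<in>square r. W z = w0 + vint1 (\<lambda>z. F (W z)) z + vint2 (\<lambda>z. G (W z)) z"
    and L: "bounded_linear L" and z: "z \<in> square r"
  shows "L (W z) = L w0 + vint1 (\<lambda>z. L (F (W z))) z + vint2 (\<lambda>z. L (G (W z))) z"
proof -
  have FW: "continuous_on (square r) (\<lambda>z. F (W z))" and GW: "continuous_on (square r) (\<lambda>z. G (W z))"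
    using continuous_on_compose2[OF smooth_on_continuous[OF W(3)] smooth_on_continuous[OF W(1)] W(2)]
      continuous_on_compose2[OF smooth_on_continuous[OF W(4)] smooth_on_continuous[OF W(1)] W(2)] by simp_all
  have "L (W z) = L (w0 + vint1 (\<lambda>z. F (W z)) z + vint2 (\<lambda>z. G (W z)) z)"
    using bspec[OF eq z] by simp
  then show ?thesis
    by (simp add: linear_add[OF bounded_linear.linear[OF L]] vint1_linear[OF L shrinkable_square FW z]
        vint2_linear[OF L shrinkable_square GW z])
qed

lemma vint1_zero [simp]: "vint1 (\<lambda>z. 0) z = 0" and vint2_zero [simp]: "vint2 (\<lambda>z. 0) z = 0"
  by (simp_all add: vint1_def vint2_def)

text \<open>The remainder \<open>c\<close> is constant in the direction of integration. An unknown
  containing both integrals has to be brought into this form before a derivative can be read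
  off.\<close>

lemma dv_of_vint2:
  assumes "smooth_on f (square r)" "continuous_on (square r) \<phi>"
    and eq: "\<And>z. z \<in> square r \<Longrightarrow> f z = c (fst z) + vint2 \<phi> z" and z: "z \<in> square r"
  shows "dv f z = \<phi> z"
proof -
  obtain u v where uv: "z = (u, v)" by (cases z)
  have m: "(u, v) \<in> square r" using z uv by simp
  have "((\<lambda>v. f (u, v)) has_vector_derivative \<phi> (u, v)) (at v)"
  proof (rule has_vector_derivative_transform_within_open[where S="{-r<..<r}"])
    show "((\<lambda>v. c u + vint2 \<phi> (u, v)) has_vector_derivative \<phi> (u, v)) (at v)"
      using has_vector_derivative_add[OF has_vector_derivative_const vint2_has_vector_derivative[OF assms(2) m], of "c u"]
      by simp
    show "c u + vint2 \<phi> (u, y) = f (u, y)" if "y \<in> {-r<..<r}" for y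
      using eq[of "(u, y)"] that m by (simp add: mem_square abs_less_iff)
  qed (use m in \<open>auto simp: mem_square\<close>)
  from dv_eqI[OF assms(1) m this] show ?thesis by (simp add: uv)
qed

lemma du_of_vint1:
  assumes "smooth_on f (square r)" "continuous_on (square r) \<phi>"
    and eq: "\<And>z. z \<in> square r \<Longrightarrow> f z = c (snd z) + vint1 \<phi> z" and z: "z \<in> square r"
  shows "du f z = \<phi> z"
proof -
  obtain u v where uv: "z = (u, v)" by (cases z)
  have m: "(u, v) \<in> square r" using z uv by simp
  have "((\<lambda>u. f (u, v)) has_vector_derivative \<phi> (u, v)) (at u)"
  proof (rule has_vector_derivative_transform_within_open[where S="{-r<..<r}"])
    show "((\<lambda>u. c v + vint1 \<phi> (u, v)) has_vector_derivative \<phi> (u, v)) (at u)"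
      using has_vector_derivative_add[OF has_vector_derivative_const vint1_has_vector_derivative[OF assms(2) m], of "c v"]
      by simp
    show "c v + vint1 \<phi> (y, v) = f (y, v)" if "y \<in> {-r<..<r}" for y
      using eq[of "(y, v)"] that m by (simp add: mem_square abs_less_iff)
  qed (use m in \<open>auto simp: mem_square\<close>)
  from du_eqI[OF assms(1) m this] show ?thesis by (simp add: uv)
qed

lemma frechet_derivative_smooth_diff:
  assumes "smooth_on f S" "smooth_on g S" "z \<in> S"
  shows "frechet_derivative (\<lambda>z. f z - g z) (at z) w = frechet_derivative f (at z) w - frechet_derivative g (at z) w"
proof -
  have "((\<lambda>z. f z - g z) has_derivative
      (\<lambda>w. frechet_derivative f (at z) w - frechet_derivative g (at z) w)) (at z)"
    by (intro has_derivative_diff smooth_on_has_derivative[OF assms(1,3)] smooth_on_has_derivative[OF assms(2,3)])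
  from frechet_derivative_at[OF this, symmetric] show ?thesis by simp
qed

lemma smooth_on_du: "smooth_on f S \<Longrightarrow> smooth_on (du f) S"
  and smooth_on_dv: "smooth_on f S \<Longrightarrow> smooth_on (dv f) S"
  by (rule smooth_on_frechet_const, assumption)+

lemma du_dv_commute:
  fixes f :: "real \<times> real \<Rightarrow> 'a::euclidean_space"
  shows "smooth_on f (square r) \<Longrightarrow> z \<in> square r \<Longrightarrow> du (dv f) z = dv (du f) z"
  by (rule second_derivative_symmetric[OF open_square])

lemma smooth_has_vector_derivative_du:
  "smooth_on f (square r) \<Longrightarrow> (u, v) \<in> square r \<Longrightarrow> ((\<lambda>u. f (u, v)) has_vector_derivative du f (u, v)) (at u)"
  by (rule has_vector_derivative_partials(1)[OF smooth_on_has_derivative])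

lemma smooth_has_vector_derivative_dv:
  "smooth_on f (square r) \<Longrightarrow> (u, v) \<in> square r \<Longrightarrow> ((\<lambda>v. f (u, v)) has_vector_derivative dv f (u, v)) (at v)"
  by (rule has_vector_derivative_partials(2)[OF smooth_on_has_derivative])

text \<open>Spreads an identity from the axis \<open>u = 0\<close> over the square: its defect obeys
  a homogeneous linear equation on each horizontal line.\<close>

lemma zero_of_linear_du:
  fixes f :: "real \<times> real \<Rightarrow> 'a::euclidean_space"
  assumes "smooth_on f (square r)" "\<And>z. z \<in> square r \<Longrightarrow> du f z = A z (f z)"
    "\<And>z. z \<in> square r \<Longrightarrow> linear (A z)" "\<And>w. continuous_on (square r) (\<lambda>z. A z w)"
    "\<And>v. (0, v) \<in> square r \<Longrightarrow> f (0, v) = 0" "z \<in> square r"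
  shows "f z = 0"
proof -
  obtain u v where uv: "z = (u, v)" by (cases z)
  then have uvr: "\<bar>u\<bar> < r" "\<bar>v\<bar> < r" using assms(6) by (auto simp: mem_square)
  have "f (u, v) = 0"
  proof (rule linear_ode_zero[where \<phi>="\<lambda>u. f (u, v)" and A="\<lambda>u. A (u, v)", OF uvr(1)])
    show "((\<lambda>u. f (u, v)) has_vector_derivative A (t, v) (f (t, v))) (at t)" if "\<bar>t\<bar> < r" for t
      using smooth_has_vector_derivative_du[OF assms(1), of t v] assms(2)[of "(t, v)"] that uvr
      by (simp add: mem_square)
    show "linear (A (t, v))" if "\<bar>t\<bar> < r" for t using assms(3) that uvr by (simp add: mem_square)
    show "continuous_on {-r<..<r} (\<lambda>t. A (t, v) w)" for w
      by (rule continuous_on_compose2[OF assms(4)])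
        (use uvr in \<open>auto simp: mem_square intro!: continuous_intros\<close>)
    show "f (0, v) = 0" using assms(5) uvr by (simp add: mem_square)
  qed
  then show ?thesis by (simp add: uv)
qed

lemma zero_of_linear_dv:
  fixes f :: "real \<times> real \<Rightarrow> 'a::euclidean_space"
  assumes "smooth_on f (square r)" "\<And>z. z \<in> square r \<Longrightarrow> dv f z = A z (f z)"
    "\<And>z. z \<in> square r \<Longrightarrow> linear (A z)" "\<And>w. continuous_on (square r) (\<lambda>z. A z w)"
    "\<And>u. (u, 0) \<in> square r \<Longrightarrow> f (u, 0) = 0" "z \<in> square r"
  shows "f z = 0"
proof -
  obtain u v where uv: "z = (u, v)" by (cases z)
  then have uvr: "\<bar>u\<bar> < r" "\<bar>v\<bar> < r" using assms(6) by (auto simp: mem_square)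
  have "f (u, v) = 0"
  proof (rule linear_ode_zero[where \<phi>="\<lambda>v. f (u, v)" and A="\<lambda>v. A (u, v)", OF uvr(2)])
    show "((\<lambda>v. f (u, v)) has_vector_derivative A (u, t) (f (u, t))) (at t)" if "\<bar>t\<bar> < r" for t
      using smooth_has_vector_derivative_dv[OF assms(1), of u t] assms(2)[of "(u, t)"] that uvr
      by (simp add: mem_square)
    show "linear (A (u, t))" if "\<bar>t\<bar> < r" for t using assms(3) that uvr by (simp add: mem_square)
    show "continuous_on {-r<..<r} (\<lambda>t. A (u, t) w)" for w
      by (rule continuous_on_compose2[OF assms(4)])
        (use uvr in \<open>auto simp: mem_square intro!: continuous_intros\<close>)
    show "f (u, 0) = 0" using assms(5) uvr by (simp add: mem_square)
  qed
  then show ?thesis by (simp add: uv)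
qed

lemma smooth_on_det2_coeff:
  assumes "open V" "smooth_on X V" "smooth_on Y V" "smooth_on w V" "\<And>x. x \<in> V \<Longrightarrow> det2 (X x) (Y x) \<noteq> 0"
  shows "smooth_on (\<lambda>x. det2 (w x) (Y x) / det2 (X x) (Y x)) V"
    "smooth_on (\<lambda>x. det2 (X x) (w x) / det2 (X x) (Y x)) V"
  by (intro smooth_on_divide smooth_on_det2 assms(1-4), erule assms(5))+

section \<open>Characteristic coordinates together with the primitive\<close>

text \<open>A single Volterra system produces characteristic coordinates \<open>\<Psi>\<close> with
  \<open>\<Psi>\<^sub>u = \<alpha> X\<close>, \<open>\<Psi>\<^sub>v = \<beta> Y\<close> together with \<open>h\<close> and its derivatives \<open>h\<^sub>u = P g\<close>, \<open>h\<^sub>v = Q e\<close>. The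
  equations for the \<open>v\<close>-derivatives are imposed only along \<open>u = 0\<close>, through the integral curve \<open>\<Psi>\<^sub>0\<close>
  of \<open>Y\<close>; elsewhere they hold because \<open>\<Psi>\<^sub>v - \<beta> Y\<close> and \<open>h\<^sub>v - Q e\<close> satisfy homogeneous linear
  equations in \<open>u\<close>. The evolution of \<open>\<alpha>, \<beta>\<close> and of \<open>P, Q\<close> is forced by equality of mixed derivatives.\<close>

lemma characteristic_solution:
  fixes X Y :: "real^2 \<Rightarrow> real^2" and g e :: "real^2 \<Rightarrow> 'm::euclidean_space" and m :: "real^2 \<Rightarrow> real"
  assumes V: "open V" "x0 \<in> V"
    and sm: "smooth_on X V" "smooth_on Y V" "smooth_on g V" "smooth_on e V" "smooth_on m V"
    and indep: "\<And>x. x \<in> V \<Longrightarrow> det2 (X x) (Y x) \<noteq> 0"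
    and gY: "\<And>x. x \<in> V \<Longrightarrow> frechet_derivative g (at x) (Y x) = e x"
    and eX: "\<And>x. x \<in> V \<Longrightarrow> frechet_derivative e (at x) (X x) = - m x *\<^sub>R g x"
  obtains r \<Psi> h \<alpha> \<beta> P Q where "r > 0"
    "smooth_on \<Psi> (square r)" "smooth_on h (square r)" "smooth_on \<alpha> (square r)"
    "smooth_on \<beta> (square r)" "smooth_on P (square r)" "smooth_on Q (square r)"
    "\<Psi> ` square r \<subseteq> V" "\<Psi> (0, 0) = x0"
    "\<alpha> (0, 0) = (1::real)" "\<beta> (0, 0) = (1::real)" "P (0, 0) = (1::real)" "Q (0, 0) = (1::real)"
    "\<forall>z\<in>square r. du \<Psi> z = \<alpha> z *\<^sub>R X (\<Psi> z)"
    "\<forall>z\<in>square r. dv \<Psi> z = \<beta> z *\<^sub>R Y (\<Psi> z)"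
    "\<forall>z\<in>square r. du h z = P z *\<^sub>R g (\<Psi> z)"
    "\<forall>z\<in>square r. dv h z = Q z *\<^sub>R e (\<Psi> z)"
proof -
  \<comment> \<open>The bracket of \<open>X\<close> and \<open>Y\<close>; \<open>c1\<close> and
    \<open>c2\<close> are its coefficients in the frame.\<close>
  define br where "br = (\<lambda>x. frechet_derivative Y (at x) (X x) - frechet_derivative X (at x) (Y x))"
  define c1 where "c1 = (\<lambda>x. det2 (br x) (Y x) / det2 (X x) (Y x))"
  define c2 where "c2 = (\<lambda>x. det2 (X x) (br x) / det2 (X x) (Y x))"
  have "smooth_on br V"
    unfolding br_def by (intro smooth_on_diff smooth_on_frechet V sm)
  then have c12: "smooth_on c1 V" "smooth_on c2 V"
    unfolding c1_def c2_def using smooth_on_det2_coeff[OF V(1) sm(1,2) _ indep] by blast+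
  have br: "br x = c1 x *\<^sub>R X x + c2 x *\<^sub>R Y x" if "x \<in> V" for x
    unfolding c1_def c2_def by (rule det2_expand[OF indep[OF that]])
  \<comment> \<open>Slots of the unknown, in order: \<open>\<Psi>0\<close>, \<open>\<Psi>\<close>,
    \<open>h\<close>, \<open>\<alpha>\<close>, \<open>\<beta>\<close>, \<open>P\<close>,
    \<open>Q\<close>.\<close>
  define p1 :: "(real^2) \<times> (real^2) \<times> 'm \<times> real \<times> real \<times> real \<times> real \<Rightarrow> real^2" where "p1 = fst"
  define p2 :: "(real^2) \<times> (real^2) \<times> 'm \<times> real \<times> real \<times> real \<times> real \<Rightarrow> real^2" where "p2 = (\<lambda>w. fst (snd w))"
  define p3 :: "(real^2) \<times> (real^2) \<times> 'm \<times> real \<times> real \<times> real \<times> real \<Rightarrow> 'm" where "p3 = (\<lambda>w. fst (snd (snd w)))"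
  define p4 :: "(real^2) \<times> (real^2) \<times> 'm \<times> real \<times> real \<times> real \<times> real \<Rightarrow> real" where "p4 = (\<lambda>w. fst (snd (snd (snd w))))"
  define p5 :: "(real^2) \<times> (real^2) \<times> 'm \<times> real \<times> real \<times> real \<times> real \<Rightarrow> real" where "p5 = (\<lambda>w. fst (snd (snd (snd (snd w)))))"
  define p6 :: "(real^2) \<times> (real^2) \<times> 'm \<times> real \<times> real \<times> real \<times> real \<Rightarrow> real" where "p6 = (\<lambda>w. fst (snd (snd (snd (snd (snd w))))))"
  define p7 :: "(real^2) \<times> (real^2) \<times> 'm \<times> real \<times> real \<times> real \<times> real \<Rightarrow> real" where "p7 = (\<lambda>w. snd (snd (snd (snd (snd (snd w))))))"
  note p_defs = p1_def p2_def p3_def p4_def p5_def p6_def p7_def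
  have pl: "bounded_linear p1" "bounded_linear p2" "bounded_linear p3" "bounded_linear p4"
    "bounded_linear p5" "bounded_linear p6" "bounded_linear p7"
    unfolding p_defs
    by (intro bounded_linear_fst bounded_linear_fst_comp bounded_linear_snd_comp bounded_linear_ident)+
  define \<Omega> where "\<Omega> = V \<times> V \<times> (UNIV :: ('m \<times> real \<times> real \<times> real \<times> real) set)"
  have \<Omega>: "open \<Omega>" unfolding \<Omega>_def by (intro open_Times V open_UNIV)
  have inV: "p1 w \<in> V" "p2 w \<in> V" if "w \<in> \<Omega>" for w
    using that by (auto simp: \<Omega>_def p1_def p2_def)
  have ps: "smooth_on p1 \<Omega>" "smooth_on p2 \<Omega>" "smooth_on p4 \<Omega>" "smooth_on p5 \<Omega>" "smooth_on p6 \<Omega>" "smooth_on p7 \<Omega>"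
    using pl by (auto intro!: smooth_on_linear_image \<Omega> simp: linear_conv_bounded_linear)
  have s1: "smooth_on (\<lambda>w. f (p1 w)) \<Omega>" and s2: "smooth_on (\<lambda>w. f (p2 w)) \<Omega>"
    if "smooth_on f V" for f :: "real^2 \<Rightarrow> 'b::euclidean_space"
    by (rule smooth_on_compose[OF \<Omega> ps(1) that], use inV in blast)
      (rule smooth_on_compose[OF \<Omega> ps(2) that], use inV in blast)
  \<comment> \<open>Comparing the mixed derivatives of \<open>\<Psi>\<close> gives
    \<open>\<alpha>_v = \<alpha> \<beta> c1\<close> and
    \<open>\<beta>_u = - \<alpha> \<beta> c2\<close>; comparing those of \<open>h\<close> gives
    \<open>P_v = - Q \<alpha> m\<close> and \<open>Q_u = P \<beta>\<close>. An entry 0 marks an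
    unknown without an integral in that direction.\<close>
  define F where "F = (\<lambda>w. (0 :: real^2, p4 w *\<^sub>R X (p2 w), p6 w *\<^sub>R g (p2 w), 0 :: real,
    - (p4 w * p5 w * c2 (p2 w)), 0 :: real, p6 w * p5 w))"
  define G where "G = (\<lambda>w. (Y (p1 w), Y (p1 w), e (p1 w), p4 w * p5 w * c1 (p2 w), 0 :: real,
    - (p7 w * p4 w * m (p2 w)), 0 :: real))"
  have smFG: "smooth_on F \<Omega>" "smooth_on G \<Omega>"
    unfolding F_def G_def by (intro smooth_intros \<Omega> ps s1 s2 sm c12)+
  \<comment> \<open>The four entries 1 become the values of \<open>\<alpha>\<close> and
    \<open>P\<close> on \<open>v = 0\<close> and those of \<open>\<beta>\<close> and
    \<open>Q\<close> on \<open>u = 0\<close>.\<close>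
  define w0 :: "(real^2) \<times> (real^2) \<times> 'm \<times> real \<times> real \<times> real \<times> real" where "w0 = (x0, x0, 0, 1, 1, 1, 1)"
  have "w0 \<in> \<Omega>" by (simp add: w0_def \<Omega>_def V)
  then obtain r W where r: "r > 0" and W: "smooth_on W (square r)" "W ` square r \<subseteq> \<Omega>"
    "\<forall>z\<in>square r. W z = w0 + vint1 (\<lambda>z. F (W z)) z + vint2 (\<lambda>z. G (W z)) z"
    using volterra_smooth_solution[OF \<Omega> _ smFG] by metis
  define \<Psi>0 where "\<Psi>0 = (\<lambda>z. p1 (W z))"
  define \<Psi> where "\<Psi> = (\<lambda>z. p2 (W z))"
  define h where "h = (\<lambda>z. p3 (W z))"
  define \<alpha> where "\<alpha> = (\<lambda>z. p4 (W z))"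
  define \<beta> where "\<beta> = (\<lambda>z. p5 (W z))"
  define P where "P = (\<lambda>z. p6 (W z))"
  define Q where "Q = (\<lambda>z. p7 (W z))"
  note defs = \<Psi>0_def \<Psi>_def h_def \<alpha>_def \<beta>_def P_def Q_def
  have sms: "smooth_on \<Psi>0 (square r)" "smooth_on \<Psi> (square r)" "smooth_on h (square r)" "smooth_on \<alpha> (square r)"
    "smooth_on \<beta> (square r)" "smooth_on P (square r)" "smooth_on Q (square r)"
    unfolding defs by (rule smooth_on_bounded_linear[OF _ open_square W(1)], rule pl)+
  have WV: "\<Psi>0 ` square r \<subseteq> V" "\<Psi> ` square r \<subseteq> V"
    unfolding \<Psi>0_def \<Psi>_def using W(2) inV by blast+
  note comp = volterra_component[OF W(1,2) smFG W(3)]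
  have pF: "p1 (F w) = 0" "p2 (F w) = p4 w *\<^sub>R X (p2 w)" "p3 (F w) = p6 w *\<^sub>R g (p2 w)" "p4 (F w) = 0"
    "p5 (F w) = - (p4 w * p5 w * c2 (p2 w))" "p6 (F w) = 0" "p7 (F w) = p6 w * p5 w" for w
    by (simp_all add: F_def p_defs)
  have pG: "p1 (G w) = Y (p1 w)" "p2 (G w) = Y (p1 w)" "p3 (G w) = e (p1 w)" "p4 (G w) = p4 w * p5 w * c1 (p2 w)"
    "p5 (G w) = 0" "p6 (G w) = - (p7 w * p4 w * m (p2 w))" "p7 (G w) = 0" for w
    by (simp_all add: G_def p_defs)
  have pw: "p1 w0 = x0" "p2 w0 = x0" "p3 w0 = 0" "p4 w0 = 1" "p5 w0 = 1" "p6 w0 = 1" "p7 w0 = 1"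
    by (simp_all add: w0_def p_defs)
  have eqs: "\<Psi>0 z = x0 + vint2 (\<lambda>z. Y (\<Psi>0 z)) z"
    "\<Psi> z = x0 + vint1 (\<lambda>z. \<alpha> z *\<^sub>R X (\<Psi> z)) z + vint2 (\<lambda>z. Y (\<Psi>0 z)) z"
    "h z = vint1 (\<lambda>z. P z *\<^sub>R g (\<Psi> z)) z + vint2 (\<lambda>z. e (\<Psi>0 z)) z"
    "\<alpha> z = 1 + vint2 (\<lambda>z. \<alpha> z * \<beta> z * c1 (\<Psi> z)) z"
    "\<beta> z = 1 + vint1 (\<lambda>z. - (\<alpha> z * \<beta> z * c2 (\<Psi> z))) z"
    "P z = 1 + vint2 (\<lambda>z. - (Q z * \<alpha> z * m (\<Psi> z))) z"
    "Q z = 1 + vint1 (\<lambda>z. P z * \<beta> z) z" if "z \<in> square r" for z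
    using comp[OF pl(1) that] comp[OF pl(2) that] comp[OF pl(3) that] comp[OF pl(4) that] comp[OF pl(5) that]
      comp[OF pl(6) that] comp[OF pl(7) that]
    unfolding pF pG pw vint1_zero vint2_zero defs by simp_all
  have comp\<Psi>: "smooth_on (\<lambda>z. f (\<Psi> z)) (square r)" and comp\<Psi>0: "smooth_on (\<lambda>z. f (\<Psi>0 z)) (square r)"
    if "smooth_on f V" for f :: "real^2 \<Rightarrow> 'b::euclidean_space"
    by (rule smooth_on_compose[OF open_square sms(2) that WV(2)])
      (rule smooth_on_compose[OF open_square sms(1) that WV(1)])
  note cont = smooth_on_continuous
  have dv\<Psi>0: "dv \<Psi>0 z = Y (\<Psi>0 z)" if "z \<in> square r" for z
    by (rule dv_of_vint2[where c="\<lambda>_. x0", OF sms(1) cont[OF comp\<Psi>0[OF sm(2)]] eqs(1) that])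
  have dv\<alpha>: "dv \<alpha> z = \<alpha> z * \<beta> z * c1 (\<Psi> z)" if "z \<in> square r" for z
    by (rule dv_of_vint2[where c="\<lambda>_. 1", OF sms(4) _ eqs(4) that])
      (intro cont smooth_on_mult open_square sms comp\<Psi> c12)
  have dvP: "dv P z = - (Q z * \<alpha> z * m (\<Psi> z))" if "z \<in> square r" for z
    by (rule dv_of_vint2[where c="\<lambda>_. 1", OF sms(6) _ eqs(6) that])
      (intro cont smooth_on_minus smooth_on_mult open_square sms comp\<Psi> sm)
  have du\<beta>: "du \<beta> z = - (\<alpha> z * \<beta> z * c2 (\<Psi> z))" if "z \<in> square r" for z
    by (rule du_of_vint1[where c="\<lambda>_. 1", OF sms(5) _ eqs(5) that])
      (intro cont smooth_on_minus smooth_on_mult open_square sms comp\<Psi> c12)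
  have duQ: "du Q z = P z * \<beta> z" if "z \<in> square r" for z
    by (rule du_of_vint1[where c="\<lambda>_. 1", OF sms(7) _ eqs(7) that])
      (intro cont smooth_on_mult open_square sms)
  \<comment> \<open>\<open>\<Psi>0\<close> solves the same initial value problem on every vertical
    line; its \<open>u\<close>-derivative satisfies the linearized equation and vanishes on
    \<open>v = 0\<close>.\<close>
  have du\<Psi>0: "du \<Psi>0 z = 0" if "z \<in> square r" for z
  proof (rule zero_of_linear_dv[where A="\<lambda>z. frechet_derivative Y (at (\<Psi>0 z))", OF smooth_on_du[OF sms(1)] _ _ _ _ that])
    show "dv (du \<Psi>0) z = frechet_derivative Y (at (\<Psi>0 z)) (du \<Psi>0 z)" if "z \<in> square r" for z
    proof -
      have "dv (du \<Psi>0) z = du (dv \<Psi>0) z" by (rule du_dv_commute[OF sms(1) that, symmetric])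
      also have "\<dots> = du (\<lambda>z. Y (\<Psi>0 z)) z"
        using frechet_derivative_cong[OF open_square that dv\<Psi>0] by simp
      also have "\<dots> = frechet_derivative Y (at (\<Psi>0 z)) (du \<Psi>0 z)"
        by (rule smooth_on_frechet_chain[OF sms(1) sm(2) that]) (use WV that in blast)
      finally show ?thesis .
    qed
    show "linear (frechet_derivative Y (at (\<Psi>0 z)))" if "z \<in> square r" for z
      by (rule smooth_on_linear_derivative[OF sm(2)]) (use WV that in blast)
    show "continuous_on (square r) (\<lambda>z. frechet_derivative Y (at (\<Psi>0 z)) w)" for w
      by (rule cont[OF comp\<Psi>0[OF smooth_on_frechet_const[OF sm(2)]]])
    show "du \<Psi>0 (u, 0) = 0" if "(u, 0) \<in> square r" for u
    proof (rule du_eqI[OF sms(1) that])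
      have "((\<lambda>u. x0) has_vector_derivative 0) (at u)" by simp
      then show "((\<lambda>u. \<Psi>0 (u, 0)) has_vector_derivative 0) (at u)"
        by (rule has_vector_derivative_transform_within_open[where S="{-r<..<r}"])
          (use that eqs(1) in \<open>auto simp: mem_square abs_less_iff\<close>)
    qed
  qed
  have \<Psi>0u: "\<Psi>0 (u, v) = \<Psi>0 (0, v)" if "(u, v) \<in> square r" for u v
  proof -
    have *: "\<bar>u\<bar> < r" "\<bar>v\<bar> < r" using that by (auto simp: mem_square)
    show ?thesis
    proof (rule has_vector_derivative_0_const_square[where f="\<lambda>u. \<Psi>0 (u, v)", OF _ *(1)])
      show "((\<lambda>u. \<Psi>0 (u, v)) has_vector_derivative 0) (at t)" if "\<bar>t\<bar> < r" for t
        using smooth_has_vector_derivative_du[OF sms(1), of t v] du\<Psi>0[of "(t, v)"] that * by (simp add: mem_square)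
    qed
  qed
  \<comment> \<open>Hence the \<open>v\<close>-integrals in the equations for \<open>\<Psi>\<close>
    and \<open>h\<close> depend on \<open>v\<close> alone, and the \<open>u\<close>-derivatives of
    both can be read off.\<close>
  have axis: "vint2 (\<lambda>z. f (\<Psi>0 z)) z = vint2 (\<lambda>z. f (\<Psi>0 z)) (0, snd z)" if "z \<in> square r"
    for z and f :: "real^2 \<Rightarrow> 'b::euclidean_space"
  proof -
    obtain u v where z: "z = (u, v)" by (cases z)
    have "integral {0..1} (\<lambda>t. f (\<Psi>0 (u, t * v))) = integral {0..1} (\<lambda>t. f (\<Psi>0 (0, t * v)))"
      by (rule integral_cong) (use \<Psi>0u shrinkable2[OF shrinkable_square] that z in metis)
    then show ?thesis by (simp add: z vint2_def)
  qed
  have du\<Psi>: "du \<Psi> z = \<alpha> z *\<^sub>R X (\<Psi> z)" if "z \<in> square r" for z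
  proof (rule du_of_vint1[where c="\<lambda>v. x0 + vint2 (\<lambda>z. Y (\<Psi>0 z)) (0, v)", OF sms(2) _ _ that])
    show "continuous_on (square r) (\<lambda>z. \<alpha> z *\<^sub>R X (\<Psi> z))"
      by (rule cont[OF smooth_on_scaleR_compose[OF sms(4,2) sm(1) WV(2)]])
    show "\<Psi> z = x0 + vint2 (\<lambda>z. Y (\<Psi>0 z)) (0, snd z) + vint1 (\<lambda>z. \<alpha> z *\<^sub>R X (\<Psi> z)) z"
      if z: "z \<in> square r" for z
      by (rule trans[OF eqs(2)[OF z]]) (simp only: axis[OF z, of Y] ac_simps)
  qed
  have duh: "du h z = P z *\<^sub>R g (\<Psi> z)" if "z \<in> square r" for z
  proof (rule du_of_vint1[where c="\<lambda>v. vint2 (\<lambda>z. e (\<Psi>0 z)) (0, v)", OF sms(3) _ _ that])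
    show "continuous_on (square r) (\<lambda>z. P z *\<^sub>R g (\<Psi> z))"
      by (rule cont[OF smooth_on_scaleR_compose[OF sms(6,2) sm(3) WV(2)]])
    show "h z = vint2 (\<lambda>z. e (\<Psi>0 z)) (0, snd z) + vint1 (\<lambda>z. P z *\<^sub>R g (\<Psi> z)) z"
      if z: "z \<in> square r" for z
      by (rule trans[OF eqs(3)[OF z]]) (simp only: axis[OF z, of e] ac_simps)
  qed
  have dv\<Psi>: "dv \<Psi> z = \<beta> z *\<^sub>R Y (\<Psi> z)" if "z \<in> square r" for z
  proof -
    define R where "R = (\<lambda>z. dv \<Psi> z - \<beta> z *\<^sub>R Y (\<Psi> z))"
    have sm\<beta>Y: "smooth_on (\<lambda>z. \<beta> z *\<^sub>R Y (\<Psi> z)) (square r)"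
      by (rule smooth_on_scaleR_compose[OF sms(5,2) sm(2) WV(2)])
    have "R z = 0"
    proof (rule zero_of_linear_du[where A="\<lambda>z w. \<alpha> z *\<^sub>R frechet_derivative X (at (\<Psi> z)) w", OF _ _ _ _ _ that])
      show "smooth_on R (square r)"
        unfolding R_def by (intro smooth_on_diff open_square smooth_on_dv sms sm\<beta>Y)
      show "linear (\<lambda>w. \<alpha> z *\<^sub>R frechet_derivative X (at (\<Psi> z)) w)" if "z \<in> square r" for z
        by (rule linear_compose_scale_right[OF smooth_on_linear_derivative[OF sm(1)]]) (use WV that in blast)
      show "continuous_on (square r) (\<lambda>z. \<alpha> z *\<^sub>R frechet_derivative X (at (\<Psi> z)) w)" for w
        by (rule cont[OF smooth_on_scaleR_compose[OF sms(4,2) smooth_on_frechet_const[OF sm(1)] WV(2)]])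
      \<comment> \<open>The terms with \<open>\<alpha>_v\<close> and \<open>\<beta>_u\<close>
        assemble into \<open>\<alpha> \<beta>\<close> times the bracket. This trades the derivative
        of \<open>Y\<close> along \<open>X\<close> for that of \<open>X\<close> along
        \<open>Y\<close>, which leaves a linear equation for \<open>R\<close>.\<close>
      show "du R z = \<alpha> z *\<^sub>R frechet_derivative X (at (\<Psi> z)) (R z)" if z: "z \<in> square r" for z
      proof -
        have \<Psi>z: "\<Psi> z \<in> V" using WV z by blast
        define DX where "DX = frechet_derivative X (at (\<Psi> z))"
        define DY where "DY = frechet_derivative Y (at (\<Psi> z))"
        have lin: "linear DX" "linear DY"
          unfolding DX_def DY_def using smooth_on_linear_derivative sm(1,2) \<Psi>z by blast+
        have "du R z = du (dv \<Psi>) z - du (\<lambda>z. \<beta> z *\<^sub>R Y (\<Psi> z)) z"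
          unfolding R_def by (rule frechet_derivative_smooth_diff[OF smooth_on_dv[OF sms(2)] sm\<beta>Y z])
        also have "du (dv \<Psi>) z = dv (\<lambda>z. \<alpha> z *\<^sub>R X (\<Psi> z)) z"
          using du_dv_commute[OF sms(2) z] frechet_derivative_cong[OF open_square z du\<Psi>] by simp
        also have "\<dots> = dv \<alpha> z *\<^sub>R X (\<Psi> z) + \<alpha> z *\<^sub>R DX (dv \<Psi> z)"
          unfolding DX_def by (rule frechet_scaleR_compose[OF sms(4,2) sm(1) WV(2) z])
        also have "du (\<lambda>z. \<beta> z *\<^sub>R Y (\<Psi> z)) z = du \<beta> z *\<^sub>R Y (\<Psi> z) + \<beta> z *\<^sub>R DY (du \<Psi> z)"
          unfolding DY_def by (rule frechet_scaleR_compose[OF sms(5,2) sm(2) WV(2) z])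
        finally have "du R z = (\<alpha> z * \<beta> z) *\<^sub>R (c1 (\<Psi> z) *\<^sub>R X (\<Psi> z) + c2 (\<Psi> z) *\<^sub>R Y (\<Psi> z))
            + \<alpha> z *\<^sub>R DX (dv \<Psi> z) - (\<alpha> z * \<beta> z) *\<^sub>R DY (X (\<Psi> z))"
          unfolding dv\<alpha>[OF z] du\<beta>[OF z] du\<Psi>[OF z] linear_scale[OF lin(2)]
          by (simp add: scaleR_add_right mult.assoc mult.left_commute mult.commute)
        also have "\<dots> = \<alpha> z *\<^sub>R DX (dv \<Psi> z) - (\<alpha> z * \<beta> z) *\<^sub>R DX (Y (\<Psi> z))"
          unfolding br[OF \<Psi>z, symmetric] br_def DX_def[symmetric] DY_def[symmetric]
          by (simp add: scaleR_diff_right)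
        also have "\<dots> = \<alpha> z *\<^sub>R DX (R z)"
          unfolding R_def by (simp add: linear_diff[OF lin(1)] linear_scale[OF lin(1)] scaleR_diff_right)
        finally show ?thesis by (simp add: DX_def)
      qed
      show "R (0, v) = 0" if z: "(0, v) \<in> square r" for v
      proof -
        have "dv \<Psi> (0, v) = Y (\<Psi>0 (0, v))"
        proof (rule dv_eqI[OF sms(2) z])
          have "((\<lambda>v. \<Psi>0 (0, v)) has_vector_derivative Y (\<Psi>0 (0, v))) (at v)"
            using smooth_has_vector_derivative_dv[OF sms(1) z] dv\<Psi>0[OF z] by simp
          then show "((\<lambda>v. \<Psi> (0, v)) has_vector_derivative Y (\<Psi>0 (0, v))) (at v)"
          proof (rule has_vector_derivative_transform_within_open[where S="{-r<..<r}"])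
            show "\<Psi>0 (0, y) = \<Psi> (0, y)" if "y \<in> {-r<..<r}" for y
            proof -
              have m: "(0, y) \<in> square r" using that r by (simp add: mem_square abs_less_iff)
              show ?thesis using eqs(1,2)[OF m] by simp
            qed
          qed (use z in \<open>auto simp: mem_square\<close>)
        qed
        moreover have "\<beta> (0, v) = 1" "\<Psi> (0, v) = \<Psi>0 (0, v)"
          using eqs(1,2,5)[OF z] by simp_all
        ultimately show ?thesis by (simp add: R_def)
      qed
    qed
    then show ?thesis by (simp add: R_def)
  qed
  have dvh: "dv h z = Q z *\<^sub>R e (\<Psi> z)" if "z \<in> square r" for z
  proof -
    define R where "R = (\<lambda>z. dv h z - Q z *\<^sub>R e (\<Psi> z))"
    have smQe: "smooth_on (\<lambda>z. Q z *\<^sub>R e (\<Psi> z)) (square r)"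
      by (rule smooth_on_scaleR_compose[OF sms(7,2) sm(4) WV(2)])
    have "R z = 0"
    proof (rule zero_of_linear_du[where A="\<lambda>z w. 0", OF _ _ _ _ _ that])
      show "smooth_on R (square r)"
        unfolding R_def by (intro smooth_on_diff open_square smooth_on_dv sms smQe)
      show "linear (\<lambda>w :: 'm. 0 :: 'm)" by (rule linear_zero)
      \<comment> \<open>All terms cancel by the choice of \<open>P_v\<close> and \<open>Q_u\<close>,
        so the defect is constant in \<open>u\<close>.\<close>
      show "du R z = 0" if z: "z \<in> square r" for z
      proof -
        have \<Psi>z: "\<Psi> z \<in> V" using WV z by blast
        note lin = smooth_on_linear_derivative[OF sm(3) \<Psi>z] smooth_on_linear_derivative[OF sm(4) \<Psi>z]
        have "du R z = du (dv h) z - du (\<lambda>z. Q z *\<^sub>R e (\<Psi> z)) z"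
          unfolding R_def by (rule frechet_derivative_smooth_diff[OF smooth_on_dv[OF sms(3)] smQe z])
        also have "du (dv h) z = dv (\<lambda>z. P z *\<^sub>R g (\<Psi> z)) z"
          using du_dv_commute[OF sms(3) z] frechet_derivative_cong[OF open_square z duh] by simp
        also have "\<dots> = dv P z *\<^sub>R g (\<Psi> z) + P z *\<^sub>R frechet_derivative g (at (\<Psi> z)) (dv \<Psi> z)"
          by (rule frechet_scaleR_compose[OF sms(6,2) sm(3) WV(2) z])
        also have "du (\<lambda>z. Q z *\<^sub>R e (\<Psi> z)) z
            = du Q z *\<^sub>R e (\<Psi> z) + Q z *\<^sub>R frechet_derivative e (at (\<Psi> z)) (du \<Psi> z)"
          by (rule frechet_scaleR_compose[OF sms(7,2) sm(4) WV(2) z])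
        finally show ?thesis
          unfolding dvP[OF z] duQ[OF z] du\<Psi>[OF z] dv\<Psi>[OF z] linear_scale[OF lin(1)] linear_scale[OF lin(2)]
            gY[OF \<Psi>z] eX[OF \<Psi>z]
          by (simp add: mult.assoc mult.left_commute mult.commute)
      qed
      show "R (0, v) = 0" if z: "(0, v) \<in> square r" for v
      proof -
        have "dv h (0, v) = e (\<Psi>0 (0, v))"
        proof (rule dv_eqI[OF sms(3) z])
          have "((\<lambda>v. vint2 (\<lambda>z. e (\<Psi>0 z)) (0, v)) has_vector_derivative e (\<Psi>0 (0, v))) (at v)"
            by (rule vint2_has_vector_derivative[OF cont[OF comp\<Psi>0[OF sm(4)]] z])
          then show "((\<lambda>v. h (0, v)) has_vector_derivative e (\<Psi>0 (0, v))) (at v)"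
          proof (rule has_vector_derivative_transform_within_open[where S="{-r<..<r}"])
            show "vint2 (\<lambda>z. e (\<Psi>0 z)) (0, y) = h (0, y)" if "y \<in> {-r<..<r}" for y
            proof -
              have m: "(0, y) \<in> square r" using that r by (simp add: mem_square abs_less_iff)
              show ?thesis using eqs(3)[OF m] by simp
            qed
          qed (use z in \<open>auto simp: mem_square\<close>)
        qed
        moreover have "Q (0, v) = 1" "\<Psi> (0, v) = \<Psi>0 (0, v)"
          using eqs(1,2,7)[OF z] by simp_all
        ultimately show ?thesis by (simp add: R_def)
      qed
    qed simp
    then show ?thesis by (simp add: R_def)
  qed
  have 00: "(0, 0) \<in> square r" using r by (simp add: mem_square)
  have at0: "\<Psi> (0, 0) = x0" "\<alpha> (0, 0) = 1" "\<beta> (0, 0) = 1" "P (0, 0) = 1" "Q (0, 0) = 1"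
    using eqs(2,4-7)[OF 00] by simp_all
  show ?thesis
    by (rule that[of r \<Psi> h \<alpha> \<beta> P Q])
      (fact r sms WV at0 | (rule ballI, rule du\<Psi> dv\<Psi> duh dvh, assumption))+
qed

lemma frechet_derivative_du_dv:
  assumes "smooth_on f (square r)" "z \<in> square r"
  shows "frechet_derivative f (at z) k = fst k *\<^sub>R du f z + snd k *\<^sub>R dv f z"
proof -
  have lin: "linear (frechet_derivative f (at z))" by (rule smooth_on_linear_derivative[OF assms])
  have "k = fst k *\<^sub>R (1, 0) + snd k *\<^sub>R (0, 1)" by (cases k) simp
  then have "frechet_derivative f (at z) k = frechet_derivative f (at z) (fst k *\<^sub>R (1, 0) + snd k *\<^sub>R (0, 1))"
    by (rule arg_cong)
  then show ?thesis by (simp only: linear_add[OF lin] linear_scale[OF lin])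
qed

text \<open>The coordinates are inverted near the base point and \<open>h\<close> is carried over to
  the plane. Dividing \<open>h_u = P g\<close> by the speed in \<open>\<Psi>_u = \<alpha> X\<close>
  gives \<open>p = P / \<alpha>\<close>, and likewise \<open>q = Q / \<beta>\<close>.\<close>

lemma local_primitive:
  fixes X Y :: "real^2 \<Rightarrow> real^2" and g e :: "real^2 \<Rightarrow> 'm::euclidean_space" and m :: "real^2 \<Rightarrow> real"
  assumes V: "open V" "x0 \<in> V"
    and sm: "smooth_on X V" "smooth_on Y V" "smooth_on g V" "smooth_on e V" "smooth_on m V"
    and indep: "\<And>x. x \<in> V \<Longrightarrow> det2 (X x) (Y x) \<noteq> 0"
    and gY: "\<And>x. x \<in> V \<Longrightarrow> frechet_derivative g (at x) (Y x) = e x"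
    and eX: "\<And>x. x \<in> V \<Longrightarrow> frechet_derivative e (at x) (X x) = - m x *\<^sub>R g x"
  obtains V' H p q where "open V'" "x0 \<in> V'" "V' \<subseteq> V" "smooth_on H V'" "smooth_on p V'" "smooth_on q V'"
    "\<And>x. x \<in> V' \<Longrightarrow> p x \<noteq> (0::real) \<and> q x \<noteq> (0::real)"
    "\<And>x. x \<in> V' \<Longrightarrow> frechet_derivative H (at x) (X x) = p x *\<^sub>R g x"
    "\<And>x. x \<in> V' \<Longrightarrow> frechet_derivative H (at x) (Y x) = q x *\<^sub>R e x"
proof -
  obtain r \<Psi> h \<alpha> \<beta> P Q where r: "r > 0"
    and \<Psi>: "smooth_on \<Psi> (square r)" and h: "smooth_on h (square r)" and \<alpha>: "smooth_on \<alpha> (square r)"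
    and \<beta>: "smooth_on \<beta> (square r)" and P: "smooth_on P (square r)" and Q: "smooth_on Q (square r)"
    and \<Psi>V: "\<Psi> ` square r \<subseteq> V"
    and at0: "\<Psi> (0, 0) = x0" "\<alpha> (0, 0) = (1::real)" "\<beta> (0, 0) = (1::real)" "P (0, 0) = (1::real)" "Q (0, 0) = (1::real)"
    and du\<Psi>: "\<forall>z\<in>square r. du \<Psi> z = \<alpha> z *\<^sub>R X (\<Psi> z)"
    and dv\<Psi>: "\<forall>z\<in>square r. dv \<Psi> z = \<beta> z *\<^sub>R Y (\<Psi> z)"
    and duh: "\<forall>z\<in>square r. du h z = P z *\<^sub>R g (\<Psi> z)"
    and dvh: "\<forall>z\<in>square r. dv h z = Q z *\<^sub>R e (\<Psi> z)"
    by (rule characteristic_solution[OF assms]) (assumption | rule that)+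
  note du\<Psi> = bspec[OF du\<Psi>] and dv\<Psi> = bspec[OF dv\<Psi>] and duh = bspec[OF duh] and dvh = bspec[OF dvh]
  note cont = smooth_on_continuous
  define a :: "real \<times> real" where "a = (0, 0)"
  have asq: "a \<in> square r" using r by (simp add: a_def mem_square)
  \<comment> \<open>Where no speed and no coefficient vanishes: a neighbourhood of the origin, since
    all four are 1 there.\<close>
  define S0 where "S0 = square r \<inter> (\<lambda>z. \<alpha> z * \<beta> z * P z * Q z) -` (- {0})"
  have "open S0"
    unfolding S0_def
    by (rule continuous_open_preimage[OF _ open_square open_Compl[OF closed_singleton]])
      (intro continuous_intros cont \<alpha> \<beta> P Q)
  have aS0: "a \<in> S0" using asq at0 by (simp add: S0_def a_def)
  have S0: "z \<in> square r" "\<alpha> z \<noteq> 0" "\<beta> z \<noteq> 0" "P z \<noteq> 0" "Q z \<noteq> 0" if "z \<in> S0" for z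
    using that by (auto simp: S0_def)
  define J where "J = (\<lambda>z k. fst k *\<^sub>R (\<alpha> z *\<^sub>R X (\<Psi> z)) + snd k *\<^sub>R (\<beta> z *\<^sub>R Y (\<Psi> z)))"
  have J: "frechet_derivative \<Psi> (at z) = J z" if "z \<in> square r" for z
    by (rule ext, rule trans[OF frechet_derivative_du_dv[OF \<Psi> that]])
      (simp only: J_def du\<Psi>[OF that] dv\<Psi>[OF that])
  have dJ: "(\<Psi> has_derivative J z) (at z)" if "z \<in> square r" for z
    using smooth_on_has_derivative[OF \<Psi> that] unfolding J[OF that] .
  \<comment> \<open>The inverse of \<open>J\<close> by Cramer's rule. The explicit form is what
    later yields the regularity of the inverse map.\<close>
  define inv_frame where "inv_frame = (\<lambda>x s t w. (det2 w (Y x) / det2 (X x) (Y x) / s, det2 (X x) w / det2 (X x) (Y x) / t))"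
  have blinear: "bounded_linear (inv_frame x s t)" for x s t
    unfolding inv_frame_def linear_conv_bounded_linear[symmetric]
    by (rule linearI) (simp_all add: det2_linear add_divide_distrib)
  have inverse: "inv_frame (\<Psi> z) (\<alpha> z) (\<beta> z) \<circ> J z = id" if "z \<in> S0" for z
  proof
    have "det2 (X (\<Psi> z)) (Y (\<Psi> z)) \<noteq> 0" using indep \<Psi>V S0(1)[OF that] by blast
    then show "(inv_frame (\<Psi> z) (\<alpha> z) (\<beta> z) \<circ> J z) k = id k" for k
      using S0(2,3)[OF that] by (cases k) (simp add: inv_frame_def J_def det2_linear)
  qed
  \<comment> \<open>Bounds the variation of \<open>J\<close> near \<open>a\<close>, as local
    injectivity asks for a derivative that is continuous in the operator norm.\<close>
  define N where "N = (\<lambda>z. norm (\<alpha> z *\<^sub>R X (\<Psi> z) - \<alpha> a *\<^sub>R X (\<Psi> a)) + norm (\<beta> z *\<^sub>R Y (\<Psi> z) - \<beta> a *\<^sub>R Y (\<Psi> a)))"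
  have "continuous_on (square r) N"
    unfolding N_def
    by (intro continuous_intros cont[OF smooth_on_scaleR_compose[OF \<alpha> \<Psi> sm(1) \<Psi>V]]
        cont[OF smooth_on_scaleR_compose[OF \<beta> \<Psi> sm(2) \<Psi>V]])
  then have Ncont: "isCont N a" using asq continuous_on_eq_continuous_at[OF open_square] by blast
  have onormJ: "onorm (\<lambda>k. J z k - J a k) \<le> N z" for z
  proof (rule onorm_le)
    fix k :: "real \<times> real"
    have "J z k - J a k = fst k *\<^sub>R (\<alpha> z *\<^sub>R X (\<Psi> z) - \<alpha> a *\<^sub>R X (\<Psi> a)) + snd k *\<^sub>R (\<beta> z *\<^sub>R Y (\<Psi> z) - \<beta> a *\<^sub>R Y (\<Psi> a))"
      by (simp add: J_def scaleR_diff_right)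
    then have "norm (J z k - J a k) \<le> \<bar>fst k\<bar> * norm (\<alpha> z *\<^sub>R X (\<Psi> z) - \<alpha> a *\<^sub>R X (\<Psi> a))
        + \<bar>snd k\<bar> * norm (\<beta> z *\<^sub>R Y (\<Psi> z) - \<beta> a *\<^sub>R Y (\<Psi> a))"
      by (metis norm_triangle_ineq norm_scaleR)
    also have "\<dots> \<le> norm k * norm (\<alpha> z *\<^sub>R X (\<Psi> z) - \<alpha> a *\<^sub>R X (\<Psi> a))
        + norm k * norm (\<beta> z *\<^sub>R Y (\<Psi> z) - \<beta> a *\<^sub>R Y (\<Psi> a))"
      using norm_fst_le[of "fst k" "snd k"] norm_snd_le[of "snd k" "fst k"]
      by (intro add_mono mult_right_mono) simp_all
    finally show "norm (J z k - J a k) \<le> N z * norm k"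
      by (simp add: N_def algebra_simps)
  qed
  have small: "\<exists>d>0. \<forall>z. dist a z < d \<longrightarrow> onorm (\<lambda>k. J z k - J a k) < \<epsilon>" if "\<epsilon> > 0" for \<epsilon>
  proof -
    have "N a = 0" by (simp add: N_def)
    then obtain d where "d > 0" "\<And>z. dist z a < d \<Longrightarrow> \<bar>N z\<bar> < \<epsilon>"
      using Ncont \<open>\<epsilon> > 0\<close> unfolding continuous_at_eps_delta by (auto simp: dist_real_def)
    then show ?thesis using onormJ
      by (intro exI[of _ d]) (metis abs_ge_self dist_commute le_less_trans order_trans)
  qed
  obtain \<rho> where \<rho>: "\<rho> > 0" "ball a \<rho> \<subseteq> S0" "inj_on \<Psi> (ball a \<rho>)"
    using has_derivative_locally_injective[OF aS0 \<open>open S0\<close> blinear inverse[OF aS0] dJ[OF S0(1)] small] by blast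
  define B where "B = ball a \<rho>"
  define V' where "V' = \<Psi> ` B"
  define \<Theta> where "\<Theta> = inv_into B \<Psi>"
  have B: "open B" "B \<subseteq> S0" "B \<subseteq> square r" "inj_on \<Psi> B" "a \<in> B"
    using \<rho> S0(1) by (auto simp: B_def)
  have contB: "continuous_on B \<Psi>" by (rule continuous_on_subset[OF cont[OF \<Psi>] B(3)])
  have V': "open V'" "V' \<subseteq> V" "x0 \<in> V'"
  proof -
    show "open V'"
      unfolding V'_def by (rule invariance_of_domain_gen[OF B(1) contB B(4)]) simp
    show "V' \<subseteq> V" using \<Psi>V B(3) by (auto simp: V'_def)
    show "x0 \<in> V'" using B(5) at0(1) by (auto simp: V'_def a_def)
  qed
  have \<Theta>: "\<Theta> y \<in> B" "\<Psi> (\<Theta> y) = y" if "y \<in> V'" for y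
    using that unfolding V'_def \<Theta>_def by (auto intro: inv_into_into f_inv_into_f)
  have \<Theta>sq: "\<Theta> ` V' \<subseteq> square r" using \<Theta>(1) B(3) by blast
  have \<Theta>cont: "continuous_on V' \<Theta>"
    unfolding V'_def
    by (rule continuous_on_inverse_open[OF B(1) contB]) (simp_all add: \<Theta>_def inv_into_f_f[OF B(4)])
  have d\<Theta>: "(\<Theta> has_derivative inv_frame y (\<alpha> (\<Theta> y)) (\<beta> (\<Theta> y))) (at y)" if y: "y \<in> V'" for y
  proof (rule has_derivative_inverse_basic[where f=\<Psi> and f'="J (\<Theta> y)" and T=V', OF _ blinear _ _ V'(1) y])
    show "(\<Psi> has_derivative J (\<Theta> y)) (at (\<Theta> y))" using dJ \<Theta>sq y by blast
    show "inv_frame y (\<alpha> (\<Theta> y)) (\<beta> (\<Theta> y)) \<circ> J (\<Theta> y) = id"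
      using inverse[of "\<Theta> y"] \<Theta>[OF y] B(2) by auto
    show "isCont \<Theta> y" using \<Theta>cont V'(1) y continuous_on_eq_continuous_at by blast
  qed (rule \<Theta>(2))
  have smV': "smooth_on f V'" if "smooth_on f V" for f :: "real^2 \<Rightarrow> 'b::real_normed_vector"
    by (rule smooth_on_subset[OF that V'(2)])
  \<comment> \<open>The derivative of \<open>\<Theta>\<close> is an expression in
    \<open>\<Theta>\<close> itself, so each order of regularity yields the next.\<close>
  have Ck: "Ck_on k \<Theta> V'" for k
  proof (induction k)
    case 0
    then show ?case using \<Theta>cont by simp
  next
    case (Suc k)
    have Ck\<Theta>: "Ck_on k (\<lambda>y. f (\<Theta> y)) V'" if "smooth_on f (square r)" for f :: "real \<times> real \<Rightarrow> real"
      by (rule Ck_on_compose[OF V'(1) Suc.IH smooth_on_Ck[OF that] \<Theta>sq])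
    have "smooth_on (\<lambda>y. det2 w (Y y) / det2 (X y) (Y y)) V'" "smooth_on (\<lambda>y. det2 (X y) w / det2 (X y) (Y y)) V'" for w
      using smooth_on_det2_coeff[OF V(1) sm(1,2) smooth_on_const[OF V(1), of w] indep] smV' by blast+
    note coeff = smooth_on_Ck[OF this(1)] smooth_on_Ck[OF this(2)]
    have nz: "\<alpha> (\<Theta> y) \<noteq> 0" "\<beta> (\<Theta> y) \<noteq> 0" if "y \<in> V'" for y
      using S0 \<Theta>(1)[OF that] B(2) by blast+
    show ?case
    proof (rule Ck_on_SucI[OF V'(1) d\<Theta>])
      show "Ck_on k (\<lambda>y. inv_frame y (\<alpha> (\<Theta> y)) (\<beta> (\<Theta> y)) w) V'" for w
        unfolding inv_frame_def divide_inverse[of _ "\<alpha> (\<Theta> _)"] divide_inverse[of _ "\<beta> (\<Theta> _)"]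
        by (intro Ck_on_Pair V'(1) Ck_on_bilinear[OF bounded_bilinear_mult] coeff Ck_on_inverse Ck\<Theta> \<alpha> \<beta> nz)
    qed
  qed
  then have sm\<Theta>: "smooth_on \<Theta> V'" by (simp add: smooth_on_def)
  have comp: "smooth_on (\<lambda>y. f (\<Theta> y)) V'" if "smooth_on f (square r)" for f :: "real \<times> real \<Rightarrow> 'b::euclidean_space"
    by (rule smooth_on_compose[OF V'(1) sm\<Theta> that \<Theta>sq])
  have dH: "frechet_derivative (\<lambda>y. h (\<Theta> y)) (at y) w
      = (det2 w (Y y) / det2 (X y) (Y y) / \<alpha> (\<Theta> y) * P (\<Theta> y)) *\<^sub>R g y
        + (det2 (X y) w / det2 (X y) (Y y) / \<beta> (\<Theta> y) * Q (\<Theta> y)) *\<^sub>R e y" if y: "y \<in> V'" for y w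
  proof -
    have ysq: "\<Theta> y \<in> square r" using \<Theta>sq y by blast
    have "frechet_derivative (\<lambda>y. h (\<Theta> y)) (at y) w = frechet_derivative h (at (\<Theta> y)) (frechet_derivative \<Theta> (at y) w)"
      by (rule smooth_on_frechet_chain[OF sm\<Theta> h y ysq])
    also have "frechet_derivative \<Theta> (at y) = inv_frame y (\<alpha> (\<Theta> y)) (\<beta> (\<Theta> y))"
      by (rule frechet_derivative_at[OF d\<Theta>[OF y], symmetric])
    finally show ?thesis
      using frechet_derivative_du_dv[OF h ysq, of "inv_frame y (\<alpha> (\<Theta> y)) (\<beta> (\<Theta> y)) w"]
      unfolding duh[OF ysq] dvh[OF ysq] \<Theta>(2)[OF y] by (simp add: inv_frame_def)
  qed
  have nz: "\<alpha> (\<Theta> y) \<noteq> 0" "\<beta> (\<Theta> y) \<noteq> 0" "P (\<Theta> y) \<noteq> 0" "Q (\<Theta> y) \<noteq> 0" "det2 (X y) (Y y) \<noteq> 0" if "y \<in> V'" for y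
    using S0(2-5)[OF subsetD[OF B(2) \<Theta>(1)[OF that]]] indep[OF subsetD[OF V'(2) that]] by simp_all
  show ?thesis
  proof (rule that[of V' "\<lambda>y. h (\<Theta> y)" "\<lambda>y. P (\<Theta> y) / \<alpha> (\<Theta> y)" "\<lambda>y. Q (\<Theta> y) / \<beta> (\<Theta> y)"])
    show "open V'" "x0 \<in> V'" "V' \<subseteq> V" "smooth_on (\<lambda>y. h (\<Theta> y)) V'" by (fact V' comp[OF h])+
    show "smooth_on (\<lambda>y. P (\<Theta> y) / \<alpha> (\<Theta> y)) V'"
      by (rule smooth_on_divide[OF V'(1) comp[OF P] comp[OF \<alpha>] nz(1)])
    show "smooth_on (\<lambda>y. Q (\<Theta> y) / \<beta> (\<Theta> y)) V'"
      by (rule smooth_on_divide[OF V'(1) comp[OF Q] comp[OF \<beta>] nz(2)])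
    fix y assume y: "y \<in> V'"
    show "P (\<Theta> y) / \<alpha> (\<Theta> y) \<noteq> 0 \<and> Q (\<Theta> y) / \<beta> (\<Theta> y) \<noteq> 0"
      using nz[OF y] by simp
    show "frechet_derivative (\<lambda>y. h (\<Theta> y)) (at y) (X y) = (P (\<Theta> y) / \<alpha> (\<Theta> y)) *\<^sub>R g y"
      unfolding dH[OF y] using nz[OF y] by (simp add: det2_linear)
    show "frechet_derivative (\<lambda>y. h (\<Theta> y)) (at y) (Y y) = (Q (\<Theta> y) / \<beta> (\<Theta> y)) *\<^sub>R e y"
      unfolding dH[OF y] using nz[OF y] by (simp add: det2_linear)
  qed
qed

section \<open>Vector fields and derivatives in charts\<close>

lemma smooth_atlasD:
  assumes "smooth_atlas A" "c \<in> A"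
  shows "open (dom_chart c)" "open (cod_chart c)"
    "homeomorphism (dom_chart c) (cod_chart c) (coord c) (inv_chart c)"
    "p \<in> dom_chart c \<Longrightarrow> inv_chart c (coord c p) = p"
    "x \<in> cod_chart c \<Longrightarrow> inv_chart c x \<in> dom_chart c"
    "x \<in> cod_chart c \<Longrightarrow> coord c (inv_chart c x) = x"
proof -
  show 1: "open (dom_chart c)" "open (cod_chart c)"
    "homeomorphism (dom_chart c) (cod_chart c) (coord c) (inv_chart c)"
    using assms by (auto simp: smooth_atlas_def)
  show "p \<in> dom_chart c \<Longrightarrow> inv_chart c (coord c p) = p"
    "x \<in> cod_chart c \<Longrightarrow> inv_chart c x \<in> dom_chart c"
    "x \<in> cod_chart c \<Longrightarrow> coord c (inv_chart c x) = x"
    using 1(3) by (auto simp: homeomorphism_def)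
qed

lemma open_coord_image:
  assumes "smooth_atlas A" "c \<in> A" "open U"
  shows "open (coord c ` (dom_chart c \<inter> U))"
proof -
  have "openin (top_of_set (dom_chart c)) (dom_chart c \<inter> U)"
    using assms(3) by (rule openin_open_Int)
  from homeomorphism_imp_open_map[OF smooth_atlasD(3)[OF assms(1,2)] this]
  show ?thesis
    using openin_open_trans smooth_atlasD(2)[OF assms(1,2)] by blast
qed

lemma open_overlap:
  assumes "smooth_atlas A" "c \<in> A" "d \<in> A"
  shows "open (coord c ` (dom_chart c \<inter> dom_chart d))"
  by (rule open_coord_image[OF assms(1,2) smooth_atlasD(1)[OF assms(1,3)]])

lemma smooth_transition:
  "smooth_atlas A \<Longrightarrow> c \<in> A \<Longrightarrow> d \<in> A \<Longrightarrow>
    smooth_on (coord d \<circ> inv_chart c) (coord c ` (dom_chart c \<inter> dom_chart d))"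
  by (simp add: smooth_atlas_def)

lemma transition_coord:
  "smooth_atlas A \<Longrightarrow> c \<in> A \<Longrightarrow> p \<in> dom_chart c \<Longrightarrow> (coord d \<circ> inv_chart c) (coord c p) = coord d p"
  by (simp add: smooth_atlasD(4))

lemma in_chart_coord:
  "smooth_atlas A \<Longrightarrow> c \<in> A \<Longrightarrow> p \<in> dom_chart c \<Longrightarrow> in_chart c f (coord c p) = f p"
  by (simp add: in_chart_def smooth_atlasD(4))

lemma chart_at:
  assumes "p \<in> points A"
  shows "chart_at A p \<in> A" "p \<in> dom_chart (chart_at A p)"
proof -
  have "\<exists>c. c \<in> A \<and> p \<in> dom_chart c" using assms by (auto simp: points_def)
  from someI_ex[OF this] show "chart_at A p \<in> A" "p \<in> dom_chart (chart_at A p)"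
    by (simp_all add: chart_at_def)
qed

lemma dom_chart_subset_points: "c \<in> A \<Longrightarrow> dom_chart c \<subseteq> points A"
  by (auto simp: points_def)

lemma smooth_in_chart: "smooth_map A f \<Longrightarrow> c \<in> A \<Longrightarrow> smooth_on (in_chart c f) (cod_chart c)"
  by (simp add: smooth_map_def)

lemma smooth_field_in_chart: "vector_field A X \<Longrightarrow> c \<in> A \<Longrightarrow> smooth_on (in_chart c (X c)) (cod_chart c)"
  by (simp add: vector_field_def)

text \<open>Works in a named chart, whereas \<open>pushforward\<close> uses the arbitrary
  \<open>chart_at\<close>.\<close>

definition dchart :: "'p chart \<Rightarrow> ('p \<Rightarrow> 'b::real_normed_vector) \<Rightarrow> 'p \<Rightarrow> real^2 \<Rightarrow> 'b" where
  "dchart c f p = frechet_derivative (in_chart c f) (at (coord c p))"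

lemma linear_dchart:
  "smooth_map A f \<Longrightarrow> c \<in> A \<Longrightarrow> p \<in> dom_chart c \<Longrightarrow> linear (dchart c f p)"
  unfolding dchart_def by (rule smooth_on_linear_derivative[OF smooth_in_chart]) auto

lemma dchart_transition:
  assumes A: "smooth_atlas A" and f: "smooth_map A f" and c: "c \<in> A" "d \<in> A" and p: "p \<in> dom_chart c" "p \<in> dom_chart d"
  shows "dchart c f p v = dchart d f p (frechet_derivative (coord d \<circ> inv_chart c) (at (coord c p)) v)"
proof -
  define N where "N = coord c ` (dom_chart c \<inter> dom_chart d)"
  have N: "open N" "coord c p \<in> N" using open_overlap[OF A c] p by (auto simp: N_def)
  have eq: "in_chart c f x = in_chart d f ((coord d \<circ> inv_chart c) x)" if "x \<in> N" for x
    using that A c by (auto simp: N_def in_chart_def smooth_atlasD(4))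
  have "dchart c f p v = frechet_derivative (\<lambda>x. in_chart d f ((coord d \<circ> inv_chart c) x)) (at (coord c p)) v"
    unfolding dchart_def using frechet_derivative_cong[OF N eq] by simp
  also have "\<dots> = frechet_derivative (in_chart d f) (at ((coord d \<circ> inv_chart c) (coord c p)))
      (frechet_derivative (coord d \<circ> inv_chart c) (at (coord c p)) v)"
    by (rule smooth_on_frechet_chain[OF smooth_transition[OF A c] smooth_in_chart[OF f c(2)]])
      (use p A c in \<open>auto simp: smooth_atlasD(4)\<close>)
  finally show ?thesis unfolding dchart_def transition_coord[OF A c(1) p(1)] .
qed

text \<open>The transformation rule for the components of \<open>X\<close> matches the Jacobian in
  \<open>dchart_transition\<close>, so the arbitrary chart behind \<open>pushforward\<close> is
  harmless.\<close>

lemma pushforward_eq: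
  assumes A: "smooth_atlas A" and f: "smooth_map A f" and X: "vector_field A X" and c: "c \<in> A" "p \<in> dom_chart c"
  shows "pushforward A f X p = dchart c f p (X c p)"
proof -
  define d where "d = chart_at A p"
  have d: "d \<in> A" "p \<in> dom_chart d"
    using chart_at[of p A] c by (auto simp: points_def d_def)
  have "X d p = frechet_derivative (coord d \<circ> inv_chart c) (at (coord c p)) (X c p)"
    using X c d unfolding vector_field_def by blast
  then show ?thesis
    using dchart_transition[OF A f c(1) d(1) c(2) d(2)]
    by (simp add: pushforward_def Let_def d_def[symmetric] dchart_def[symmetric])
qed

lemma pushforward_chart_at: "pushforward A f X p = dchart (chart_at A p) f p (X (chart_at A p) p)"
  by (simp add: pushforward_def Let_def dchart_def)

lemma in_chart_pushforward:
  assumes "smooth_atlas A" "smooth_map A f" "vector_field A X" "c \<in> A" "x \<in> cod_chart c"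
  shows "in_chart c (pushforward A f X) x = frechet_derivative (in_chart c f) (at x) (in_chart c (X c) x)"
proof -
  note c = smooth_atlasD[OF assms(1,4)]
  have "pushforward A f X (inv_chart c x) = dchart c f (inv_chart c x) (X c (inv_chart c x))"
    by (rule pushforward_eq[OF assms(1-4) c(5)[OF assms(5)]])
  then show ?thesis by (simp add: in_chart_def dchart_def c(6)[OF assms(5)])
qed

lemma smooth_map_pushforward:
  assumes "smooth_atlas A" "smooth_map A f" "vector_field A X"
  shows "smooth_map A (pushforward A f X)"
  unfolding smooth_map_def
proof
  fix c assume c: "c \<in> A"
  note cc = smooth_atlasD(2)[OF assms(1) c]
  have "smooth_on (\<lambda>x. frechet_derivative (in_chart c f) (at x) (in_chart c (X c) x)) (cod_chart c)"
    by (rule smooth_on_frechet[OF cc smooth_in_chart[OF assms(2) c] smooth_field_in_chart[OF assms(3) c]])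
  then show "smooth_on (in_chart c (pushforward A f X)) (cod_chart c)"
    using smooth_on_cong[OF cc, of "in_chart c (pushforward A f X)"
        "\<lambda>x. frechet_derivative (in_chart c f) (at x) (in_chart c (X c) x)"]
      in_chart_pushforward[OF assms c] by simp
qed

lemma dchart_cong:
  assumes "smooth_atlas A" "c \<in> A" "p \<in> dom_chart c" "\<And>q. q \<in> points A \<Longrightarrow> f q = g q"
  shows "dchart c f p = dchart c g p"
  unfolding dchart_def
proof (rule frechet_derivative_cong[OF smooth_atlasD(2)[OF assms(1,2)]])
  show "coord c p \<in> cod_chart c" using assms(3) by blast
  show "in_chart c f y = in_chart c g y" if "y \<in> cod_chart c" for y
    using assms(4) smooth_atlasD(5)[OF assms(1,2) that] dom_chart_subset_points[OF assms(2)]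
    by (auto simp: in_chart_def)
qed

lemma pushforward_cong:
  assumes "smooth_atlas A" "p \<in> points A" "\<And>q. q \<in> points A \<Longrightarrow> f q = g q"
  shows "pushforward A f X p = pushforward A g X p"
  unfolding pushforward_chart_at using dchart_cong[OF assms(1) chart_at[OF assms(2)] assms(3)] by simp

lemma smooth_map_inner:
  assumes "smooth_atlas A" "smooth_map A f" "smooth_map A g"
  shows "smooth_map A (\<lambda>p. f p \<bullet> g p)"
  using assms smooth_on_inner[OF smooth_atlasD(2)] unfolding smooth_map_def in_chart_def o_def by blast

text \<open>Product rule for a constant function; the skew-symmetry relations below come from it
  with \<open>k = 1\<close> (unit length) or \<open>k = 0\<close> (orthogonality).\<close>

lemma pushforward_inner_const:
  fixes f g :: "'p::{t2_space,second_countable_topology} \<Rightarrow> 'b::euclidean_space"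
  assumes A: "smooth_atlas A" and f: "smooth_map A f" and g: "smooth_map A g"
    and p: "p \<in> points A" and const: "\<And>q. q \<in> points A \<Longrightarrow> f q \<bullet> g q = k"
  shows "pushforward A f X p \<bullet> g p = - (f p \<bullet> pushforward A g X p)"
proof -
  define c where "c = chart_at A p"
  have c: "c \<in> A" "p \<in> dom_chart c" using chart_at[OF p] by (simp_all add: c_def)
  define x where "x = coord c p"
  have x: "x \<in> cod_chart c" using c(2) by (auto simp: x_def)
  have df: "(in_chart c f has_derivative dchart c f p) (at x)" and dg: "(in_chart c g has_derivative dchart c g p) (at x)"
    unfolding dchart_def x_def[symmetric]
    using smooth_on_has_derivative[OF smooth_in_chart[OF f c(1)] x] smooth_on_has_derivative[OF smooth_in_chart[OF g c(1)] x] .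
  have "((\<lambda>y. in_chart c f y \<bullet> in_chart c g y) has_derivative
      (\<lambda>v. in_chart c f x \<bullet> dchart c g p v + dchart c f p v \<bullet> in_chart c g x)) (at x)"
    by (rule has_derivative_inner[OF df dg])
  moreover have "((\<lambda>y. in_chart c f y \<bullet> in_chart c g y) has_derivative (\<lambda>v. 0)) (at x)"
  proof (rule has_derivative_transform_within_open[OF has_derivative_const smooth_atlasD(2)[OF A c(1)] x])
    show "k = in_chart c f y \<bullet> in_chart c g y" if "y \<in> cod_chart c" for y
      using const smooth_atlasD(5)[OF A c(1) that] dom_chart_subset_points[OF c(1)] by (auto simp: in_chart_def)
  qed
  ultimately have "(\<lambda>v. in_chart c f x \<bullet> dchart c g p v + dchart c f p v \<bullet> in_chart c g x) = (\<lambda>v. 0)"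
    by (rule has_derivative_unique)
  from fun_cong[OF this, of "X c p"] show ?thesis
    unfolding pushforward_chart_at c_def[symmetric] x_def in_chart_coord[OF A c] by linarith
qed

text \<open>In a chart this is the commutator formula for directional derivatives. It plays the part
  of torsion-freeness: it links the derivative of the image of \<open>Y\<close> along
  \<open>X\<close> with that of the image of \<open>X\<close> along \<open>Y\<close>.\<close>

lemma pushforward_bracket:
  fixes f :: "'p::{t2_space,second_countable_topology} \<Rightarrow> 'b::euclidean_space"
  assumes A: "smooth_atlas A" and f: "smooth_map A f" and X: "vector_field A X" and Y: "vector_field A Y"
    and c: "c \<in> A" "p \<in> dom_chart c"
  shows "pushforward A (pushforward A f Y) X p - pushforward A (pushforward A f X) Y p
    = dchart c f p (lie_bracket X Y c p)"
proof -
  define x where "x = coord c p"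
  have x: "x \<in> cod_chart c" using c(2) by (auto simp: x_def)
  note cc = smooth_atlasD(2)[OF A c(1)]
  have D: "dchart c (pushforward A f Z) p = frechet_derivative (\<lambda>x. frechet_derivative (in_chart c f) (at x) (in_chart c (Z c) x)) (at x)"
    if "vector_field A Z" for Z
    unfolding dchart_def x_def[symmetric]
    by (rule frechet_derivative_cong[OF cc x in_chart_pushforward[OF A f that c(1)]])
  have v: "X c p = in_chart c (X c) x" "Y c p = in_chart c (Y c) x"
    unfolding x_def in_chart_coord[OF A c] by simp_all
  show ?thesis
    unfolding pushforward_eq[OF A smooth_map_pushforward[OF A f Y] X c]
      pushforward_eq[OF A smooth_map_pushforward[OF A f X] Y c] D[OF X] D[OF Y]
      lie_bracket_def x_def[symmetric] v
    using frechet_derivative_bracket[OF cc smooth_in_chart[OF f c(1)] smooth_field_in_chart[OF X c(1)]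
        smooth_field_in_chart[OF Y c(1)] x]
    by (simp add: dchart_def x_def)
qed

section \<open>The Levi-Civita connection of an immersion\<close>

lemma linear_axis_expand:
  fixes v :: "real^'n"
  assumes "linear L"
  shows "L v = (\<Sum>k\<in>UNIV. v $ k *\<^sub>R L (axis k 1))"
proof -
  have "L v = L (\<Sum>k\<in>UNIV. v $ k *\<^sub>R axis k 1)"
    using basis_expansion[of v] by (simp add: scalar_mult_eq_scaleR)
  then show ?thesis using assms by (simp add: linear_sum linear_scale)
qed

lemma matrix_inv_right:
  assumes "invertible M"
  shows "M ** matrix_inv M = mat 1"
  using someI_ex[OF assms[unfolded invertible_def]] by (simp add: matrix_inv_def)

text \<open>The Christoffel symbols are the coefficients of the tangential part of the second
  derivatives \<open>H i j\<close> in the coordinate vectors \<open>E k\<close>. The covariant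
  derivative is thus the tangential part of the flat one; testing against tangent vectors avoids
  writing down the projection.\<close>

lemma levi_civita_chart:
  fixes F :: "real^2 \<Rightarrow> 'b::euclidean_space"
  assumes S: "open S" "smooth_on F S" "x \<in> S" and inj: "inj (frechet_derivative F (at x))"
    and \<eta>: "smooth_on \<eta> S"
  defines "M \<equiv> \<lambda>y. (\<chi> i j. partial i F y \<bullet> partial j F y) :: real^2^2"
  defines "\<Gamma> \<equiv> \<lambda>k i j. (\<Sum>l\<in>UNIV. matrix_inv (M x) $ k $ l *
     (partial i (\<lambda>y. M y $ j $ l) x + partial j (\<lambda>y. M y $ i $ l) x - partial l (\<lambda>y. M y $ i $ j) x)) / 2"
  shows "frechet_derivative F (at x) (\<chi> k. frechet_derivative \<eta> (at x) v $ k +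
      (\<Sum>i\<in>UNIV. \<Sum>j\<in>UNIV. \<Gamma> k i j * v $ i * \<eta> x $ j)) \<bullet> frechet_derivative F (at x) z
    = frechet_derivative (\<lambda>y. frechet_derivative F (at y) (\<eta> y)) (at x) v \<bullet> frechet_derivative F (at x) z"
proof -
  define D where "D = frechet_derivative F (at x)"
  define E where "E = (\<lambda>k. D (axis k 1))"
  define H where "H = (\<lambda>i j. frechet_derivative (\<lambda>y. frechet_derivative F (at y) (axis j 1)) (at x) (axis i 1))"
  have linD: "linear D" unfolding D_def by (rule smooth_on_linear_derivative[OF S(2,3)])
  have Hsym: "H i j = H j i" for i j
    unfolding H_def by (rule second_derivative_symmetric[OF S])
  have smE: "smooth_on (\<lambda>y. frechet_derivative F (at y) w) S" for w
    by (rule smooth_on_frechet_const[OF S(2)])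
  have dM: "partial l (\<lambda>y. M y $ i $ j) x = H l i \<bullet> E j + E i \<bullet> H l j" for l i j
  proof -
    have "((\<lambda>y. frechet_derivative F (at y) (axis i 1) \<bullet> frechet_derivative F (at y) (axis j 1)) has_derivative
       (\<lambda>h. frechet_derivative F (at x) (axis i 1) \<bullet> frechet_derivative (\<lambda>y. frechet_derivative F (at y) (axis j 1)) (at x) h
         + frechet_derivative (\<lambda>y. frechet_derivative F (at y) (axis i 1)) (at x) h \<bullet> frechet_derivative F (at x) (axis j 1))) (at x)"
      by (intro has_derivative_inner smooth_on_has_derivative[OF smE S(3)])
    from fun_cong[OF frechet_derivative_at[OF this], of "axis l 1"] show ?thesis
      unfolding M_def partial_def H_def E_def D_def by simp
  qed
  \<comment> \<open>Christoffel symbols of the first kind: of the six terms, four cancel in pairs by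
    the symmetry of \<open>H\<close>.\<close>
  have key: "partial i (\<lambda>y. M y $ j $ l) x + partial j (\<lambda>y. M y $ i $ l) x - partial l (\<lambda>y. M y $ i $ j) x = 2 * (H i j \<bullet> E l)"
    for i j l
    unfolding dM using Hsym[of i j] Hsym[of i l] Hsym[of j l] by (simp add: inner_commute)
  have Mx: "M x $ i $ j = E i \<bullet> E j" for i j
    by (simp add: M_def partial_def E_def D_def)
  \<comment> \<open>The Gram matrix has trivial kernel: its quadratic form at \<open>w\<close> is
    the squared length of \<open>D w\<close>, and \<open>D\<close> is injective.\<close>
  have inv: "invertible (M x)"
  proof -
    have "w = 0" if "M x *v w = 0" for w
    proof -
      have Dw: "D w = (\<Sum>k\<in>UNIV. w $ k *\<^sub>R E k)"
        unfolding E_def by (rule linear_axis_expand[OF linD])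
      have "D w \<bullet> D w = (\<Sum>i\<in>UNIV. w $ i * (\<Sum>j\<in>UNIV. M x $ i $ j * w $ j))"
        unfolding Dw Mx by (simp add: inner_sum_left inner_sum_right sum_distrib_left mult.commute mult.left_commute inner_commute)
      also have "\<dots> = (\<Sum>i\<in>UNIV. w $ i * (M x *v w) $ i)"
        by (simp add: matrix_vector_mult_def)
      finally have "D w = 0" using that by simp
      then show "w = 0" using inj linear_0[OF linD] unfolding D_def[symmetric] by (metis injD)
    qed
    then show ?thesis
      unfolding invertible_left_inverse matrix_left_invertible_ker by blast
  qed
  have \<Gamma>: "\<Gamma> k i j = (\<Sum>l\<in>UNIV. matrix_inv (M x) $ k $ l * (H i j \<bullet> E l))" for k i j
    unfolding \<Gamma>_def key by (simp add: sum_divide_distrib)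
  \<comment> \<open>Lowering the upper index with the metric cancels the inverse matrix.\<close>
  have contr: "(\<Sum>k\<in>UNIV. \<Gamma> k i j * (E k \<bullet> E r)) = H i j \<bullet> E r" for i j r
  proof -
    have "(\<Sum>k\<in>UNIV. \<Gamma> k i j * (E k \<bullet> E r)) = (\<Sum>k\<in>UNIV. \<Sum>l\<in>UNIV. M x $ r $ k * matrix_inv (M x) $ k $ l * (H i j \<bullet> E l))"
      unfolding \<Gamma> Mx by (simp add: sum_distrib_left mult.commute mult.left_commute inner_commute)
    also have "\<dots> = (\<Sum>l\<in>UNIV. \<Sum>k\<in>UNIV. M x $ r $ k * matrix_inv (M x) $ k $ l * (H i j \<bullet> E l))"
      by (rule sum.swap)
    also have "\<dots> = (\<Sum>l\<in>UNIV. (M x ** matrix_inv (M x)) $ r $ l * (H i j \<bullet> E l))"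
      by (simp add: matrix_matrix_mult_def sum_distrib_right)
    also have "\<dots> = H i j \<bullet> E r"
      unfolding matrix_inv_right[OF inv] by (simp add: mat_def if_distrib[of "\<lambda>a. a * _"] cong: if_cong)
    finally show ?thesis .
  qed
  define \<gamma> where "\<gamma> = (\<chi> k. \<Sum>i\<in>UNIV. \<Sum>j\<in>UNIV. \<Gamma> k i j * v $ i * \<eta> x $ j)"
  define K where "K = (\<Sum>i\<in>UNIV. \<Sum>j\<in>UNIV. (v $ i * \<eta> x $ j) *\<^sub>R H i j)"
  have D\<gamma>: "D \<gamma> \<bullet> E r = K \<bullet> E r" for r
  proof -
    have "D \<gamma> \<bullet> E r = (\<Sum>k\<in>UNIV. \<Sum>i\<in>UNIV. \<Sum>j\<in>UNIV. v $ i * \<eta> x $ j * (\<Gamma> k i j * (E k \<bullet> E r)))"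
      unfolding linear_axis_expand[OF linD, of \<gamma>]
      by (simp add: E_def \<gamma>_def inner_sum_left sum_distrib_left mult.assoc mult.commute mult.left_commute)
    also have "\<dots> = (\<Sum>i\<in>UNIV. \<Sum>k\<in>UNIV. \<Sum>j\<in>UNIV. v $ i * \<eta> x $ j * (\<Gamma> k i j * (E k \<bullet> E r)))"
      by (rule sum.swap)
    also have "\<dots> = (\<Sum>i\<in>UNIV. \<Sum>j\<in>UNIV. \<Sum>k\<in>UNIV. v $ i * \<eta> x $ j * (\<Gamma> k i j * (E k \<bullet> E r)))"
      by (rule sum.cong[OF refl sum.swap])
    also have "\<dots> = (\<Sum>i\<in>UNIV. \<Sum>j\<in>UNIV. v $ i * \<eta> x $ j * (H i j \<bullet> E r))"
      unfolding sum_distrib_left[symmetric] contr ..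
    finally show ?thesis by (simp add: K_def inner_sum_left)
  qed
  have d2: "frechet_derivative (\<lambda>y. frechet_derivative F (at y) (\<eta> x)) (at x) v = K"
  proof -
    have lin2: "linear (frechet_derivative (\<lambda>y. frechet_derivative F (at y) w) (at x))" for w
      by (rule smooth_on_linear_derivative[OF smE S(3)])
    have "frechet_derivative (\<lambda>y. frechet_derivative F (at y) (\<eta> x)) (at x) v
        = (\<Sum>i\<in>UNIV. v $ i *\<^sub>R frechet_derivative (\<lambda>y. frechet_derivative F (at y) (\<eta> x)) (at x) (axis i 1))"
      by (rule linear_axis_expand[OF lin2])
    also have "\<dots> = (\<Sum>i\<in>UNIV. v $ i *\<^sub>R frechet_derivative (\<lambda>y. frechet_derivative F (at y) (axis i 1)) (at x) (\<eta> x))"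
      using second_derivative_symmetric[OF S] by (intro sum.cong refl arg_cong2[where f=scaleR])
    also have "\<dots> = (\<Sum>i\<in>UNIV. v $ i *\<^sub>R (\<Sum>j\<in>UNIV. \<eta> x $ j *\<^sub>R H j i))"
      unfolding H_def by (intro sum.cong refl arg_cong2[where f=scaleR] linear_axis_expand[OF lin2])
    finally show ?thesis unfolding K_def by (simp add: scaleR_sum_right Hsym)
  qed
  have "(\<chi> k. frechet_derivative \<eta> (at x) v $ k + (\<Sum>i\<in>UNIV. \<Sum>j\<in>UNIV. \<Gamma> k i j * v $ i * \<eta> x $ j))
      = frechet_derivative \<eta> (at x) v + \<gamma>"
    by (simp add: vec_eq_iff \<gamma>_def)
  then have "D (\<chi> k. frechet_derivative \<eta> (at x) v $ k + (\<Sum>i\<in>UNIV. \<Sum>j\<in>UNIV. \<Gamma> k i j * v $ i * \<eta> x $ j)) \<bullet> E r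
      = (D (frechet_derivative \<eta> (at x) v) + K) \<bullet> E r" for r
    by (simp add: linear_add[OF linD] inner_add_left D\<gamma>)
  moreover have "D (frechet_derivative \<eta> (at x) v) + K = frechet_derivative (\<lambda>y. frechet_derivative F (at y) (\<eta> y)) (at x) v"
    using frechet_derivative_frechet_field[OF S(1,2) \<eta> S(3), of v] d2 by (simp add: D_def)
  ultimately show ?thesis
    unfolding D_def[symmetric] linear_axis_expand[OF linD, of z]
    by (simp add: inner_sum_right E_def)
qed

text \<open>Every later computation with the connection goes through this characterization; the
  Christoffel symbols are not unfolded again.\<close>

lemma levi_civita_inner:
  fixes f :: "'p::{t2_space,second_countable_topology} \<Rightarrow> 'b::euclidean_space"
  assumes A: "smooth_atlas A" and f: "immersion A f" and X: "vector_field A X" and Y: "vector_field A Y"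
    and c: "c \<in> A" "p \<in> dom_chart c"
  shows "dchart c f p (levi_civita f X Y c p) \<bullet> dchart c f p z
    = pushforward A (pushforward A f Y) X p \<bullet> dchart c f p z"
proof -
  have sf: "smooth_map A f" using f by (simp add: immersion_def)
  define x where "x = coord c p"
  have x: "x \<in> cod_chart c" using c(2) by (auto simp: x_def)
  note cc = smooth_atlasD(2)[OF A c(1)]
  have inj: "inj (frechet_derivative (in_chart c f) (at x))"
    using f c by (simp add: immersion_def x_def)
  have D: "dchart c (pushforward A f Y) p = frechet_derivative (\<lambda>x. frechet_derivative (in_chart c f) (at x) (in_chart c (Y c) x)) (at x)"
    unfolding dchart_def x_def[symmetric]
    by (rule frechet_derivative_cong[OF cc x in_chart_pushforward[OF A sf Y c(1)]])
  have v: "Y c p = in_chart c (Y c) x"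
    unfolding x_def in_chart_coord[OF A c] by simp
  show ?thesis
    using levi_civita_chart[OF cc smooth_in_chart[OF sf c(1)] x inj smooth_field_in_chart[OF Y c(1)], of "X c p" z]
    unfolding pushforward_eq[OF A smooth_map_pushforward[OF A sf Y] X c] D
    unfolding levi_civita_def christoffel_def metric_coeff_def v dchart_def x_def[symmetric] .
qed

section \<open>Orthonormal frames that diagonalize the second fundamental form\<close>

lemma det2_nonzero:
  assumes "\<And>a b. a *\<^sub>R x + b *\<^sub>R y = 0 \<Longrightarrow> a = 0 \<and> b = 0"
  shows "det2 x y \<noteq> 0"
proof
  assume d: "det2 x y = 0"
  have "(y $ 1) *\<^sub>R x + (- (x $ 1)) *\<^sub>R y = 0" "(y $ 2) *\<^sub>R x + (- (x $ 2)) *\<^sub>R y = 0"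
    using d by (simp_all add: vec_eq_iff forall_2 det2_def algebra_simps)
  then have "x $ 1 = 0" "x $ 2 = 0"
    using assms[of "y $ 1" "- (x $ 1)"] assms[of "y $ 2" "- (x $ 2)"] by simp_all
  then have "1 *\<^sub>R x + 0 *\<^sub>R y = 0" by (simp add: vec_eq_iff forall_2)
  then show False using assms[of 1 0] by simp
qed

lemma orthonormal_independent:
  assumes "linear L" "L x \<bullet> L x = (1::real)" "L y \<bullet> L y = 1" "L x \<bullet> L y = 0" "a *\<^sub>R x + b *\<^sub>R y = 0"
  shows "a = 0 \<and> b = 0"
proof -
  have "a *\<^sub>R L x + b *\<^sub>R L y = 0"
    using arg_cong[OF assms(5), of L] linear_add[OF assms(1)] linear_scale[OF assms(1)] linear_0[OF assms(1)] by simp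
  then have "(a *\<^sub>R L x + b *\<^sub>R L y) \<bullet> L x = 0" "(a *\<^sub>R L x + b *\<^sub>R L y) \<bullet> L y = 0" by simp_all
  then show ?thesis using assms(2-4) by (simp add: inner_add_left inner_add_right inner_commute)
qed

lemma orthonormal_coefficients:
  assumes "G \<bullet> G = (1::real)" "E \<bullet> E = 1" "G \<bullet> E = 0" "u = a *\<^sub>R G + b *\<^sub>R E"
  shows "u = (u \<bullet> G) *\<^sub>R G + (u \<bullet> E) *\<^sub>R E"
  using assms by (simp add: inner_add_left inner_add_right inner_commute)

lemma orthonormal_frameD:
  assumes A: "smooth_atlas A" and h: "immersion A h" and fr: "orthonormal_frame A h X Y"
    and c: "c \<in> A" "p \<in> dom_chart c"
  defines "G \<equiv> pushforward A h X p" and "E \<equiv> pushforward A h Y p"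
  shows "G \<bullet> G = 1" "E \<bullet> E = 1" "G \<bullet> E = 0"
    and "dchart c h p (X c p) = G" "dchart c h p (Y c p) = E"
    and "det2 (X c p) (Y c p) \<noteq> 0"
    and "dchart c h p z = (dchart c h p z \<bullet> G) *\<^sub>R G + (dchart c h p z \<bullet> E) *\<^sub>R E"
    and "range (dchart c h p) = {a *\<^sub>R G + b *\<^sub>R E |a b. True}"
proof -
  have p: "p \<in> points A" using c by (auto simp: points_def)
  have sh: "smooth_map A h" using h by (simp add: immersion_def)
  have X: "vector_field A X" and Y: "vector_field A Y" using fr by (simp_all add: orthonormal_frame_def)
  show on: "G \<bullet> G = 1" "E \<bullet> E = 1" "G \<bullet> E = 0"
    using fr p by (simp_all add: orthonormal_frame_def induced_inner_def G_def E_def)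
  show D: "dchart c h p (X c p) = G" "dchart c h p (Y c p) = E"
    unfolding G_def E_def using pushforward_eq[OF A sh _ c] X Y by simp_all
  have lin: "linear (dchart c h p)" by (rule linear_dchart[OF sh c])
  show det: "det2 (X c p) (Y c p) \<noteq> 0"
    by (rule det2_nonzero, rule orthonormal_independent[OF lin]) (simp_all add: D on)
  have comb: "dchart c h p (a *\<^sub>R X c p + b *\<^sub>R Y c p) = a *\<^sub>R G + b *\<^sub>R E" for a b
    by (simp add: linear_add[OF lin] linear_scale[OF lin] D)
  have ex: "\<exists>a b. dchart c h p z = a *\<^sub>R G + b *\<^sub>R E" for z
    using comb det2_expand[OF det, of z] by metis
  show "dchart c h p z = (dchart c h p z \<bullet> G) *\<^sub>R G + (dchart c h p z \<bullet> E) *\<^sub>R E"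
    using ex[of z] orthonormal_coefficients[OF on] by blast
  show "range (dchart c h p) = {a *\<^sub>R G + b *\<^sub>R E |a b. True}"
    using ex comb[symmetric] by blast
qed

lemma tangent_plane_frame:
  assumes "smooth_atlas A" "immersion A h" "orthonormal_frame A h X Y" "p \<in> points A"
  shows "tangent_plane A h p = {a *\<^sub>R pushforward A h X p + b *\<^sub>R pushforward A h Y p |a b. True}"
  using orthonormal_frameD(8)[OF assms(1-3) chart_at[OF assms(4)]]
  unfolding tangent_plane_def Let_def dchart_def .

text \<open>\<open>normal_component\<close> is a definite description, so uniqueness is needed as
  well: tangent vectors are determined by their products with \<open>G\<close> and
  \<open>E\<close>.\<close>

lemma normal_component_frame:
  fixes G E :: "'b::euclidean_space"
  assumes on: "G \<bullet> G = 1" "E \<bullet> E = 1" "G \<bullet> E = 0"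
  shows "normal_component {a *\<^sub>R G + b *\<^sub>R E |a b. True} v = v - (v \<bullet> G) *\<^sub>R G - (v \<bullet> E) *\<^sub>R E"
proof -
  define T where "T = {a *\<^sub>R G + b *\<^sub>R E |a b. True}"
  have EG: "E \<bullet> G = 0" using on(3) by (simp add: inner_commute)
  have perp: "w \<in> T\<^sup>\<bottom> \<longleftrightarrow> w \<bullet> G = 0 \<and> w \<bullet> E = 0" for w
  proof
    assume w: "w \<in> T\<^sup>\<bottom>"
    have "G = 1 *\<^sub>R G + 0 *\<^sub>R E" "E = 0 *\<^sub>R G + 1 *\<^sub>R E" by simp_all
    then have "G \<in> T" "E \<in> T" unfolding T_def by blast+
    then show "w \<bullet> G = 0 \<and> w \<bullet> E = 0"
      using w by (auto simp: orthogonal_comp_def orthogonal_def inner_commute)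
  next
    assume "w \<bullet> G = 0 \<and> w \<bullet> E = 0"
    then show "w \<in> T\<^sup>\<bottom>"
      by (auto simp: orthogonal_comp_def orthogonal_def T_def inner_add_left inner_add_right inner_commute)
  qed
  have "normal_component T v = v - (v \<bullet> G) *\<^sub>R G - (v \<bullet> E) *\<^sub>R E"
    unfolding normal_component_def
  proof (rule the_equality)
    have "(v \<bullet> G) *\<^sub>R G + (v \<bullet> E) *\<^sub>R E \<in> T" unfolding T_def by blast
    moreover have "v - (v - (v \<bullet> G) *\<^sub>R G - (v \<bullet> E) *\<^sub>R E) = (v \<bullet> G) *\<^sub>R G + (v \<bullet> E) *\<^sub>R E" by simp
    ultimately show "v - (v \<bullet> G) *\<^sub>R G - (v \<bullet> E) *\<^sub>R E \<in> T\<^sup>\<bottom> \<and> v - (v - (v \<bullet> G) *\<^sub>R G - (v \<bullet> E) *\<^sub>R E) \<in> T"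
      unfolding perp using on EG by (simp add: inner_diff_left add.commute)
    fix w assume w: "w \<in> T\<^sup>\<bottom> \<and> v - w \<in> T"
    then obtain a b where "v - w = a *\<^sub>R G + b *\<^sub>R E" by (auto simp: T_def)
    then have "v - w = ((v - w) \<bullet> G) *\<^sub>R G + ((v - w) \<bullet> E) *\<^sub>R E"
      by (rule orthonormal_coefficients[OF on])
    then show "w = v - (v \<bullet> G) *\<^sub>R G - (v \<bullet> E) *\<^sub>R E"
      using w unfolding perp by (simp add: inner_diff_left algebra_simps)
  qed
  then show ?thesis by (simp add: T_def)
qed

text \<open>The difference of both sides is tangent and, by \<open>levi_civita_inner\<close>,
  orthogonal to all tangent vectors. The vector \<open>u\<close> only witnesses that the flat
  derivative is tangent.\<close>

lemma levi_civita_tangential: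
  assumes A: "smooth_atlas A" and f: "immersion A f" and X: "vector_field A X" and Y: "vector_field A Y"
    and c: "c \<in> A" "p \<in> dom_chart c" and w: "pushforward A (pushforward A f Y) X p = dchart c f p u"
  shows "dchart c f p (levi_civita f X Y c p) = pushforward A (pushforward A f Y) X p"
proof -
  have lin: "linear (dchart c f p)" using f linear_dchart[OF _ c, of f] by (simp add: immersion_def)
  have "dchart c f p (levi_civita f X Y c p) - dchart c f p u = dchart c f p (levi_civita f X Y c p - u)"
    by (rule linear_diff[OF lin, symmetric])
  moreover have "(dchart c f p (levi_civita f X Y c p) - dchart c f p u) \<bullet> dchart c f p z = 0" for z
    using levi_civita_inner[OF A f X Y c, of z] by (simp add: inner_diff_left w)
  ultimately show ?thesis using w by (metis eq_iff_diff_eq_0 inner_eq_zero_iff)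
qed

lemma dchart_eq_0_iff:
  assumes "immersion A f" "c \<in> A" "p \<in> dom_chart c"
  shows "dchart c f p v = 0 \<longleftrightarrow> v = 0"
proof -
  have "inj (dchart c f p)" "linear (dchart c f p)"
    using assms linear_dchart[OF _ assms(2,3), of f] by (simp_all add: immersion_def dchart_def)
  then show ?thesis by (metis injD linear_0)
qed

lemma second_ff_chart_at:
  assumes "p \<in> points A"
  shows "second_ff A f X Y p = pushforward A (pushforward A f Y) X p
    - dchart (chart_at A p) f p (levi_civita f X Y (chart_at A p) p)"
  by (simp add: second_ff_def pushforward_chart_at[of _ f])

lemma dchart_add_scale:
  fixes a b :: "'p::{t2_space,second_countable_topology} \<Rightarrow> real" and f G E :: "'p \<Rightarrow> 'b::euclidean_space"
  assumes A: "smooth_atlas A" and c: "c \<in> A" "p \<in> dom_chart c"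
    and sm: "smooth_map A f" "smooth_map A a" "smooth_map A G" "smooth_map A b" "smooth_map A E"
  shows "dchart c (\<lambda>q. f q + a q *\<^sub>R G q + b q *\<^sub>R E q) p v
    = dchart c f p v + (a p *\<^sub>R dchart c G p v + dchart c a p v *\<^sub>R G p)
      + (b p *\<^sub>R dchart c E p v + dchart c b p v *\<^sub>R E p)"
proof -
  define x where "x = coord c p"
  have x: "x \<in> cod_chart c" using c(2) by (auto simp: x_def)
  have d: "(in_chart c k has_derivative dchart c k p) (at x)" if "smooth_map A k" for k :: "'p \<Rightarrow> 'c::real_normed_vector"
    unfolding dchart_def x_def[symmetric] by (rule smooth_on_has_derivative[OF smooth_in_chart[OF that c(1)] x])
  have v: "in_chart c k x = k p" for k :: "'p \<Rightarrow> 'c"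
    unfolding x_def by (rule in_chart_coord[OF A c])
  have "((\<lambda>y. in_chart c f y + in_chart c a y *\<^sub>R in_chart c G y + in_chart c b y *\<^sub>R in_chart c E y) has_derivative
     (\<lambda>w. dchart c f p w + (in_chart c a x *\<^sub>R dchart c G p w + dchart c a p w *\<^sub>R in_chart c G x)
       + (in_chart c b x *\<^sub>R dchart c E p w + dchart c b p w *\<^sub>R in_chart c E x))) (at x)"
    by (intro has_derivative_add has_derivative_scaleR d sm)
  moreover have "in_chart c (\<lambda>q. f q + a q *\<^sub>R G q + b q *\<^sub>R E q)
      = (\<lambda>y. in_chart c f y + in_chart c a y *\<^sub>R in_chart c G y + in_chart c b y *\<^sub>R in_chart c E y)"
    by (simp add: in_chart_def fun_eq_iff)
  ultimately have "(in_chart c (\<lambda>q. f q + a q *\<^sub>R G q + b q *\<^sub>R E q) has_derivative (\<lambda>w. dchart c f p w + (a p *\<^sub>R dchart c G p w + dchart c a p w *\<^sub>R G p)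
       + (b p *\<^sub>R dchart c E p w + dchart c b p w *\<^sub>R E p))) (at (coord c p))"
    unfolding v unfolding x_def by simp
  from frechet_derivative_at[OF this, symmetric] show ?thesis by (simp add: dchart_def)
qed

text \<open>Vanishing of the mixed second fundamental form makes \<open>D_X E\<close> tangent, and
  the bracket term, being tangent, passes this on to \<open>D_Y G\<close>. Unit length and
  orthogonality then leave a single component in each.\<close>

lemma diagonal_frame_derivatives:
  assumes A: "smooth_atlas A" and h: "immersion A h" and fr: "orthonormal_frame A h X Y"
    and diag: "\<forall>p\<in>points A. second_ff A h X Y p = 0" and p: "p \<in> points A"
  defines "G \<equiv> pushforward A h X" and "E \<equiv> pushforward A h Y"
  shows "pushforward A E X p = - (pushforward A G X p \<bullet> E p) *\<^sub>R G p"
    and "pushforward A G Y p = (pushforward A G Y p \<bullet> E p) *\<^sub>R E p"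
    and "pushforward A G X p \<bullet> G p = 0" and "pushforward A E Y p \<bullet> E p = 0"
    and "pushforward A E Y p \<bullet> G p = - (pushforward A G Y p \<bullet> E p)"
proof -
  define c where "c = chart_at A p"
  have c: "c \<in> A" "p \<in> dom_chart c" using chart_at[OF p] by (simp_all add: c_def)
  have sh: "smooth_map A h" using h by (simp add: immersion_def)
  have X: "vector_field A X" and Y: "vector_field A Y" using fr by (simp_all add: orthonormal_frame_def)
  have smG: "smooth_map A G" and smE: "smooth_map A E"
    unfolding G_def E_def by (rule smooth_map_pushforward[OF A sh X] smooth_map_pushforward[OF A sh Y])+
  have on: "G q \<bullet> G q = 1" "E q \<bullet> E q = 1" "G q \<bullet> E q = 0" if "q \<in> points A" for q
    using orthonormal_frameD(1-3)[OF A h fr chart_at[OF that]] by (simp_all add: G_def E_def)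
  have GG: "pushforward A G Z p \<bullet> G p = 0" for Z
    using pushforward_inner_const[OF A smG smG p on(1), of Z] by (simp add: inner_commute)
  have EE: "pushforward A E Z p \<bullet> E p = 0" for Z
    using pushforward_inner_const[OF A smE smE p on(2), of Z] by (simp add: inner_commute)
  have EG: "pushforward A E Z p \<bullet> G p = - (pushforward A G Z p \<bullet> E p)" for Z
    using pushforward_inner_const[OF A smG smE p on(3), of Z] by (simp add: inner_commute)
  show "pushforward A G X p \<bullet> G p = 0" "pushforward A E Y p \<bullet> E p = 0"
    "pushforward A E Y p \<bullet> G p = - (pushforward A G Y p \<bullet> E p)"
    by (rule GG EE EG)+
  have expand: "dchart c h p z = (dchart c h p z \<bullet> G p) *\<^sub>R G p + (dchart c h p z \<bullet> E p) *\<^sub>R E p" for z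
    unfolding G_def E_def by (rule orthonormal_frameD(7)[OF A h fr c])
  have EX: "pushforward A E X p = dchart c h p (levi_civita h X Y c p)"
    using bspec[OF diag p] unfolding second_ff_chart_at[OF p] E_def[symmetric] c_def[symmetric] by simp
  show "pushforward A E X p = - (pushforward A G X p \<bullet> E p) *\<^sub>R G p"
    using expand[of "levi_civita h X Y c p"] unfolding EX[symmetric] EE EG by simp
  have br: "pushforward A E X p - pushforward A G Y p = dchart c h p (lie_bracket X Y c p)"
    unfolding G_def E_def by (rule pushforward_bracket[OF A sh X Y c])
  have "pushforward A G Y p = pushforward A E X p - dchart c h p (lie_bracket X Y c p)"
    unfolding br[symmetric] by simp
  also have "\<dots> = dchart c h p (levi_civita h X Y c p - lie_bracket X Y c p)"
    unfolding EX by (rule linear_diff[OF linear_dchart[OF sh c], symmetric])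
  finally have "pushforward A G Y p = dchart c h p (levi_civita h X Y c p - lie_bracket X Y c p)" .
  then show "pushforward A G Y p = (pushforward A G Y p \<bullet> E p) *\<^sub>R E p"
    using expand[of "levi_civita h X Y c p - lie_bracket X Y c p"] GG[of Y] by simp
qed

section \<open>Flatness of the normal bundle\<close>

text \<open>The Ricci equation: both shape operators involved are diagonal in the same frame, hence commute.\<close>

lemma flat_normal_bundle_diagonal:
  fixes h :: "'p::{t2_space,second_countable_topology} \<Rightarrow> 'b::euclidean_space"
  assumes A: "smooth_atlas A" and h: "immersion A h" and fr: "orthonormal_frame A h X Y"
    and diag: "\<forall>p\<in>points A. second_ff A h X Y p = 0"
  shows "flat_normal_bundle A h"
  unfolding flat_normal_bundle_def
proof (intro allI impI ballI, elim conjE)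
  fix U V \<nu> p
  assume U: "vector_field A U" and V: "vector_field A V" and \<nu>: "normal_field A h \<nu>" and p: "p \<in> points A"
  define c where "c = chart_at A p"
  have c: "c \<in> A" "p \<in> dom_chart c" using chart_at[OF p] by (simp_all add: c_def)
  have sh: "smooth_map A h" using h by (simp add: immersion_def)
  have X: "vector_field A X" and Y: "vector_field A Y" using fr by (simp_all add: orthonormal_frame_def)
  have sm\<nu>: "smooth_map A \<nu>" using \<nu> by (simp add: normal_field_def)
  define G where "G = pushforward A h X"
  define E where "E = pushforward A h Y"
  have smG: "smooth_map A G" and smE: "smooth_map A E"
    unfolding G_def E_def by (rule smooth_map_pushforward[OF A sh X] smooth_map_pushforward[OF A sh Y])+
  have on: "G q \<bullet> G q = 1" "E q \<bullet> E q = 1" "G q \<bullet> E q = 0" if "q \<in> points A" for q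
    using orthonormal_frameD(1-3)[OF A h fr chart_at[OF that]] by (simp_all add: G_def E_def)
  define nc where "nc = (\<lambda>q v. v - (v \<bullet> G q) *\<^sub>R G q - (v \<bullet> E q) *\<^sub>R E q)"
  have T: "tangent_plane A h q = {a *\<^sub>R G q + b *\<^sub>R E q |a b. True}" if "q \<in> points A" for q
    using tangent_plane_frame[OF A h fr that] by (simp add: G_def E_def)
  have nconn: "normal_connection A h Z \<xi> q = nc q (pushforward A \<xi> Z q)" if "q \<in> points A" for Z \<xi> q
    unfolding normal_connection_def T[OF that] nc_def by (rule normal_component_frame[OF on[OF that]])
  have \<nu>G: "\<nu> q \<bullet> G q = 0" "\<nu> q \<bullet> E q = 0" if "q \<in> points A" for q
  proof -
    have "\<nu> q \<in> (tangent_plane A h q)\<^sup>\<bottom>" using \<nu> that by (simp add: normal_field_def)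
    moreover have "G q = 1 *\<^sub>R G q + 0 *\<^sub>R E q" "E q = 0 *\<^sub>R G q + 1 *\<^sub>R E q" by simp_all
    then have "G q \<in> tangent_plane A h q" "E q \<in> tangent_plane A h q" unfolding T[OF that] by blast+
    ultimately show "\<nu> q \<bullet> G q = 0" "\<nu> q \<bullet> E q = 0"
      by (auto simp: orthogonal_comp_def orthogonal_def inner_commute)
  qed
  define \<phi> where "\<phi> = (\<lambda>Z q. \<nu> q \<bullet> pushforward A G Z q)"
  define \<psi> where "\<psi> = (\<lambda>Z q. \<nu> q \<bullet> pushforward A E Z q)"
  \<comment> \<open>The normal part of the derivative of \<open>\<nu>\<close>: since
    \<open>\<nu>\<close> is orthogonal to \<open>G\<close> and \<open>E\<close>, the tangential
    coefficients are \<open>- \<phi>\<close> and \<open>- \<psi>\<close>, which no longer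
    differentiate \<open>\<nu>\<close>.\<close>
  define N where "N = (\<lambda>Z q. pushforward A \<nu> Z q + \<phi> Z q *\<^sub>R G q + \<psi> Z q *\<^sub>R E q)"
  have nN: "normal_connection A h Z \<nu> q = N Z q" if "q \<in> points A" for Z q
    using pushforward_inner_const[OF A sm\<nu> smG that \<nu>G(1), of Z] pushforward_inner_const[OF A sm\<nu> smE that \<nu>G(2), of Z]
    by (simp add: nconn[OF that] nc_def N_def \<phi>_def \<psi>_def)
  have nclin: "linear (nc p)"
    unfolding nc_def by (rule linearI) (simp_all add: inner_add_left scaleR_add_left scaleR_diff_right)
  have ncG: "nc p (G p) = 0" "nc p (E p) = 0"
    using on[OF p] by (simp_all add: nc_def inner_commute)
  \<comment> \<open>Derivatives of \<open>\<phi>\<close> and \<open>\<psi>\<close> multiply the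
    tangent vectors \<open>G\<close> and \<open>E\<close> and are killed by the projection.\<close>
  have second: "normal_connection A h W (normal_connection A h Z \<nu>) p
      = nc p (pushforward A (pushforward A \<nu> Z) W p) + \<phi> Z p *\<^sub>R nc p (pushforward A G W p) + \<psi> Z p *\<^sub>R nc p (pushforward A E W p)"
    if Z: "vector_field A Z" for Z W
  proof -
    have sm: "smooth_map A (\<phi> Z)" "smooth_map A (\<psi> Z)"
      unfolding \<phi>_def \<psi>_def
      by (intro smooth_map_inner[OF A] sm\<nu> smooth_map_pushforward[OF A _ Z] smG smE)+
    have "pushforward A (normal_connection A h Z \<nu>) W p = pushforward A (N Z) W p"
      by (rule pushforward_cong[OF A p nN])
    also have "\<dots> = dchart c (N Z) p (W c p)" by (simp add: pushforward_chart_at c_def)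
    also have "\<dots> = pushforward A (pushforward A \<nu> Z) W p
        + (\<phi> Z p *\<^sub>R pushforward A G W p + dchart c (\<phi> Z) p (W c p) *\<^sub>R G p)
        + (\<psi> Z p *\<^sub>R pushforward A E W p + dchart c (\<psi> Z) p (W c p) *\<^sub>R E p)"
      unfolding N_def dchart_add_scale[OF A c smooth_map_pushforward[OF A sm\<nu> Z] sm(1) smG sm(2) smE]
      by (simp add: pushforward_chart_at c_def)
    finally show ?thesis
      by (simp add: nconn[OF p] linear_add[OF nclin] linear_scale[OF nclin] ncG)
  qed
  note D = diagonal_frame_derivatives[OF A h fr diag p, folded G_def E_def]
  have ncD: "nc p (pushforward A E X p) = 0" "nc p (pushforward A G Y p) = 0"
    by (subst D(1), simp add: linear_neg[OF nclin] linear_scale[OF nclin] ncG)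
      (subst D(2), simp add: linear_scale[OF nclin] ncG)
  have \<nu>D: "\<nu> p \<bullet> pushforward A E X p = 0" "\<nu> p \<bullet> pushforward A G Y p = 0"
    by (subst D(1), simp add: \<nu>G[OF p]) (subst D(2), simp add: \<nu>G[OF p])
  have split: "\<exists>a b. \<forall>k :: 'p \<Rightarrow> 'b. smooth_map A k \<longrightarrow> pushforward A k Z p = a *\<^sub>R pushforward A k X p + b *\<^sub>R pushforward A k Y p" for Z
  proof -
    define a where "a = det2 (Z c p) (Y c p) / det2 (X c p) (Y c p)"
    define b where "b = det2 (X c p) (Z c p) / det2 (X c p) (Y c p)"
    have Z: "Z c p = a *\<^sub>R X c p + b *\<^sub>R Y c p"
      unfolding a_def b_def by (rule det2_expand[OF orthonormal_frameD(6)[OF A h fr c]])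
    have "pushforward A k Z p = a *\<^sub>R pushforward A k X p + b *\<^sub>R pushforward A k Y p" if "smooth_map A k" for k :: "'p \<Rightarrow> 'b"
      unfolding pushforward_chart_at c_def[symmetric] Z
        linear_add[OF linear_dchart[OF that c]] linear_scale[OF linear_dchart[OF that c]] ..
    then show ?thesis by (intro exI allI impI)
  qed
  obtain u1 u2 where u: "\<forall>k :: 'p \<Rightarrow> 'b. smooth_map A k \<longrightarrow> pushforward A k U p = u1 *\<^sub>R pushforward A k X p + u2 *\<^sub>R pushforward A k Y p"
    using split[of U] by (elim exE)
  note u = u[rule_format]
  obtain v1 v2 where v: "\<forall>k :: 'p \<Rightarrow> 'b. smooth_map A k \<longrightarrow> pushforward A k V p = v1 *\<^sub>R pushforward A k X p + v2 *\<^sub>R pushforward A k Y p"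
    using split[of V] by (elim exE)
  note v = v[rule_format]
  have bracket: "pushforward A (pushforward A \<nu> V) U p - pushforward A (pushforward A \<nu> U) V p = pushforward A \<nu> (lie_bracket U V) p"
    unfolding pushforward_bracket[OF A sm\<nu> U V c] by (simp add: pushforward_chart_at[of A \<nu> "lie_bracket U V"] c_def)
  have "normal_connection A h (lie_bracket U V) \<nu> p
      = nc p (pushforward A (pushforward A \<nu> V) U p) - nc p (pushforward A (pushforward A \<nu> U) V p)"
    unfolding nconn[OF p] bracket[symmetric] by (rule linear_diff[OF nclin])
  \<comment> \<open>As \<open>D_X E\<close> and \<open>D_Y G\<close> have no normal part, the
    remaining coefficients are the products \<open>u1 v1\<close> and \<open>u2 v2\<close>, which are
    symmetric in \<open>U\<close> and \<open>V\<close>.\<close>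
  then show "normal_curvature A h U V \<nu> p = 0"
    unfolding normal_curvature_def second[OF U] second[OF V] \<phi>_def \<psi>_def u[OF smG] u[OF smE] v[OF smG] v[OF smE]
    by (simp add: linear_add[OF nclin] linear_scale[OF nclin] ncD \<nu>D inner_add_right mult.commute mult.left_commute)
qed

section \<open>From \<open>h\<close> to the surface of type D\<close>

lemma vector_field_scale:
  assumes A: "smooth_atlas A" and \<phi>: "smooth_map A \<phi>" and Y: "vector_field A Y"
  shows "vector_field A (\<lambda>c p. \<phi> p *\<^sub>R Y c p)"
  unfolding vector_field_def
proof (intro conjI ballI)
  fix c assume c: "c \<in> A"
  show "smooth_on (in_chart c (\<lambda>p. \<phi> p *\<^sub>R Y c p)) (cod_chart c)"
    using smooth_on_scaleR[OF smooth_atlasD(2)[OF A c] smooth_in_chart[OF \<phi> c] smooth_field_in_chart[OF Y c]]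
    by (simp add: in_chart_def o_def)
  fix d p assume d: "d \<in> A" and p: "p \<in> dom_chart c \<inter> dom_chart d"
  have lin: "linear (frechet_derivative (coord d \<circ> inv_chart c) (at (coord c p)))"
    by (rule smooth_on_linear_derivative[OF smooth_transition[OF A c d]]) (use p in blast)
  have "Y d p = frechet_derivative (coord d \<circ> inv_chart c) (at (coord c p)) (Y c p)"
    using Y c d p unfolding vector_field_def by blast
  then show "\<phi> p *\<^sub>R Y d p = frechet_derivative (coord d \<circ> inv_chart c) (at (coord c p)) (\<phi> p *\<^sub>R Y c p)"
    unfolding linear_scale[OF lin] by (rule arg_cong)
qed

lemma pushforward_scale:
  assumes "smooth_map A f" "p \<in> points A"
  shows "pushforward A f (\<lambda>c p. \<phi> p *\<^sub>R Y c p) p = \<phi> p *\<^sub>R pushforward A f Y p"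
  unfolding pushforward_chart_at by (rule linear_scale[OF linear_dchart[OF assms(1) chart_at[OF assms(2)]]])

lemma levi_civita_eq_0:
  assumes A: "smooth_atlas A" and f: "immersion A f" and X: "vector_field A X" and Y: "vector_field A Y"
    and c: "c \<in> A" "p \<in> dom_chart c"
    and "\<And>z. pushforward A (pushforward A f Y) X p \<bullet> dchart c f p z = 0"
  shows "levi_civita f X Y c p = 0"
proof -
  have "dchart c f p (levi_civita f X Y c p) \<bullet> dchart c f p (levi_civita f X Y c p) = 0"
    using levi_civita_inner[OF A f X Y c] assms(7) by simp
  then show ?thesis using dchart_eq_0_iff[OF f c] by simp
qed

lemma levi_civita_nonzero:
  assumes A: "smooth_atlas A" and f: "immersion A f" and X: "vector_field A X" and Y: "vector_field A Y"
    and c: "c \<in> A" "p \<in> dom_chart c"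
    and "pushforward A (pushforward A f Y) X p \<bullet> dchart c f p z \<noteq> 0"
  shows "levi_civita f X Y c p \<noteq> 0"
proof
  assume "levi_civita f X Y c p = 0"
  then have "dchart c f p (levi_civita f X Y c p) = 0" using dchart_eq_0_iff[OF f c] by simp
  then show False using levi_civita_inner[OF A f X Y c, of z] assms(7) by simp
qed

lemma immersion_of_independent:
  fixes f :: "'p::{t2_space,second_countable_topology} \<Rightarrow> 'b::euclidean_space"
  assumes f: "smooth_map A f"
    and det: "\<And>c p. c \<in> A \<Longrightarrow> p \<in> dom_chart c \<Longrightarrow> det2 (X c p) (Y c p) \<noteq> 0"
    and ind: "\<And>c p a b. c \<in> A \<Longrightarrow> p \<in> dom_chart c \<Longrightarrow>
        a *\<^sub>R dchart c f p (X c p) + b *\<^sub>R dchart c f p (Y c p) = 0 \<Longrightarrow> a = 0 \<and> b = 0"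
  shows "immersion A f"
  unfolding immersion_def
proof (intro conjI ballI f)
  fix c p assume c: "c \<in> A" "p \<in> dom_chart c"
  have lin: "linear (dchart c f p)" by (rule linear_dchart[OF f c])
  have "z = 0" if z: "dchart c f p z = 0" for z
  proof -
    define a where "a = det2 z (Y c p) / det2 (X c p) (Y c p)"
    define b where "b = det2 (X c p) z / det2 (X c p) (Y c p)"
    have ab: "z = a *\<^sub>R X c p + b *\<^sub>R Y c p" unfolding a_def b_def by (rule det2_expand[OF det[OF c]])
    have "a *\<^sub>R dchart c f p (X c p) + b *\<^sub>R dchart c f p (Y c p) = dchart c f p (a *\<^sub>R X c p + b *\<^sub>R Y c p)"
      by (simp only: linear_add[OF lin] linear_scale[OF lin])
    then have "a = 0 \<and> b = 0" using ind[OF c, of a b] z ab by simp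
    then show ?thesis using ab by simp
  qed
  then show "inj (frechet_derivative (in_chart c f) (at (coord c p)))"
    using linear_injective_0[OF lin] by (simp add: dchart_def)
qed

text \<open>The three assumptions on the curves enter separately: \<open>a \<noteq> 0\<close> is the
  angle condition, \<open>\<beta> \<noteq> 0\<close> permits the normalization of \<open>Y\<close>,
  and a nonasymptotic \<open>X\<close> keeps the derivative of \<open>G\<close> along
  \<open>X\<close> from being parallel to \<open>E\<close>, so that \<open>G\<close> is an
  immersion.\<close>

theorem type_D_of_generating_data:
  fixes h :: "'p::{t2_space,second_countable_topology} \<Rightarrow> 'b::euclidean_space"
  assumes A: "smooth_atlas A" and gd: "generating_data A h X Y"
  shows "type_D A (pushforward A h X)"
proof -
  have h: "immersion A h" and fr: "orthonormal_frame A h X Y"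
    and diag: "\<forall>p\<in>points A. second_ff A h X Y p = 0"
    and nXX: "\<And>c p. c \<in> A \<Longrightarrow> p \<in> dom_chart c \<Longrightarrow> levi_civita h X X c p \<noteq> 0"
    and nYY: "\<And>c p. c \<in> A \<Longrightarrow> p \<in> dom_chart c \<Longrightarrow> levi_civita h Y Y c p \<noteq> 0"
    and nas: "\<And>p. p \<in> points A \<Longrightarrow> second_ff A h X X p \<noteq> 0"
    using gd by (auto simp: generating_data_def nowhere_vanishing_def)
  have sh: "smooth_map A h" using h by (simp add: immersion_def)
  have X: "vector_field A X" and Y: "vector_field A Y" using fr by (simp_all add: orthonormal_frame_def)
  define G where "G = pushforward A h X"
  define E where "E = pushforward A h Y"
  have smG: "smooth_map A G" and smE: "smooth_map A E"
    unfolding G_def E_def by (rule smooth_map_pushforward[OF A sh X] smooth_map_pushforward[OF A sh Y])+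
  have on: "G q \<bullet> G q = 1" "E q \<bullet> E q = 1" "G q \<bullet> E q = 0" if "q \<in> points A" for q
    using orthonormal_frameD(1-3)[OF A h fr chart_at[OF that]] by (simp_all add: G_def E_def)
  have expand: "dchart c h p z = (dchart c h p z \<bullet> G p) *\<^sub>R G p + (dchart c h p z \<bullet> E p) *\<^sub>R E p"
    if "c \<in> A" "p \<in> dom_chart c" for c p z
    unfolding G_def E_def by (rule orthonormal_frameD(7)[OF A h fr that])
  have DX: "dchart c h p (X c p) = G p" and DY: "dchart c h p (Y c p) = E p"
    if "c \<in> A" "p \<in> dom_chart c" for c p
    unfolding G_def E_def by (rule orthonormal_frameD(4,5)[OF A h fr that])+
  note D = diagonal_frame_derivatives[OF A h fr diag, folded G_def E_def]
  define a where "a = (\<lambda>p. pushforward A G X p \<bullet> E p)"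
  define \<beta> where "\<beta> = (\<lambda>p. pushforward A G Y p \<bullet> E p)"
  have inpts: "p \<in> points A" if "c \<in> A" "p \<in> dom_chart c" for c p using that by (auto simp: points_def)
  have a0: "a p \<noteq> 0" if p: "p \<in> points A" for p
  proof
    assume "a p = 0"
    note c = chart_at[OF p]
    have "levi_civita h X X (chart_at A p) p = 0"
    proof (rule levi_civita_eq_0[OF A h X X c])
      show "pushforward A (pushforward A h X) X p \<bullet> dchart (chart_at A p) h p z = 0" for z
        unfolding G_def[symmetric]
        by (subst expand[OF c]) (use \<open>a p = 0\<close> D(3)[OF p] in \<open>simp add: inner_add_right a_def\<close>)
    qed
    then show False using nXX[OF c] by simp
  qed
  have \<beta>0: "\<beta> p \<noteq> 0" if p: "p \<in> points A" for p
  proof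
    assume "\<beta> p = 0"
    note c = chart_at[OF p]
    have "levi_civita h Y Y (chart_at A p) p = 0"
    proof (rule levi_civita_eq_0[OF A h Y Y c])
      show "pushforward A (pushforward A h Y) Y p \<bullet> dchart (chart_at A p) h p z = 0" for z
        unfolding E_def[symmetric]
        by (subst expand[OF c]) (use \<open>\<beta> p = 0\<close> D(4,5)[OF p] in \<open>simp add: inner_add_right \<beta>_def\<close>)
    qed
    then show False using nYY[OF c] by simp
  qed
  \<comment> \<open>Otherwise the derivative of \<open>G\<close> along \<open>X\<close> would be
    tangent to \<open>h\<close>, and \<open>X\<close> would be asymptotic.\<close>
  have nas': "pushforward A G X p \<noteq> s *\<^sub>R E p" if p: "p \<in> points A" for p s
  proof
    assume eq: "pushforward A G X p = s *\<^sub>R E p"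
    note c = chart_at[OF p]
    have "s *\<^sub>R E p = dchart (chart_at A p) h p (s *\<^sub>R Y (chart_at A p) p)"
      using DY[OF c] linear_scale[OF linear_dchart[OF sh c]] by simp
    then have w: "pushforward A (pushforward A h X) X p = dchart (chart_at A p) h p (s *\<^sub>R Y (chart_at A p) p)"
      using eq by (simp add: G_def)
    have "second_ff A h X X p = 0"
      unfolding second_ff_chart_at[OF p] levi_civita_tangential[OF A h X X c w] by simp
    then show False using nas[OF p] by simp
  qed
  define Yg where "Yg = (\<lambda>c p. (1 / \<beta> p) *\<^sub>R Y c p)"
  have sm\<beta>: "smooth_map A (\<lambda>p. 1 / \<beta> p)"
    unfolding smooth_map_def
  proof
    fix c assume c: "c \<in> A"
    note cc = smooth_atlasD(2)[OF A c]
    have "smooth_map A \<beta>"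
      unfolding \<beta>_def by (rule smooth_map_inner[OF A smooth_map_pushforward[OF A smG Y] smE])
    then have "smooth_on (\<lambda>x. 1 / in_chart c \<beta> x) (cod_chart c)"
      using smooth_atlasD(5)[OF A c] inpts[OF c] \<beta>0
      by (intro smooth_on_divide[OF cc smooth_on_const[OF cc] smooth_in_chart[OF _ c]]) (auto simp: in_chart_def)
    then show "smooth_on (in_chart c (\<lambda>p. 1 / \<beta> p)) (cod_chart c)" by (simp add: in_chart_def o_def)
  qed
  have Yg: "vector_field A Yg" unfolding Yg_def by (rule vector_field_scale[OF A sm\<beta> Y])
  have GX: "dchart c G p (X c p) = pushforward A G X p" and GY: "dchart c G p (Y c p) = \<beta> p *\<^sub>R E p"
    if c: "c \<in> A" "p \<in> dom_chart c" for c p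
    using pushforward_eq[OF A smG X c] pushforward_eq[OF A smG Y c] D(2)[OF inpts[OF c]]
    by (simp_all add: \<beta>_def)
  have gYg: "pushforward A G Yg p = E p" if p: "p \<in> points A" for p
  proof -
    have "pushforward A G Yg p = (1 / \<beta> p) *\<^sub>R pushforward A G Y p"
      unfolding Yg_def by (rule pushforward_scale[OF smG p])
    also have "pushforward A G Y p = \<beta> p *\<^sub>R E p" using D(2)[OF p] by (simp add: \<beta>_def)
    finally show ?thesis using \<beta>0[OF p] by simp
  qed
  have imm: "immersion A G"
  proof (rule immersion_of_independent[OF smG, where X=X and Y=Y])
    show "det2 (X c p) (Y c p) \<noteq> 0" if "c \<in> A" "p \<in> dom_chart c" for c p
      by (rule orthonormal_frameD(6)[OF A h fr that])
    fix c p s t assume c: "c \<in> A" "p \<in> dom_chart c" and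
      eq: "s *\<^sub>R dchart c G p (X c p) + t *\<^sub>R dchart c G p (Y c p) = 0"
    note p = inpts[OF c]
    have eq': "s *\<^sub>R pushforward A G X p + (t * \<beta> p) *\<^sub>R E p = 0"
      using eq unfolding GX[OF c] GY[OF c] by simp
    have "s = 0"
    proof (rule ccontr)
      assume "s \<noteq> 0"
      have "s *\<^sub>R pushforward A G X p = (- (t * \<beta> p)) *\<^sub>R E p"
        using eq' by (simp add: add_eq_0_iff2)
      then have "inverse s *\<^sub>R (s *\<^sub>R pushforward A G X p) = inverse s *\<^sub>R ((- (t * \<beta> p)) *\<^sub>R E p)" by simp
      then have "pushforward A G X p = (inverse s * (- (t * \<beta> p))) *\<^sub>R E p" using \<open>s \<noteq> 0\<close> by simp
      then show False using nas'[OF p] by blast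
    qed
    moreover have "E p \<noteq> 0" using on(2)[OF p] by auto
    ultimately show "s = 0 \<and> t = 0" using eq' \<beta>0[OF p] by simp
  qed
  \<comment> \<open>The position vector is orthogonal to the tangent plane of the surface
    \<open>G\<close>. A radial derivative therefore contributes neither to the connection nor to the
    second fundamental form in the sphere.\<close>
  have tang: "G p \<bullet> dchart c G p z = 0" if c: "c \<in> A" "p \<in> dom_chart c" for c p z
  proof -
    have lin: "linear (dchart c G p)" by (rule linear_dchart[OF smG c])
    have "dchart c G p z = (det2 z (Y c p) / det2 (X c p) (Y c p)) *\<^sub>R pushforward A G X p
        + (det2 (X c p) z / det2 (X c p) (Y c p)) *\<^sub>R (\<beta> p *\<^sub>R E p)"
      by (subst det2_expand[OF orthonormal_frameD(6)[OF A h fr c], of z])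
        (simp only: linear_add[OF lin] linear_scale[OF lin] GX[OF c] GY[OF c])
    then show ?thesis
      using D(3)[OF inpts[OF c]] on(3)[OF inpts[OF c]] by (simp add: inner_add_right inner_commute)
  qed
  have second: "pushforward A (pushforward A G Yg) X p = - a p *\<^sub>R G p" if p: "p \<in> points A" for p
    using pushforward_cong[OF A p gYg, where X=X] D(1)[OF p] by (simp add: a_def)
  have LC: "levi_civita G X Yg c p = 0" if c: "c \<in> A" "p \<in> dom_chart c" for c p
    by (rule levi_civita_eq_0[OF A imm X Yg c]) (simp add: second[OF inpts[OF c]] tang[OF c])
  have "type_D A G"
    unfolding type_D_def
  proof (intro conjI, rule imm, goal_cases)
    case 1
    show "G ` points A \<subseteq> sphere 0 1" using on(1) by (auto simp: norm_eq_sqrt_inner)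
  next
    case 2
    have li: "linearly_independent A X Yg"
      unfolding linearly_independent_def
    proof (intro ballI allI impI)
      fix c p s t assume c: "c \<in> A" "p \<in> dom_chart c" and "s *\<^sub>R X c p + t *\<^sub>R Yg c p = 0"
      then have "s *\<^sub>R X c p + (t / \<beta> p) *\<^sub>R Y c p = 0" by (simp add: Yg_def)
      from orthonormal_independent[OF linear_dchart[OF sh c] _ _ _ this]
      show "s = 0 \<and> t = 0" using on[OF inpts[OF c]] \<beta>0[OF inpts[OF c]] by (simp add: DX[OF c] DY[OF c])
    qed
    have "\<forall>p\<in>points A. norm (pushforward A G Yg p) = 1"
      using gYg on(2) by (simp add: norm_eq_sqrt_inner)
    moreover have "\<forall>p\<in>points A. induced_inner A G X Yg p \<noteq> 0"
      using a0 gYg by (simp add: induced_inner_def a_def)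
    moreover have "vanishing A (levi_civita G X Yg)"
      unfolding vanishing_def using LC by blast
    moreover have "\<forall>p\<in>points A. sphere_second_ff A G X Yg p = 0"
    proof
      fix p assume p: "p \<in> points A"
      have "pushforward A G (levi_civita G X Yg) p = 0"
        unfolding pushforward_chart_at LC[OF chart_at[OF p]]
        by (rule linear_0[OF linear_dchart[OF smG chart_at[OF p]]])
      then show "sphere_second_ff A G X Yg p = 0"
        using on(1)[OF p] by (simp add: sphere_second_ff_def Let_def second[OF p])
    qed
    ultimately show ?case using X Yg li by blast
  qed
  then show ?thesis by (simp add: G_def)
qed

section \<open>Restriction to a coordinate neighbourhood\<close>

lemma restrict_atlasE:
  assumes "c \<in> restrict_atlas A U"
  obtains b where "b \<in> A" "c = (dom_chart b \<inter> U, coord b)"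
  using assms by (auto simp: restrict_atlas_def)

text \<open>\<open>inv_chart\<close> is an \<open>inv_into\<close> and so depends on the domain as
  well as on the map; injectivity reconciles the two.\<close>

lemma inv_chart_restrict:
  assumes A: "smooth_atlas A" and b: "b \<in> A" and x: "x \<in> coord b ` (dom_chart b \<inter> U)"
  shows "inv_chart (dom_chart b \<inter> U, coord b) x = inv_chart b x"
proof -
  obtain p where p: "p \<in> dom_chart b \<inter> U" "x = coord b p" using x by blast
  have "inj_on (coord b) (dom_chart b)"
    using smooth_atlasD(4)[OF A b] by (metis inj_on_inverseI)
  then have "inj_on (coord b) (dom_chart b \<inter> U)" by (rule inj_on_subset) blast
  then show ?thesis
    using p smooth_atlasD(4)[OF A b, of p] by (simp add: inv_chart_def inv_into_f_f)
qed

lemma smooth_atlas_restrict: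
  assumes A: "smooth_atlas A" and U: "open U"
  shows "smooth_atlas (restrict_atlas A U)"
  unfolding smooth_atlas_def
proof (intro conjI ballI)
  fix c assume "c \<in> restrict_atlas A U"
  then obtain b where b: "b \<in> A" and c: "c = (dom_chart b \<inter> U, coord b)" by (rule restrict_atlasE)
  show "open (dom_chart c)" using smooth_atlasD(1)[OF A b] U by (simp add: c open_Int)
  show "open (cod_chart c)" using open_coord_image[OF A b U] by (simp add: c)
  have "homeomorphism (dom_chart b \<inter> U) (coord b ` (dom_chart b \<inter> U)) (coord b) (inv_chart b)"
    by (rule homeomorphism_of_subsets[OF smooth_atlasD(3)[OF A b]]) auto
  then have "homeomorphism (dom_chart b \<inter> U) (coord b ` (dom_chart b \<inter> U)) (coord b) (inv_chart c)"
    by (rule homeomorphism_cong) (use inv_chart_restrict[OF A b, of _ U] in \<open>simp_all add: c\<close>)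
  then show "homeomorphism (dom_chart c) (cod_chart c) (coord c) (inv_chart c)"
    by (simp add: c)
next
  fix c d assume "c \<in> restrict_atlas A U" "d \<in> restrict_atlas A U"
  then obtain b e where b: "b \<in> A" and c: "c = (dom_chart b \<inter> U, coord b)"
    and e: "e \<in> A" and d: "d = (dom_chart e \<inter> U, coord e)"
    by (metis restrict_atlasE)
  define N where "N = coord b ` (dom_chart b \<inter> (dom_chart e \<inter> U))"
  have N: "open N"
    unfolding N_def by (rule open_coord_image[OF A b open_Int[OF smooth_atlasD(1)[OF A e] U]])
  have "smooth_on (coord e \<circ> inv_chart b) N"
    by (rule smooth_on_subset[OF smooth_transition[OF A b e]]) (auto simp: N_def)
  moreover have "(coord d \<circ> inv_chart c) x = (coord e \<circ> inv_chart b) x" if "x \<in> N" for x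
    using inv_chart_restrict[OF A b, of x U] that by (auto simp: N_def c d)
  ultimately have "smooth_on (coord d \<circ> inv_chart c) N"
    using smooth_on_cong[OF N, of "coord d \<circ> inv_chart c" "coord e \<circ> inv_chart b"] by blast
  moreover have "coord c ` (dom_chart c \<inter> dom_chart d) = N" by (auto simp: N_def c d)
  ultimately show "smooth_on (coord d \<circ> inv_chart c) (coord c ` (dom_chart c \<inter> dom_chart d))" by simp
qed

text \<open>Only meaningful at points of the domain of \<open>c\<close>, where \<open>\<zeta>\<close> gives the components in that chart.\<close>

definition lift_field :: "'p chart \<Rightarrow> (real^2 \<Rightarrow> real^2) \<Rightarrow> 'p vfield" where
  "lift_field c \<zeta> = (\<lambda>d p. frechet_derivative (coord d \<circ> inv_chart c) (at (coord c p)) (\<zeta> (coord c p)))"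

lemma lift_field_self:
  assumes A: "smooth_atlas A" and c: "c \<in> A" "p \<in> dom_chart c"
  shows "lift_field c \<zeta> c p = \<zeta> (coord c p)"
proof -
  have "frechet_derivative (coord c \<circ> inv_chart c) (at (coord c p)) = frechet_derivative (\<lambda>x. x) (at (coord c p))"
    by (rule frechet_derivative_cong[OF smooth_atlasD(2)[OF A c(1)]])
      (use c(2) smooth_atlasD(6)[OF A c(1)] in \<open>simp_all add: o_def\<close>)
  also have "\<dots> = (\<lambda>x. x)" by (rule frechet_derivative_at[OF has_derivative_ident, symmetric])
  finally show ?thesis by (simp add: lift_field_def)
qed

text \<open>The transformation law is the chain rule for transitions through the chart
  \<open>c\<close>. As \<open>c\<close> covers all points, components prescribed there determine the
  field everywhere.\<close>

lemma vector_field_lift: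
  assumes A: "smooth_atlas A" and c: "c \<in> A" "points A \<subseteq> dom_chart c" and \<zeta>: "smooth_on \<zeta> (cod_chart c)"
  shows "vector_field A (lift_field c \<zeta>)"
  unfolding vector_field_def
proof (intro conjI ballI)
  fix d assume d: "d \<in> A"
  have sub: "dom_chart d \<subseteq> dom_chart c" using dom_chart_subset_points[OF d] c(2) by blast
  define N where "N = coord c ` (dom_chart c \<inter> dom_chart d)"
  have N: "open N" "N \<subseteq> cod_chart c" unfolding N_def using open_overlap[OF A c(1) d] by auto
  have cod: "coord d ` (dom_chart d \<inter> dom_chart c) = cod_chart d" using sub by blast
  have k: "smooth_on (\<lambda>y. frechet_derivative (coord d \<circ> inv_chart c) (at y) (\<zeta> y)) N"
    by (rule smooth_on_frechet[OF N(1)])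
      (use smooth_transition[OF A c(1) d] smooth_on_subset[OF \<zeta> N(2)] in \<open>simp_all add: N_def\<close>)
  have "smooth_on (coord c \<circ> inv_chart d) (cod_chart d)"
    using smooth_transition[OF A d c(1)] unfolding cod .
  from smooth_on_compose[OF smooth_atlasD(2)[OF A d] this k]
  have "smooth_on (\<lambda>x. frechet_derivative (coord d \<circ> inv_chart c) (at ((coord c \<circ> inv_chart d) x)) (\<zeta> ((coord c \<circ> inv_chart d) x))) (cod_chart d)"
    using smooth_atlasD(5)[OF A d] sub by (force simp: N_def)
  then show "smooth_on (in_chart d (lift_field c \<zeta> d)) (cod_chart d)"
    by (simp add: in_chart_def lift_field_def o_def)
next
  fix d e p assume d: "d \<in> A" and e: "e \<in> A" and p: "p \<in> dom_chart d \<inter> dom_chart e"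
  have pc: "p \<in> dom_chart c" using p d c(2) by (auto simp: points_def)
  define N where "N = coord c ` (dom_chart c \<inter> (dom_chart d \<inter> dom_chart e))"
  have N: "open N" "coord c p \<in> N"
    unfolding N_def using open_coord_image[OF A c(1) open_Int[OF smooth_atlasD(1)[OF A d] smooth_atlasD(1)[OF A e]]] p pc
    by auto
  have "frechet_derivative (coord e \<circ> inv_chart c) (at (coord c p))
      = frechet_derivative (\<lambda>x. (coord e \<circ> inv_chart d) ((coord d \<circ> inv_chart c) x)) (at (coord c p))"
    by (rule frechet_derivative_cong[OF N])
      (auto simp: N_def smooth_atlasD(4)[OF A c(1)] smooth_atlasD(4)[OF A d])
  then have "frechet_derivative (coord e \<circ> inv_chart c) (at (coord c p)) v
      = frechet_derivative (coord e \<circ> inv_chart d) (at ((coord d \<circ> inv_chart c) (coord c p)))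
          (frechet_derivative (coord d \<circ> inv_chart c) (at (coord c p)) v)" for v
    using smooth_on_frechet_chain[OF smooth_transition[OF A c(1) d] smooth_transition[OF A d e], of "coord c p" v]
      p pc smooth_atlasD(4)[OF A c(1) pc] by simp
  then show "lift_field c \<zeta> e p = frechet_derivative (coord e \<circ> inv_chart d) (at (coord d p)) (lift_field c \<zeta> d p)"
    unfolding transition_coord[OF A c(1) pc] lift_field_def by simp
qed

lemma smooth_map_of_chart:
  assumes A: "smooth_atlas A" and c: "c \<in> A" "points A \<subseteq> dom_chart c" and F: "smooth_on F (cod_chart c)"
  shows "smooth_map A (\<lambda>p. F (coord c p))"
  unfolding smooth_map_def
proof
  fix d assume d: "d \<in> A"
  have sub: "dom_chart d \<subseteq> dom_chart c" using dom_chart_subset_points[OF d] c(2) by blast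
  have cod: "coord d ` (dom_chart d \<inter> dom_chart c) = cod_chart d" using sub by blast
  have "smooth_on (coord c \<circ> inv_chart d) (cod_chart d)"
    using smooth_transition[OF A d c(1)] unfolding cod .
  from smooth_on_compose[OF smooth_atlasD(2)[OF A d] this F]
  have "smooth_on (\<lambda>x. F ((coord c \<circ> inv_chart d) x)) (cod_chart d)"
    using smooth_atlasD(5)[OF A d] sub by force
  then show "smooth_on (in_chart d (\<lambda>p. F (coord c p))) (cod_chart d)" by (simp add: in_chart_def o_def)
qed

lemma pushforward_of_chart:
  assumes A: "smooth_atlas A" and c: "c \<in> A" "points A \<subseteq> dom_chart c" and F: "smooth_on F (cod_chart c)"
    and \<zeta>: "smooth_on \<zeta> (cod_chart c)" and p: "p \<in> dom_chart c"
  shows "pushforward A (\<lambda>p. F (coord c p)) (lift_field c \<zeta>) p = frechet_derivative F (at (coord c p)) (\<zeta> (coord c p))"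
proof -
  have "dchart c (\<lambda>p. F (coord c p)) p = frechet_derivative F (at (coord c p))"
    unfolding dchart_def
    by (rule frechet_derivative_cong[OF smooth_atlasD(2)[OF A c(1)]])
      (use p smooth_atlasD(6)[OF A c(1)] in \<open>simp_all add: in_chart_def\<close>)
  then show ?thesis
    using pushforward_eq[OF A smooth_map_of_chart[OF A c F] vector_field_lift[OF A c \<zeta>] c(1) p]
      lift_field_self[OF A c(1) p, of \<zeta>] by simp
qed

section \<open>From a surface of type D back to \<open>h\<close>\<close>

text \<open>The frame is \<open>\<xi> / p\<close> and \<open>\<eta> / q\<close>, along which
  \<open>H\<close> has derivatives \<open>g\<close> and \<open>e\<close>. The geodesic curvatures
  come out as \<open>m / p\<close> and, up to sign, \<open>1 / q\<close>, both nonzero; the last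
  hypothesis excludes that the derivative of \<open>g\<close> along \<open>\<xi>\<close> is tangent
  to the new surface.\<close>

lemma generating_data_of_primitive:
  fixes g e H :: "real^2 \<Rightarrow> 'b::euclidean_space" and c :: "('p::{t2_space,second_countable_topology}) chart"
  assumes A: "smooth_atlas A" and c: "c \<in> A" "points A \<subseteq> dom_chart c" and S: "S = cod_chart c"
    and sm: "smooth_on \<xi> S" "smooth_on \<eta> S" "smooth_on g S" "smooth_on e S" "smooth_on H S" "smooth_on p S" "smooth_on q S"
    and on: "\<And>x. x \<in> S \<Longrightarrow> g x \<bullet> g x = 1" "\<And>x. x \<in> S \<Longrightarrow> e x \<bullet> e x = 1" "\<And>x. x \<in> S \<Longrightarrow> g x \<bullet> e x = 0"
    and nz: "\<And>x. x \<in> S \<Longrightarrow> p x \<noteq> 0" "\<And>x. x \<in> S \<Longrightarrow> q x \<noteq> 0" "\<And>x. x \<in> S \<Longrightarrow> m x \<noteq> 0"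
    and H\<xi>: "\<And>x. x \<in> S \<Longrightarrow> frechet_derivative H (at x) (\<xi> x) = p x *\<^sub>R g x"
    and H\<eta>: "\<And>x. x \<in> S \<Longrightarrow> frechet_derivative H (at x) (\<eta> x) = q x *\<^sub>R e x"
    and g\<eta>: "\<And>x. x \<in> S \<Longrightarrow> frechet_derivative g (at x) (\<eta> x) = e x"
    and e\<xi>: "\<And>x. x \<in> S \<Longrightarrow> frechet_derivative e (at x) (\<xi> x) = - m x *\<^sub>R g x"
    and g\<xi>: "\<And>x s. x \<in> S \<Longrightarrow> frechet_derivative g (at x) (\<xi> x) \<noteq> s *\<^sub>R e x"
  obtains h X Y where "generating_data A h X Y" "\<forall>r\<in>points A. pushforward A h X r = g (coord c r)"
proof -
  have oS: "open S" unfolding S by (rule smooth_atlasD(2)[OF A c(1)])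
  define h where "h = (\<lambda>r. H (coord c r))"
  define G where "G = (\<lambda>r. g (coord c r))"
  define E where "E = (\<lambda>r. e (coord c r))"
  define X where "X = lift_field c (\<lambda>x. (1 / p x) *\<^sub>R \<xi> x)"
  define Y where "Y = lift_field c (\<lambda>x. (1 / q x) *\<^sub>R \<eta> x)"
  have sm\<zeta>: "smooth_on (\<lambda>x. (1 / p x) *\<^sub>R \<xi> x) S" "smooth_on (\<lambda>x. (1 / q x) *\<^sub>R \<eta> x) S"
    by (intro smooth_on_scaleR smooth_on_divide oS smooth_on_const sm nz; assumption)+
  have X: "vector_field A X" and Y: "vector_field A Y"
    unfolding X_def Y_def using vector_field_lift[OF A c] sm\<zeta> unfolding S by blast+
  have sh: "smooth_map A h" and sG: "smooth_map A G" and sE: "smooth_map A E"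
    unfolding h_def G_def E_def using smooth_map_of_chart[OF A c] sm(3-5) unfolding S by blast+
  have inS: "coord c r \<in> S" and rc: "r \<in> dom_chart c" if "r \<in> points A" for r
    using that c(2) by (auto simp: S)
  have push: "pushforward A (\<lambda>r. F (coord c r)) X r = (1 / p (coord c r)) *\<^sub>R frechet_derivative F (at (coord c r)) (\<xi> (coord c r))"
    "pushforward A (\<lambda>r. F (coord c r)) Y r = (1 / q (coord c r)) *\<^sub>R frechet_derivative F (at (coord c r)) (\<eta> (coord c r))"
    if F: "smooth_on F S" and r: "r \<in> points A" for F :: "real^2 \<Rightarrow> 'b" and r
  proof -
    have lin: "linear (frechet_derivative F (at (coord c r)))" by (rule smooth_on_linear_derivative[OF F inS[OF r]])
    show "pushforward A (\<lambda>r. F (coord c r)) X r = (1 / p (coord c r)) *\<^sub>R frechet_derivative F (at (coord c r)) (\<xi> (coord c r))"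
      unfolding X_def pushforward_of_chart[OF A c F[unfolded S] sm\<zeta>(1)[unfolded S] rc[OF r]]
      by (rule linear_scale[OF lin])
    show "pushforward A (\<lambda>r. F (coord c r)) Y r = (1 / q (coord c r)) *\<^sub>R frechet_derivative F (at (coord c r)) (\<eta> (coord c r))"
      unfolding Y_def pushforward_of_chart[OF A c F[unfolded S] sm\<zeta>(2)[unfolded S] rc[OF r]]
      by (rule linear_scale[OF lin])
  qed
  have hX: "pushforward A h X r = G r" and hY: "pushforward A h Y r = E r" if r: "r \<in> points A" for r
    using push[OF sm(5) r] nz[OF inS[OF r]] unfolding H\<xi>[OF inS[OF r]] H\<eta>[OF inS[OF r]]
    by (simp_all add: h_def G_def E_def)
  have GY: "pushforward A G Y r = (1 / q (coord c r)) *\<^sub>R E r"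
    and EX: "pushforward A E X r = - (m (coord c r) / p (coord c r)) *\<^sub>R G r" if r: "r \<in> points A" for r
    using push(2)[OF sm(3) r] push(1)[OF sm(4) r] unfolding g\<eta>[OF inS[OF r]] e\<xi>[OF inS[OF r]]
    by (simp_all add: G_def E_def)
  have GX: "pushforward A G X r \<noteq> s *\<^sub>R E r" if r: "r \<in> points A" for r s
  proof
    note x = inS[OF r]
    assume "pushforward A G X r = s *\<^sub>R E r"
    then have "(1 / p (coord c r)) *\<^sub>R frechet_derivative g (at (coord c r)) (\<xi> (coord c r)) = s *\<^sub>R e (coord c r)"
      using push(1)[OF sm(3) r] by (simp add: G_def E_def)
    then have "p (coord c r) *\<^sub>R ((1 / p (coord c r)) *\<^sub>R frechet_derivative g (at (coord c r)) (\<xi> (coord c r)))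
        = p (coord c r) *\<^sub>R (s *\<^sub>R e (coord c r))" by simp
    then have "frechet_derivative g (at (coord c r)) (\<xi> (coord c r)) = (p (coord c r) * s) *\<^sub>R e (coord c r)"
      using nz(1)[OF x] by simp
    then show False using g\<xi>[OF x] by blast
  qed
  have onr: "G r \<bullet> G r = 1" "E r \<bullet> E r = 1" "G r \<bullet> E r = 0" if "r \<in> points A" for r
    using on inS[OF that] by (simp_all add: G_def E_def)
  have inpts: "r \<in> points A" if "d \<in> A" "r \<in> dom_chart d" for d r using that by (auto simp: points_def)
  have dX: "dchart d h r (X d r) = G r" and dY: "dchart d h r (Y d r) = E r" if d: "d \<in> A" "r \<in> dom_chart d" for d r
    using pushforward_eq[OF A sh X d] pushforward_eq[OF A sh Y d] hX[OF inpts[OF d]] hY[OF inpts[OF d]] by simp_all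
  have imm: "immersion A h"
  proof (rule immersion_of_independent[OF sh, where X=X and Y=Y])
    fix d r a b assume d: "d \<in> A" "r \<in> dom_chart d"
    note onr = onr[OF inpts[OF d]]
    show "det2 (X d r) (Y d r) \<noteq> 0"
      by (rule det2_nonzero, rule orthonormal_independent[OF linear_dchart[OF sh d]]) (simp_all add: dX[OF d] dY[OF d] onr)
    assume "a *\<^sub>R dchart d h r (X d r) + b *\<^sub>R dchart d h r (Y d r) = 0"
    then have eq: "a *\<^sub>R G r + b *\<^sub>R E r = 0" unfolding dX[OF d] dY[OF d] .
    have "(a *\<^sub>R G r + b *\<^sub>R E r) \<bullet> G r = 0" "(a *\<^sub>R G r + b *\<^sub>R E r) \<bullet> E r = 0" unfolding eq by simp_all
    then show "a = 0 \<and> b = 0" using onr by (simp add: inner_add_left inner_add_right inner_commute)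
  qed
  have fr: "orthonormal_frame A h X Y"
    using X Y hX hY onr by (simp add: orthonormal_frame_def induced_inner_def)
  have hXX: "pushforward A (pushforward A h X) Z r = pushforward A G Z r"
    and hYY: "pushforward A (pushforward A h Y) Z r = pushforward A E Z r" if "r \<in> points A" for r Z
    using pushforward_cong[OF A that hX] pushforward_cong[OF A that hY] by simp_all
  have GXE: "pushforward A G X r \<bullet> E r = m (coord c r) / p (coord c r)" if r: "r \<in> points A" for r
    using pushforward_inner_const[OF A sG sE r onr(3), of X] onr(1)[OF r] by (simp add: EX[OF r])
  have EYG: "pushforward A E Y r \<bullet> G r = - 1 / q (coord c r)" if r: "r \<in> points A" for r
  proof -
    have "E t \<bullet> G t = 0" if "t \<in> points A" for t using onr(3)[OF that] by (simp add: inner_commute)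
    from pushforward_inner_const[OF A sE sG r this, of Y] show ?thesis using onr(2)[OF r] by (simp add: GY[OF r])
  qed
  have GXG: "pushforward A G X r \<bullet> G r = 0" if r: "r \<in> points A" for r
    using pushforward_inner_const[OF A sG sG r onr(1), of X] by (simp add: inner_commute)
  have diag: "\<forall>r\<in>points A. second_ff A h X Y r = 0"
  proof
    fix r assume r: "r \<in> points A"
    note d = chart_at[OF r]
    let ?d = "chart_at A r"
    \<comment> \<open>The derivative of \<open>E\<close> along \<open>X\<close> is a multiple of
      \<open>G\<close>, the image of \<open>X\<close>, hence tangent to \<open>h\<close>.\<close>
    have "pushforward A (pushforward A h Y) X r = dchart ?d h r ((- (m (coord c r) / p (coord c r))) *\<^sub>R X ?d r)"
      unfolding hYY[OF r] EX[OF r] linear_scale[OF linear_dchart[OF sh d]] dX[OF d] ..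
    from levi_civita_tangential[OF A imm X Y d this] show "second_ff A h X Y r = 0"
      unfolding second_ff_chart_at[OF r] by simp
  qed
  have "generating_data A h X Y"
    unfolding generating_data_def
  proof (intro conjI imm fr diag flat_normal_bundle_diagonal[OF A imm fr diag])
    show "nowhere_vanishing A (levi_civita h X X)"
      unfolding nowhere_vanishing_def
    proof (intro ballI)
      fix d r assume d: "d \<in> A" "r \<in> dom_chart d"
      note r = inpts[OF d]
      have "pushforward A (pushforward A h X) X r \<bullet> dchart d h r (Y d r) \<noteq> 0"
        unfolding dY[OF d] hXX[OF r] GXE[OF r] using nz[OF inS[OF r]] by simp
      then show "levi_civita h X X d r \<noteq> 0" by (rule levi_civita_nonzero[OF A imm X X d])
    qed
    show "nowhere_vanishing A (levi_civita h Y Y)"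
      unfolding nowhere_vanishing_def
    proof (intro ballI)
      fix d r assume d: "d \<in> A" "r \<in> dom_chart d"
      note r = inpts[OF d]
      have "pushforward A (pushforward A h Y) Y r \<bullet> dchart d h r (X d r) \<noteq> 0"
        unfolding dX[OF d] hYY[OF r] EYG[OF r] using nz[OF inS[OF r]] by simp
      then show "levi_civita h Y Y d r \<noteq> 0" by (rule levi_civita_nonzero[OF A imm Y Y d])
    qed
    show "\<forall>r\<in>points A. second_ff A h X X r \<noteq> 0"
    proof
      fix r assume r: "r \<in> points A"
      note d = chart_at[OF r]
      let ?d = "chart_at A r" and ?L = "levi_civita h X X (chart_at A r) r"
      show "second_ff A h X X r \<noteq> 0"
      proof
        assume "second_ff A h X X r = 0"
        then have L: "pushforward A G X r = dchart ?d h r ?L"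
          unfolding second_ff_chart_at[OF r] hXX[OF r] by simp
        have "dchart ?d h r ?L = (dchart ?d h r ?L \<bullet> G r) *\<^sub>R G r + (dchart ?d h r ?L \<bullet> E r) *\<^sub>R E r"
          using orthonormal_frameD(7)[OF A imm fr d, of ?L] unfolding hX[OF r] hY[OF r] .
        \<comment> \<open>Without a normal part only the \<open>E\<close> component would be left,
          since \<open>G\<close> has constant length; \<open>GX\<close> forbids this.\<close>
        then have "pushforward A G X r = (dchart ?d h r ?L \<bullet> E r) *\<^sub>R E r"
          using GXG[OF r] unfolding L by simp
        then show False using GX[OF r] by blast
      qed
    qed
  qed
  then show ?thesis using that hX by (simp add: G_def)
qed

text \<open>In a chart around \<open>p0\<close> the conditions on the two fields become the
  derivative equations required by \<open>local_primitive\<close>; \<open>U\<close> is the region on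
  which the primitive exists.\<close>

theorem generating_data_of_type_D:
  fixes g :: "'p::{t2_space,second_countable_topology} \<Rightarrow> 'b::euclidean_space"
  assumes A: "smooth_atlas A" and tD: "type_D A g" and p0: "p0 \<in> points A"
  obtains U h X Y where "open U" "p0 \<in> U" "U \<subseteq> points A" "generating_data (restrict_atlas A U) h X Y"
    "\<forall>r\<in>U. g r = pushforward (restrict_atlas A U) h X r"
proof -
  obtain X Y where imm: "immersion A g" and sphere: "g ` points A \<subseteq> sphere 0 1"
    and X: "vector_field A X" and Y: "vector_field A Y" and li: "linearly_independent A X Y"
    and unit: "\<forall>p\<in>points A. norm (pushforward A g Y p) = 1"
    and angle: "\<forall>p\<in>points A. induced_inner A g X Y p \<noteq> 0"
    and LC: "vanishing A (levi_civita g X Y)"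
    and ff: "\<forall>p\<in>points A. sphere_second_ff A g X Y p = 0"
    using tD unfolding type_D_def by blast
  have sg: "smooth_map A g" using imm by (simp add: immersion_def)
  define E where "E = pushforward A g Y"
  have sE: "smooth_map A E" unfolding E_def by (rule smooth_map_pushforward[OF A sg Y])
  have gg: "g r \<bullet> g r = 1" and EE: "E r \<bullet> E r = 1" if "r \<in> points A" for r
  proof -
    have "norm (g r) = 1" "norm (E r) = 1" using sphere unit that by (auto simp: E_def)
    then show "g r \<bullet> g r = 1" "E r \<bullet> E r = 1" by (simp_all add: power2_norm_eq_inner[symmetric])
  qed
  have gpush: "pushforward A g Z r \<bullet> g r = 0" if "r \<in> points A" for Z r
    using pushforward_inner_const[OF A sg sg that gg, of Z] by (simp add: inner_commute)
  have gE: "g r \<bullet> E r = 0" if "r \<in> points A" for r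
    using gpush[OF that, of Y] by (simp add: E_def inner_commute)
  define \<mu> where "\<mu> = (\<lambda>r. pushforward A g X r \<bullet> E r)"
  have \<mu>0: "\<mu> r \<noteq> 0" if "r \<in> points A" for r
    using angle that by (simp add: \<mu>_def E_def induced_inner_def)
  \<comment> \<open>With connection and second fundamental form both zero, only the radial part of
    the derivative survives; differentiating the orthogonality of \<open>E\<close> and
    \<open>g\<close> gives its coefficient.\<close>
  have EX: "pushforward A E X r = - \<mu> r *\<^sub>R g r" if r: "r \<in> points A" for r
  proof -
    note c = chart_at[OF r]
    have "levi_civita g X Y (chart_at A r) r = 0" using LC c by (simp add: vanishing_def)
    then have "pushforward A g (levi_civita g X Y) r = 0"
      using linear_0[OF linear_dchart[OF sg c]] by (simp add: pushforward_chart_at)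
    then have "pushforward A E X r = (pushforward A E X r \<bullet> g r) *\<^sub>R g r"
      using bspec[OF ff r] by (simp add: sphere_second_ff_def Let_def E_def)
    moreover have "pushforward A E X r \<bullet> g r = - \<mu> r"
    proof -
      have "E t \<bullet> g t = 0" if "t \<in> points A" for t using gE[OF that] by (simp add: inner_commute)
      from pushforward_inner_const[OF A sE sg r this, of X] show ?thesis by (simp add: \<mu>_def inner_commute)
    qed
    ultimately show ?thesis by simp
  qed
  define c where "c = chart_at A p0"
  have c: "c \<in> A" "p0 \<in> dom_chart c" using chart_at[OF p0] by (simp_all add: c_def)
  define V where "V = cod_chart c"
  have V: "open V" "coord c p0 \<in> V" using smooth_atlasD(2)[OF A c(1)] c(2) by (simp_all add: V_def)
  define \<xi> where "\<xi> = in_chart c (X c)"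
  define \<eta> where "\<eta> = in_chart c (Y c)"
  define g0 where "g0 = in_chart c g"
  define e0 where "e0 = in_chart c E"
  define m0 where "m0 = in_chart c \<mu>"
  have s\<mu>: "smooth_map A \<mu>"
    unfolding \<mu>_def by (rule smooth_map_inner[OF A smooth_map_pushforward[OF A sg X] sE])
  have sm: "smooth_on \<xi> V" "smooth_on \<eta> V" "smooth_on g0 V" "smooth_on e0 V" "smooth_on m0 V"
    unfolding \<xi>_def \<eta>_def g0_def e0_def m0_def V_def
    by (rule smooth_field_in_chart[OF X c(1)] smooth_field_in_chart[OF Y c(1)] smooth_in_chart[OF _ c(1)]
        sg sE s\<mu>)+
  have pt: "inv_chart c x \<in> dom_chart c" "coord c (inv_chart c x) = x" "inv_chart c x \<in> points A" if "x \<in> V" for x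
    using smooth_atlasD(5,6)[OF A c(1), of x] that c(1) by (auto simp: V_def points_def)
  have val: "\<xi> x = X c (inv_chart c x)" "\<eta> x = Y c (inv_chart c x)" "g0 x = g (inv_chart c x)"
    "e0 x = E (inv_chart c x)" "m0 x = \<mu> (inv_chart c x)" for x
    by (simp_all add: \<xi>_def \<eta>_def g0_def e0_def m0_def in_chart_def)
  have der: "frechet_derivative (in_chart c f) (at x) (\<xi> x) = pushforward A f X (inv_chart c x)"
    "frechet_derivative (in_chart c f) (at x) (\<eta> x) = pushforward A f Y (inv_chart c x)"
    if "x \<in> V" "smooth_map A f" for x and f :: "'p \<Rightarrow> 'b"
    using pushforward_eq[OF A that(2) X c(1) pt(1)[OF that(1)]] pushforward_eq[OF A that(2) Y c(1) pt(1)[OF that(1)]]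
    by (simp_all add: dchart_def pt(2)[OF that(1)] val)
  have indep: "det2 (\<xi> x) (\<eta> x) \<noteq> 0" if "x \<in> V" for x
    by (rule det2_nonzero) (use li c(1) pt(1)[OF that] in \<open>unfold linearly_independent_def val, blast\<close>)
  have g\<eta>: "frechet_derivative g0 (at x) (\<eta> x) = e0 x" if "x \<in> V" for x
  proof -
    have "frechet_derivative g0 (at x) (\<eta> x) = pushforward A g Y (inv_chart c x)"
      unfolding g0_def by (rule der(2)[OF that sg])
    then show ?thesis by (simp only: val(4) E_def)
  qed
  have e\<xi>: "frechet_derivative e0 (at x) (\<xi> x) = - m0 x *\<^sub>R g0 x" if "x \<in> V" for x
  proof -
    have "frechet_derivative e0 (at x) (\<xi> x) = pushforward A E X (inv_chart c x)"
      unfolding e0_def by (rule der(1)[OF that sE])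
    then show ?thesis by (simp only: EX[OF pt(3)[OF that]] val(3,5))
  qed
  \<comment> \<open>Parallel images would make \<open>\<xi>\<close> a multiple of
    \<open>\<eta>\<close>, by injectivity of the differential.\<close>
  have g\<xi>: "frechet_derivative g0 (at x) (\<xi> x) \<noteq> s *\<^sub>R e0 x" if x: "x \<in> V" for x s
  proof
    assume eq: "frechet_derivative g0 (at x) (\<xi> x) = s *\<^sub>R e0 x"
    have lin: "linear (frechet_derivative g0 (at x))" by (rule smooth_on_linear_derivative[OF sm(3) x])
    have "frechet_derivative g0 (at x) (\<xi> x) = frechet_derivative g0 (at x) (s *\<^sub>R \<eta> x)"
      unfolding linear_scale[OF lin] g\<eta>[OF x] eq ..
    moreover have "inj (frechet_derivative g0 (at x))"
      using imm c(1) pt(1,2)[OF x] unfolding immersion_def g0_def by metis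
    ultimately have "\<xi> x = s *\<^sub>R \<eta> x" by (rule injD[rotated])
    then show False using indep[OF x] by (simp add: det2_linear)
  qed
  obtain V' H p q where V': "open V'" "coord c p0 \<in> V'" "V' \<subseteq> V" and smV': "smooth_on H V'" "smooth_on p V'" "smooth_on q V'"
    and pq: "\<And>x. x \<in> V' \<Longrightarrow> p x \<noteq> (0::real) \<and> q x \<noteq> (0::real)"
    and H: "\<And>x. x \<in> V' \<Longrightarrow> frechet_derivative H (at x) (\<xi> x) = p x *\<^sub>R g0 x"
      "\<And>x. x \<in> V' \<Longrightarrow> frechet_derivative H (at x) (\<eta> x) = q x *\<^sub>R e0 x"
    using local_primitive[OF V sm indep g\<eta> e\<xi>] by metis
  define U where "U = dom_chart c \<inter> coord c -` V'"
  have oU: "open U"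
    unfolding U_def
    by (rule continuous_open_preimage[OF _ smooth_atlasD(1)[OF A c(1)] V'(1)])
      (use smooth_atlasD(3)[OF A c(1)] in \<open>simp add: homeomorphism_def\<close>)
  have U: "p0 \<in> U" "U \<subseteq> points A" "U \<subseteq> dom_chart c"
    using c V'(2) by (auto simp: U_def points_def)
  define B where "B = restrict_atlas A U"
  \<comment> \<open>The restriction of \<open>c\<close> to \<open>U\<close> covers the whole
    restricted surface, as \<open>generating_data_of_primitive\<close> demands.\<close>
  define d where "d = (dom_chart c \<inter> U, coord c)"
  have B: "smooth_atlas B" unfolding B_def by (rule smooth_atlas_restrict[OF A oU])
  have dB: "d \<in> B" unfolding d_def B_def restrict_atlas_def using c(1) by force
  have ptsB: "points B \<subseteq> U" unfolding B_def points_def restrict_atlas_def by auto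
  have Upts: "U \<subseteq> points B"
    using dom_chart_subset_points[OF dB] U(3) by (simp add: d_def Int_absorb1)
  have domd: "points B \<subseteq> dom_chart d" using ptsB U(3) by (auto simp: d_def)
  have codd: "V' = cod_chart d"
    using V'(3) by (auto simp: d_def U_def V_def)
  have inV: "x \<in> V" if "x \<in> V'" for x using that V'(3) by blast
  note smB = smooth_on_subset[OF _ V'(3)]
  obtain h X' Y' where "generating_data B h X' Y'" and hX: "\<forall>r\<in>points B. pushforward B h X' r = g0 (coord d r)"
  proof (rule generating_data_of_primitive[OF B dB domd codd smB[OF sm(1)] smB[OF sm(2)] smB[OF sm(3)] smB[OF sm(4)] smV'])
    fix x assume x: "x \<in> V'"
    note r = pt(3)[OF inV[OF x]]
    show "g0 x \<bullet> g0 x = 1" "e0 x \<bullet> e0 x = 1" "g0 x \<bullet> e0 x = 0"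
      unfolding val using gg[OF r] EE[OF r] gE[OF r] by simp_all
    show "p x \<noteq> 0" "q x \<noteq> 0" using pq[OF x] by simp_all
    show "m0 x \<noteq> 0" unfolding val by (rule \<mu>0[OF r])
    show "frechet_derivative H (at x) (\<xi> x) = p x *\<^sub>R g0 x" "frechet_derivative H (at x) (\<eta> x) = q x *\<^sub>R e0 x"
      by (rule H[OF x])+
    show "frechet_derivative g0 (at x) (\<eta> x) = e0 x" by (rule g\<eta>[OF inV[OF x]])
    show "frechet_derivative e0 (at x) (\<xi> x) = - m0 x *\<^sub>R g0 x" by (rule e\<xi>[OF inV[OF x]])
    show "frechet_derivative g0 (at x) (\<xi> x) \<noteq> s *\<^sub>R e0 x" for s by (rule g\<xi>[OF inV[OF x]])
  qed (rule that)
  moreover have "g r = pushforward B h X' r" if r: "r \<in> U" for r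
  proof -
    have "g r = g0 (coord d r)"
      unfolding g0_def d_def using U(3) r by (simp add: in_chart_coord[OF A c(1)] subset_iff)
    then show ?thesis using bspec[OF hX subsetD[OF Upts r]] by simp
  qed
  ultimately show ?thesis
    using that[OF oU U(1,2)] unfolding B_def by blast
qed

theorem theorem7:
  fixes A :: "('p::{t2_space,second_countable_topology}) chart set"
    and n :: nat
  assumes "smooth_atlas A"
    and "n \<ge> 3"
    and "CARD('m::finite) = n + 1"
  shows "(\<forall>(h :: 'p \<Rightarrow> real^'m) X Y. generating_data A h X Y \<longrightarrow> type_D A (pushforward A h X)) \<and>
    (\<forall>g :: 'p \<Rightarrow> real^'m. type_D A g \<longrightarrow>
      (\<forall>p\<in>points A. \<exists>U. open U \<and> p \<in> U \<and> U \<subseteq> points A \<and>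
        (\<exists>(h :: 'p \<Rightarrow> real^'m) X Y. generating_data (restrict_atlas A U) h X Y \<and>
          (\<forall>q\<in>U. g q = pushforward (restrict_atlas A U) h X q))))"
proof (intro conjI allI impI ballI)
  show "type_D A (pushforward A h X)" if "generating_data A h X Y" for h :: "'p \<Rightarrow> real^'m" and X Y
    by (rule type_D_of_generating_data[OF assms(1) that])
  fix g :: "'p \<Rightarrow> real^'m" and p
  assume "type_D A g" "p \<in> points A"
  from generating_data_of_type_D[OF assms(1) this]
  obtain U h X Y where "open U" "p \<in> U" "U \<subseteq> points A" "generating_data (restrict_atlas A U) h X Y"
    "\<forall>r\<in>U. g r = pushforward (restrict_atlas A U) h X r"
    by metis
  then show "\<exists>U. open U \<and> p \<in> U \<and> U \<subseteq> points A \<and>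
        (\<exists>(h :: 'p \<Rightarrow> real^'m) X Y. generating_data (restrict_atlas A U) h X Y \<and>
          (\<forall>q\<in>U. g q = pushforward (restrict_atlas A U) h X q))"
    by blast
qed

end
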